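(* Let $Z\in\mathbb{D}^{1,2}$ have zero mean, let $g(Z)=E(\langle DZ,-DL^{-1}Z\rangle_{\mathfrak{H}}\mid Z)$, and fix $\alpha\geq0$ and $\beta>0$. Assume that (i) $g(Z)\leq\alpha Z+\beta$ almost surely; (ii) $Z$ has a density $\rho$. Then, for all $z>0$, we have $$P(Z\geq z)\leq\exp\left(-\frac{z^{2}}{2\alpha z+2\beta}\right).$$
   Context: $\mathfrak{H}$ is a real separable Hilbert space and $X=\{X(h):h\in\mathfrak{H}\}$ is a centered isonormal Gaussian process over $\mathfrak{H}$ on a probability space $(\Omega,\mathscr{F},P)$, i.e. a centered jointly Gaussian family with $E(X(h)X(k))=\langle h,k\rangle_{\mathfrak{H}}$; $\mathscr{F}$ is the $\sigma$-field generated by $X$. Malliavin derivative: for a smooth cylindrical variable $F=\psi(X(\phi_1),\ldots,X(\phi_n))$ ($\psi:\mathbb{R}^n\to\mathbb{R}$ smooth with compact support, $\phi_i\in\mathfrak{H}$), $DF=\sum_{i}\frac{\partial\psi}{\partial x_i}(X(\phi_1),\ldots,X(\phi_n))\phi_i\in L^2(\Omega,\mathfrak{H})$. $\mathbb{D}^{1,2}$ is the closure of the set of smooth cylindrical variables under the norm $\|F\|_{1,2}^2=E(F^2)+E(\|DF\|_{\mathfrak{H}}^2)$, and $D$ is extended to it by closure. $J_m$ is the orthogonal projection of $L^2(\Omega,\mathscr{F},P)$ onto the $m$-th Wiener chaos of $X$. For $Z\in L^2(\Omega,\mathscr{F},P)$, $L^{-1}Z=\sum_{m\ge1}-\frac1m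 J_m(Z)$, which lies in $\mathbb{D}^{1,2}$. "Density" means density of the law of $Z$ with respect to Lebesgue measure. *)

theory Defs
  imports "HOL-Probability.Probability"
begin

section \<open>Isonormal Gaussian processes\<close>

text \<open>Gaussian variables may be degenerate (variance \<open>0\<close>).\<close>

definition centered_gaussian :: "'a measure \<Rightarrow> ('a \<Rightarrow> real) \<Rightarrow> bool" where
  "centered_gaussian M Y \<longleftrightarrow> Y \<in> borel_measurable M \<and>
     ((AE \<omega> in M. Y \<omega> = 0) \<or> (\<exists>\<sigma>>0. distributed M lborel Y (normal_density 0 \<sigma>)))"

text \<open>The separable real Hilbert space is a type of class
  \<open>{real_inner, complete_space, second_countable_topology}\<close>: for a metric space, second
  countability is separability. The trivial space and finite-dimensional spaces are allowed.\<close>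

locale isonormal_gaussian_process = prob_space M
  for M :: "'a measure" +
  fixes X :: "'h::{real_inner, complete_space, second_countable_topology} \<Rightarrow> 'a \<Rightarrow> real"
  assumes jointly_gaussian:
      "\<And>(n::nat) (c :: nat \<Rightarrow> real) (h :: nat \<Rightarrow> 'h).
         centered_gaussian M (\<lambda>\<omega>. \<Sum>i<n. c i * X (h i) \<omega>)"
    and covariance: "\<And>h k. (\<integral>\<omega>. X h \<omega> * X k \<omega> \<partial>M) = inner h k"
    and generated: "sets M = sigma_sets (space M) {X h -` B \<inter> space M | h B. B \<in> sets borel}"

section \<open>Square-integrable functions and convergence in mean square\<close>

text \<open>Elements of \<open>L\<^sup>2\<close> are represented by functions, with no passage to almost-everywhere
  classes; the notions below are invariant under almost-everywhere modification.\<close>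

definition square_integrable :: "'a measure \<Rightarrow> ('a \<Rightarrow> 'b::real_normed_vector) \<Rightarrow> bool" where
  "square_integrable M f \<longleftrightarrow> f \<in> borel_measurable M \<and> integrable M (\<lambda>\<omega>. (norm (f \<omega>))\<^sup>2)"

definition L2_converges ::
    "'a measure \<Rightarrow> (nat \<Rightarrow> 'a \<Rightarrow> 'b::real_normed_vector) \<Rightarrow> ('a \<Rightarrow> 'b) \<Rightarrow> bool" where
  "L2_converges M S f \<longleftrightarrow> (\<lambda>n. \<integral>\<omega>. (norm (S n \<omega> - f \<omega>))\<^sup>2 \<partial>M) \<longlonglongrightarrow> 0"

section \<open>Smooth compactly supported functions on n-space\<close>

text \<open>A function of \<open>n\<close> real variables is represented by a function on \<open>nat \<Rightarrow> real\<close> that only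
  depends on the coordinates with index below \<open>n\<close>. For such functions, continuity with respect
  to the product topology on \<open>nat \<Rightarrow> real\<close> is ordinary continuity on \<open>n\<close>-space.\<close>

definition depends_on_first :: "nat \<Rightarrow> ((nat \<Rightarrow> real) \<Rightarrow> real) \<Rightarrow> bool" where
  "depends_on_first n \<psi> \<longleftrightarrow> (\<forall>x y. (\<forall>i<n. x i = y i) \<longrightarrow> \<psi> x = \<psi> y)"

definition partial_deriv :: "nat \<Rightarrow> ((nat \<Rightarrow> real) \<Rightarrow> real) \<Rightarrow> (nat \<Rightarrow> real) \<Rightarrow> real" where
  "partial_deriv i \<psi> x = deriv (\<lambda>t. \<psi> (x(i := t))) (x i)"

text \<open>\<open>C_class n k \<psi>\<close>: all iterated partial derivatives of \<open>\<psi>\<close> of order at most \<open>k\<close> exist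
  and are continuous.\<close>

primrec C_class :: "nat \<Rightarrow> nat \<Rightarrow> ((nat \<Rightarrow> real) \<Rightarrow> real) \<Rightarrow> bool" where
  "C_class n 0 \<psi> \<longleftrightarrow> continuous_on UNIV \<psi>"
| "C_class n (Suc k) \<psi> \<longleftrightarrow> continuous_on UNIV \<psi> \<and>
     (\<forall>i<n. (\<forall>x. (\<lambda>t. \<psi> (x(i := t))) field_differentiable at (x i)) \<and>
            C_class n k (partial_deriv i \<psi>))"

definition smooth_compact_support :: "nat \<Rightarrow> ((nat \<Rightarrow> real) \<Rightarrow> real) \<Rightarrow> bool" where
  "smooth_compact_support n \<psi> \<longleftrightarrow>
     depends_on_first n \<psi> \<and> (\<forall>k. C_class n k \<psi>) \<and>
     (\<exists>K. \<forall>x. \<psi> x \<noteq> 0 \<longrightarrow> (\<forall>i<n. \<bar>x i\<bar> \<le> K))"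

section \<open>The Malliavin derivative\<close>

text \<open>The derivative is taken as a relation because it is computed from a representation of the
  variable; its independence of the representation (almost surely) is a theorem.\<close>

definition smooth_cylindrical ::
    "('h::real_inner \<Rightarrow> 'a \<Rightarrow> real) \<Rightarrow> ('a \<Rightarrow> real) \<Rightarrow> ('a \<Rightarrow> 'h) \<Rightarrow> bool" where
  "smooth_cylindrical X F DF \<longleftrightarrow>
     (\<exists>n \<psi> \<phi>. n \<ge> 1 \<and> smooth_compact_support n \<psi> \<and>
        F = (\<lambda>\<omega>. \<psi> (\<lambda>j. X (\<phi> j) \<omega>)) \<and>
        DF = (\<lambda>\<omega>. \<Sum>i<n. partial_deriv i \<psi> (\<lambda>j. X (\<phi> j) \<omega>) *\<^sub>R \<phi> i))"

text \<open>The closure of the smooth cylindrical variables under the norm with square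
  \<open>E(F\<^sup>2) + E(\<parallel>DF\<parallel>\<^sup>2)\<close>, as the closure of the graph of the derivative.\<close>

definition has_malliavin_deriv ::
    "'a measure \<Rightarrow> ('h::real_inner \<Rightarrow> 'a \<Rightarrow> real) \<Rightarrow> ('a \<Rightarrow> real) \<Rightarrow> ('a \<Rightarrow> 'h) \<Rightarrow> bool" where
  "has_malliavin_deriv M X F U \<longleftrightarrow>
     square_integrable M F \<and> square_integrable M U \<and>
     (\<exists>S DS. (\<forall>n. smooth_cylindrical X (S n) (DS n)) \<and>
        L2_converges M S F \<and> L2_converges M DS U)"

definition D12 :: "'a measure \<Rightarrow> ('h::real_inner \<Rightarrow> 'a \<Rightarrow> real) \<Rightarrow> ('a \<Rightarrow> real) set" where
  "D12 M X = {F. \<exists>U. has_malliavin_deriv M X F U}"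

definition malliavin_deriv ::
    "'a measure \<Rightarrow> ('h::real_inner \<Rightarrow> 'a \<Rightarrow> real) \<Rightarrow> ('a \<Rightarrow> real) \<Rightarrow> 'a \<Rightarrow> 'h" where
  "malliavin_deriv M X F = (SOME U. has_malliavin_deriv M X F U)"

section \<open>Wiener chaos and the inverse of the Ornstein--Uhlenbeck generator\<close>

text \<open>Hermite polynomials in the probabilists' normalization.\<close>

fun hermite :: "nat \<Rightarrow> real \<Rightarrow> real" where
  "hermite 0 x = 1"
| "hermite (Suc 0) x = x"
| "hermite (Suc (Suc k)) x = x * hermite (Suc k) x - real (Suc k) * hermite k x"

text \<open>The \<open>m\<close>-th chaos is the closed linear span in \<open>L\<^sup>2\<close> of the variables \<open>H\<^sub>m(X(h))\<close> with \<open>h\<close> a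
  unit vector. For \<open>m = 0\<close> every generator is the constant \<open>1\<close>, so dropping the restriction to
  unit vectors there yields the constants also when the Hilbert space is trivial.\<close>

definition chaos_span ::
    "('h::real_inner \<Rightarrow> 'a \<Rightarrow> real) \<Rightarrow> nat \<Rightarrow> ('a \<Rightarrow> real) set" where
  "chaos_span X m =
     {F. \<exists>(n::nat) (c :: nat \<Rightarrow> real) (h :: nat \<Rightarrow> 'h).
           (m \<ge> 1 \<longrightarrow> (\<forall>i<n. norm (h i) = 1)) \<and>
           F = (\<lambda>\<omega>. \<Sum>i<n. c i * hermite m (X (h i) \<omega>))}"

definition wiener_chaos ::
    "'a measure \<Rightarrow> ('h::real_inner \<Rightarrow> 'a \<Rightarrow> real) \<Rightarrow> nat \<Rightarrow> ('a \<Rightarrow> real) set" where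
  "wiener_chaos M X m =
     {F. square_integrable M F \<and> (\<exists>S. (\<forall>n. S n \<in> chaos_span X m) \<and> L2_converges M S F)}"

text \<open>Orthogonal projection onto the \<open>m\<close>-th chaos (determined up to almost-sure equality).\<close>

definition chaos_proj ::
    "'a measure \<Rightarrow> ('h::real_inner \<Rightarrow> 'a \<Rightarrow> real) \<Rightarrow> nat \<Rightarrow> ('a \<Rightarrow> real) \<Rightarrow> 'a \<Rightarrow> real" where
  "chaos_proj M X m Z =
     (SOME Y. Y \<in> wiener_chaos M X m \<and>
        (\<forall>W \<in> wiener_chaos M X m. (\<integral>\<omega>. (Z \<omega> - Y \<omega>) * W \<omega> \<partial>M) = 0))"

definition L_inv ::
    "'a measure \<Rightarrow> ('h::real_inner \<Rightarrow> 'a \<Rightarrow> real) \<Rightarrow> ('a \<Rightarrow> real) \<Rightarrow> 'a \<Rightarrow> real" where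
  "L_inv M X Z =
     (SOME Y. square_integrable M Y \<and>
        L2_converges M (\<lambda>N \<omega>. \<Sum>m=1..N. - (1 / real m) * chaos_proj M X m Z \<omega>) Y)"

text \<open>The random variable \<open>g(Z)\<close>, the conditional expectation being with respect to the
  \<open>\<sigma>\<close>-field generated by \<open>Z\<close>.\<close>

definition g_of ::
    "'a measure \<Rightarrow> ('h::real_inner \<Rightarrow> 'a \<Rightarrow> real) \<Rightarrow> ('a \<Rightarrow> real) \<Rightarrow> 'a \<Rightarrow> real" where
  "g_of M X Z =
     real_cond_exp M (vimage_algebra (space M) Z borel)
       (\<lambda>\<omega>. inner (malliavin_deriv M X Z \<omega>) (- malliavin_deriv M X (L_inv M X Z) \<omega>))"

end

theory Submission
  imports Defs
begin

text \<open>
  Integration by parts for smooth cylindrical variables and the fact that the number operator is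
  multiplication by \<open>m\<close> on the \<open>m\<close>-th chaos give
  \<open>E(Z f(Z)) = E(f'(Z) \<langle>DZ, -DL\<^sup>-\<^sup>1Z\<rangle>) = E(f'(Z) g(Z))\<close> for smooth \<open>f\<close> with bounded derivative. If
  \<open>f' \<ge> 0\<close>, the right-hand side is at most \<open>E(f'(Z) (\<alpha>Z + \<beta>))\<close>. For
  \<open>f(x) = exp (\<theta> s(x))\<close>, where \<open>s\<close> is a smooth concave approximation of \<open>min x z\<close>, this is a
  differential inequality in \<open>\<theta>\<close> for the moment generating function of \<open>s(Z)\<close>. Integrating it,
  Markov's inequality with \<open>\<theta> = z / (\<alpha>z + \<beta>)\<close> gives the claim as \<open>s(x)\<close> tends to \<open>min x z\<close>.
\<close>

section \<open>Square-integrable functions\<close>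

text \<open>The function exp (\<theta>x) itself is out of reach: its derivative is unbounded, and
  finiteness of E exp (\<theta>Z) is not known beforehand. What closes the inequality is the
  concavity of the truncation s: on the left, s(x) \<le> x replaces Z by s(Z); on the right, x s'(x)
  \<le> s(x) - s(0) and s' \<le> 1 turn s'(Z) (\<alpha>Z + \<beta>) into \<alpha>s(Z) + \<beta> -
  \<alpha>s(0). Up to the error \<alpha>s(0), the logarithm of the moment generating function then
  grows at rate at most \<beta>\<theta> / (1 - \<alpha>\<theta>), and \<theta> = z / (\<alpha>z +
  \<beta>) is the point where this rate equals z. The other obstacle is that the derivative, the
  chaos projections and the inverse generator are given by choice. Identities are therefore proved
  for all pairs in the mean-square closure of the graph of the derivative, so that they hold for
  whichever element is chosen. That the chaoses exhaust the centred variables is derived from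
  uniqueness of characteristic functions, which fits a process given by its Gaussian linear
  combinations and the \<sigma>-algebra it generates.\<close>

definition msq :: "'a measure \<Rightarrow> ('a \<Rightarrow> 'b::real_normed_vector) \<Rightarrow> real" where
  "msq M f = (\<integral>\<omega>. (norm (f \<omega>))\<^sup>2 \<partial>M)"

lemma L2_converges_msq: "L2_converges M S f \<longleftrightarrow> (\<lambda>n. msq M (\<lambda>\<omega>. S n \<omega> - f \<omega>)) \<longlonglongrightarrow> 0"
  by (simp add: L2_converges_def msq_def)

lemma msq_nonneg [simp]: "0 \<le> msq M f"
  by (simp add: msq_def)

lemma msq_eq_inner: "msq M f = (\<integral>\<omega>. inner (f \<omega>) (f \<omega>) \<partial>M)" for f :: "'a \<Rightarrow> 'b::real_inner"
  by (simp add: msq_def power2_norm_eq_inner)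

lemma msq_minus_commute: "msq M (\<lambda>\<omega>. f \<omega> - g \<omega>) = msq M (\<lambda>\<omega>. g \<omega> - f \<omega>)"
  by (simp add: msq_def norm_minus_commute)

lemma norm_add_sq_le: "(norm (a + b))\<^sup>2 \<le> 2 * (norm a)\<^sup>2 + 2 * (norm b)\<^sup>2" for a b :: "'b::real_normed_vector"
proof -
  have "(norm (a + b))\<^sup>2 \<le> (norm a + norm b)\<^sup>2"
    by (intro power_mono norm_triangle_ineq) auto
  also have "\<dots> \<le> 2 * (norm a)\<^sup>2 + 2 * (norm b)\<^sup>2"
    using zero_le_power2[of "norm a - norm b"] by (simp add: power2_sum power2_diff)
  finally show ?thesis .
qed

lemma square_integrable_measurable [measurable_dest]:
  "square_integrable M f \<Longrightarrow> f \<in> borel_measurable M"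
  by (simp add: square_integrable_def)

lemma square_integrable_norm_sq: "square_integrable M f \<Longrightarrow> integrable M (\<lambda>\<omega>. (norm (f \<omega>))\<^sup>2)"
  by (simp add: square_integrable_def)

lemma square_integrable_bound:
  fixes f :: "'a \<Rightarrow> 'b::{real_normed_vector, second_countable_topology}" and g :: "'a \<Rightarrow> real"
  assumes [measurable]: "f \<in> borel_measurable M" and "integrable M g" and "AE \<omega> in M. (norm (f \<omega>))\<^sup>2 \<le> g \<omega>"
  shows "square_integrable M f"
  unfolding square_integrable_def
  by (intro conjI Bochner_Integration.integrable_bound[OF assms(2)] assms(1)) (use assms(3) in auto)

lemma square_integrable_add:
  fixes f g :: "'a \<Rightarrow> 'b::{real_normed_vector, second_countable_topology}"
  assumes [measurable]: "square_integrable M f" "square_integrable M g"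
  shows "square_integrable M (\<lambda>\<omega>. f \<omega> + g \<omega>)"
  by (rule square_integrable_bound[where g = "\<lambda>\<omega>. 2 * (norm (f \<omega>))\<^sup>2 + 2 * (norm (g \<omega>))\<^sup>2"])
    (use assms in \<open>auto simp: square_integrable_norm_sq norm_add_sq_le\<close>)

lemma square_integrable_scaleR:
  fixes f :: "'a \<Rightarrow> 'b::{real_normed_vector, second_countable_topology}"
  assumes [measurable]: "square_integrable M f"
  shows "square_integrable M (\<lambda>\<omega>. c *\<^sub>R f \<omega>)"
  using square_integrable_norm_sq[OF assms] assms
  by (auto simp: square_integrable_def power_mult_distrib)

lemma square_integrable_mult:
  fixes f :: "'a \<Rightarrow> real"
  shows "square_integrable M f \<Longrightarrow> square_integrable M (\<lambda>\<omega>. c * f \<omega>)"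
  using square_integrable_scaleR[of M f c] by simp

lemma square_integrable_uminus:
  fixes f :: "'a \<Rightarrow> 'b::{real_normed_vector, second_countable_topology}"
  shows "square_integrable M f \<Longrightarrow> square_integrable M (\<lambda>\<omega>. - f \<omega>)"
  using square_integrable_scaleR[of M f "-1"] by simp

lemma square_integrable_diff:
  fixes f g :: "'a \<Rightarrow> 'b::{real_normed_vector, second_countable_topology}"
  shows "square_integrable M f \<Longrightarrow> square_integrable M g \<Longrightarrow> square_integrable M (\<lambda>\<omega>. f \<omega> - g \<omega>)"
  using square_integrable_add[of M f "\<lambda>\<omega>. - g \<omega>"] square_integrable_uminus[of M g] by simp

lemma square_integrable_zero [simp]: "square_integrable M (\<lambda>\<omega>. 0)"
  by (simp add: square_integrable_def)

lemma square_integrable_sum: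
  fixes f :: "'i \<Rightarrow> 'a \<Rightarrow> 'b::{real_normed_vector, second_countable_topology}"
  shows "(\<And>i. i \<in> I \<Longrightarrow> square_integrable M (f i)) \<Longrightarrow> square_integrable M (\<lambda>\<omega>. \<Sum>i\<in>I. f i \<omega>)"
  by (induction I rule: infinite_finite_induct) (auto intro: square_integrable_add)

lemma abs_inner_le_sq: "\<bar>inner a b\<bar> \<le> (norm a)\<^sup>2 + (norm b)\<^sup>2" for a b :: "'b::real_inner"
proof -
  have "\<bar>inner a b\<bar> \<le> norm a * norm b" by (rule Cauchy_Schwarz_ineq2)
  also have "\<dots> \<le> (norm a)\<^sup>2 + (norm b)\<^sup>2"
    using zero_le_power2[of "norm a - norm b"] zero_le_power2[of "norm a"] zero_le_power2[of "norm b"]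
    unfolding power2_diff by linarith
  finally show ?thesis .
qed

lemma integrable_inner:
  fixes f g :: "'a \<Rightarrow> 'b::{real_inner, second_countable_topology}"
  assumes [measurable]: "square_integrable M f" "square_integrable M g"
  shows "integrable M (\<lambda>\<omega>. inner (f \<omega>) (g \<omega>))"
  by (rule Bochner_Integration.integrable_bound[where f = "\<lambda>\<omega>. (norm (f \<omega>))\<^sup>2 + (norm (g \<omega>))\<^sup>2"])
    (use assms in \<open>auto simp: square_integrable_norm_sq abs_inner_le_sq\<close>)

lemma integrable_mult_sq:
  fixes f g :: "'a \<Rightarrow> real"
  assumes "square_integrable M f" "square_integrable M g"
  shows "integrable M (\<lambda>\<omega>. f \<omega> * g \<omega>)"
  using integrable_inner[OF assms] by simp

lemma msq_add_le:
  fixes f g :: "'a \<Rightarrow> 'b::{real_normed_vector, second_countable_topology}"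
  assumes "square_integrable M f" "square_integrable M g"
  shows "msq M (\<lambda>\<omega>. f \<omega> + g \<omega>) \<le> 2 * msq M f + 2 * msq M g"
proof -
  have "msq M (\<lambda>\<omega>. f \<omega> + g \<omega>) \<le> (\<integral>\<omega>. 2 * (norm (f \<omega>))\<^sup>2 + 2 * (norm (g \<omega>))\<^sup>2 \<partial>M)"
    unfolding msq_def using assms square_integrable_add[OF assms]
    by (intro integral_mono) (auto simp: square_integrable_norm_sq norm_add_sq_le)
  then show ?thesis
    using assms by (simp add: msq_def square_integrable_norm_sq)
qed

lemma msq_diff_le:
  fixes f g h :: "'a \<Rightarrow> 'b::{real_normed_vector, second_countable_topology}"
  assumes "square_integrable M f" "square_integrable M g" "square_integrable M h"
  shows "msq M (\<lambda>\<omega>. f \<omega> - h \<omega>) \<le> 2 * msq M (\<lambda>\<omega>. f \<omega> - g \<omega>) + 2 * msq M (\<lambda>\<omega>. g \<omega> - h \<omega>)"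
  using msq_add_le[of M "\<lambda>\<omega>. f \<omega> - g \<omega>" "\<lambda>\<omega>. g \<omega> - h \<omega>"] assms
  by (simp add: square_integrable_diff)

lemma msq_scaleR: "msq M (\<lambda>\<omega>. c *\<^sub>R f \<omega>) = c\<^sup>2 * msq M f"
  by (simp add: msq_def power_mult_distrib)

lemma msq_add:
  fixes f g :: "'a \<Rightarrow> 'b::{real_inner, second_countable_topology}"
  assumes "square_integrable M f" "square_integrable M g"
  shows "msq M (\<lambda>\<omega>. f \<omega> + g \<omega>) = msq M f + 2 * (\<integral>\<omega>. inner (f \<omega>) (g \<omega>) \<partial>M) + msq M g"
  unfolding msq_eq_inner
  by (simp add: inner_add_left inner_add_right inner_commute[of "g _" "f _"] integrable_inner assms)

lemma msq_diff:
  fixes f g :: "'a \<Rightarrow> 'b::{real_inner, second_countable_topology}"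
  assumes "square_integrable M f" "square_integrable M g"
  shows "msq M (\<lambda>\<omega>. f \<omega> - g \<omega>) = msq M f - 2 * (\<integral>\<omega>. inner (f \<omega>) (g \<omega>) \<partial>M) + msq M g"
  unfolding msq_eq_inner
  by (simp add: inner_diff_left inner_diff_right inner_commute[of "g _" "f _"] integrable_inner assms)

text \<open>The mean square of f + t g is a nonnegative polynomial in t of degree at most 2, which
  bounds its linear coefficient. If g has mean square 0 the polynomial is affine and the linear
  coefficient has to vanish.\<close>

lemma integral_inner_Cauchy_Schwarz:
  fixes f g :: "'a \<Rightarrow> 'b::{real_inner, second_countable_topology}"
  assumes "square_integrable M f" "square_integrable M g"
  shows "\<bar>\<integral>\<omega>. inner (f \<omega>) (g \<omega>) \<partial>M\<bar> \<le> sqrt (msq M f * msq M g)"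
proof -
  define c where "c = (\<integral>\<omega>. inner (f \<omega>) (g \<omega>) \<partial>M)"
  have q: "0 \<le> msq M f + 2 * t * c + t\<^sup>2 * msq M g" for t
    using msq_add[OF assms(1) square_integrable_scaleR[OF assms(2), of t]] msq_nonneg[of M "\<lambda>\<omega>. f \<omega> + t *\<^sub>R g \<omega>"]
    by (simp add: msq_scaleR c_def mult.assoc)
  have "c\<^sup>2 \<le> msq M f * msq M g"
  proof (cases "msq M g = 0")
    case True
    have "c = 0"
    proof (rule ccontr)
      assume "c \<noteq> 0"
      then show False
        \<comment> \<open>At this t the affine polynomial takes the value -1.\<close>
        using q[of "- (msq M f + 1) / (2 * c)"] True by (simp add: field_simps)
    qed
    then show ?thesis by simp
  next
    case False
    then have p: "msq M g > 0" using msq_nonneg[of M g] by linarith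
    have "0 \<le> msq M f - c\<^sup>2 / msq M g"
      \<comment> \<open>This t minimizes the quadratic polynomial.\<close>
      using q[of "- c / msq M g"] p by (simp add: power2_eq_square field_simps)
    then show ?thesis using p by (simp add: field_simps)
  qed
  then have "sqrt (c\<^sup>2) \<le> sqrt (msq M f * msq M g)" by (rule real_sqrt_le_mono)
  then show ?thesis by (simp add: c_def)
qed

text \<open>The difference of the integrands splits into the inner products of S - f with T - g, of
  f with T - g, and of S - f with g; Cauchy-Schwarz bounds each by mean squares that tend to
  0.\<close>

lemma L2_converges_inner:
  fixes S T :: "nat \<Rightarrow> 'a \<Rightarrow> 'b::{real_inner, second_countable_topology}"
  assumes S: "\<And>n. square_integrable M (S n)" "square_integrable M f" "L2_converges M S f"
    and T: "\<And>n. square_integrable M (T n)" "square_integrable M g" "L2_converges M T g"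
  shows "(\<lambda>n. \<integral>\<omega>. inner (S n \<omega>) (T n \<omega>) \<partial>M) \<longlonglongrightarrow> (\<integral>\<omega>. inner (f \<omega>) (g \<omega>) \<partial>M)"
proof -
  let ?a = "\<lambda>n. msq M (\<lambda>\<omega>. S n \<omega> - f \<omega>)" and ?b = "\<lambda>n. msq M (\<lambda>\<omega>. T n \<omega> - g \<omega>)"
  have a: "?a \<longlonglongrightarrow> 0" and b: "?b \<longlonglongrightarrow> 0" using S T by (auto simp: L2_converges_msq)
  have dS: "square_integrable M (\<lambda>\<omega>. S n \<omega> - f \<omega>)" and dT: "square_integrable M (\<lambda>\<omega>. T n \<omega> - g \<omega>)" for n
    using S T by (auto intro: square_integrable_diff)
  have "(\<lambda>n. (\<integral>\<omega>. inner (S n \<omega>) (T n \<omega>) \<partial>M) - (\<integral>\<omega>. inner (f \<omega>) (g \<omega>) \<partial>M)) \<longlonglongrightarrow> 0"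
  proof (rule Lim_null_comparison)
    show "\<forall>\<^sub>F n in sequentially. norm ((\<integral>\<omega>. inner (S n \<omega>) (T n \<omega>) \<partial>M) - (\<integral>\<omega>. inner (f \<omega>) (g \<omega>) \<partial>M))
        \<le> sqrt (?a n * ?b n) + sqrt (msq M f * ?b n) + sqrt (?a n * msq M g)"
    proof (intro always_eventually allI)
      fix n
      have "(\<integral>\<omega>. inner (S n \<omega>) (T n \<omega>) \<partial>M) - (\<integral>\<omega>. inner (f \<omega>) (g \<omega>) \<partial>M)
         = (\<integral>\<omega>. inner (S n \<omega> - f \<omega>) (T n \<omega> - g \<omega>) \<partial>M) + (\<integral>\<omega>. inner (f \<omega>) (T n \<omega> - g \<omega>) \<partial>M)
           + (\<integral>\<omega>. inner (S n \<omega> - f \<omega>) (g \<omega>) \<partial>M)"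
        by (simp add: inner_diff_left inner_diff_right integrable_inner S T)
      then show "norm ((\<integral>\<omega>. inner (S n \<omega>) (T n \<omega>) \<partial>M) - (\<integral>\<omega>. inner (f \<omega>) (g \<omega>) \<partial>M))
        \<le> sqrt (?a n * ?b n) + sqrt (msq M f * ?b n) + sqrt (?a n * msq M g)"
        using integral_inner_Cauchy_Schwarz[OF dS dT, of n n] integral_inner_Cauchy_Schwarz[OF S(2) dT, of n]
          integral_inner_Cauchy_Schwarz[OF dS T(2), of n] unfolding real_norm_def by linarith
    qed
    show "(\<lambda>n. sqrt (?a n * ?b n) + sqrt (msq M f * ?b n) + sqrt (?a n * msq M g)) \<longlonglongrightarrow> 0"
      by (rule tendsto_eq_intros a b refl | simp)+
  qed
  then show ?thesis by (rule LIM_zero_cancel)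
qed

lemma L2_converges_const: "L2_converges M (\<lambda>n. f) f"
  by (simp add: L2_converges_def)

lemma L2_converges_inner_left:
  fixes S :: "nat \<Rightarrow> 'a \<Rightarrow> 'b::{real_inner, second_countable_topology}"
  assumes "\<And>n. square_integrable M (S n)" "square_integrable M f" "L2_converges M S f" "square_integrable M g"
  shows "(\<lambda>n. \<integral>\<omega>. inner (S n \<omega>) (g \<omega>) \<partial>M) \<longlonglongrightarrow> (\<integral>\<omega>. inner (f \<omega>) (g \<omega>) \<partial>M)"
  using L2_converges_inner[OF assms(1-3) assms(4) assms(4) L2_converges_const] .

lemma L2_converges_mult_left:
  fixes S :: "nat \<Rightarrow> 'a \<Rightarrow> real"
  assumes "\<And>n. square_integrable M (S n)" "square_integrable M f" "L2_converges M S f" "square_integrable M g"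
  shows "(\<lambda>n. \<integral>\<omega>. S n \<omega> * g \<omega> \<partial>M) \<longlonglongrightarrow> (\<integral>\<omega>. f \<omega> * g \<omega> \<partial>M)"
  using L2_converges_inner_left[OF assms] by simp

lemma L2_converges_add:
  fixes S T :: "nat \<Rightarrow> 'a \<Rightarrow> 'b::{real_normed_vector, second_countable_topology}"
  assumes S: "\<And>n. square_integrable M (S n)" "square_integrable M f" "L2_converges M S f"
    and T: "\<And>n. square_integrable M (T n)" "square_integrable M g" "L2_converges M T g"
  shows "L2_converges M (\<lambda>n \<omega>. S n \<omega> + T n \<omega>) (\<lambda>\<omega>. f \<omega> + g \<omega>)"
  unfolding L2_converges_msq
proof (rule Lim_null_comparison)
  show "\<forall>\<^sub>F n in sequentially. norm (msq M (\<lambda>\<omega>. S n \<omega> + T n \<omega> - (f \<omega> + g \<omega>)))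
      \<le> 2 * msq M (\<lambda>\<omega>. S n \<omega> - f \<omega>) + 2 * msq M (\<lambda>\<omega>. T n \<omega> - g \<omega>)"
    using msq_add_le[OF square_integrable_diff[OF S(1) S(2)] square_integrable_diff[OF T(1) T(2)]]
    by (simp add: algebra_simps)
  show "(\<lambda>n. 2 * msq M (\<lambda>\<omega>. S n \<omega> - f \<omega>) + 2 * msq M (\<lambda>\<omega>. T n \<omega> - g \<omega>)) \<longlonglongrightarrow> 0"
    using S(3) T(3) unfolding L2_converges_msq
    by (auto intro!: tendsto_eq_intros)
qed

lemma L2_converges_scaleR:
  assumes "L2_converges M S f"
  shows "L2_converges M (\<lambda>n \<omega>. c *\<^sub>R S n \<omega>) (\<lambda>\<omega>. c *\<^sub>R f \<omega>)"
  using assms unfolding L2_converges_msq scaleR_diff_right[symmetric] msq_scaleR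
  by (auto intro!: tendsto_eq_intros)

text \<open>Closure by sequences, the form in which the chaos and the derivative are defined, so
  that both become instances of it. It acts on functions rather than on almost-everywhere
  classes.\<close>

definition L2_closure :: "'a measure \<Rightarrow> ('a \<Rightarrow> 'b::real_normed_vector) set \<Rightarrow> ('a \<Rightarrow> 'b) set" where
  "L2_closure M A = {F. square_integrable M F \<and> (\<exists>S. (\<forall>n. S n \<in> A) \<and> L2_converges M S F)}"

lemma L2_closureI:
  assumes "square_integrable M F" "\<And>e. e > 0 \<Longrightarrow> \<exists>S\<in>A. msq M (\<lambda>\<omega>. S \<omega> - F \<omega>) < e"
  shows "F \<in> L2_closure M A"
proof -
  have "\<forall>n. \<exists>S. S \<in> A \<and> msq M (\<lambda>\<omega>. S \<omega> - F \<omega>) < inverse (real (Suc n))"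
    using assms(2) by (meson inverse_positive_iff_positive of_nat_0_less_iff zero_less_Suc)
  then obtain S where S: "\<And>n. S n \<in> A" "\<And>n. msq M (\<lambda>\<omega>. S n \<omega> - F \<omega>) < inverse (real (Suc n))"
    by metis
  have "L2_converges M S F"
    unfolding L2_converges_msq
    by (rule Lim_null_comparison[OF _ LIMSEQ_inverse_real_of_nat])
      (use S(2) in \<open>auto intro!: always_eventually less_imp_le\<close>)
  then show ?thesis using assms(1) S(1) by (auto simp: L2_closure_def)
qed

lemma L2_closureD:
  assumes "F \<in> L2_closure M A" "e > 0"
  obtains S where "S \<in> A" "msq M (\<lambda>\<omega>. S \<omega> - F \<omega>) < e"
proof -
  obtain S where S: "\<And>n. S n \<in> A" "L2_converges M S F" using assms by (auto simp: L2_closure_def)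
  then have "\<forall>\<^sub>F n in sequentially. msq M (\<lambda>\<omega>. S n \<omega> - F \<omega>) < e"
    using assms(2) unfolding L2_converges_msq by (auto dest: order_tendstoD)
  then obtain n where "msq M (\<lambda>\<omega>. S n \<omega> - F \<omega>) < e" by (auto simp: eventually_sequentially)
  then show thesis using that S by blast
qed

lemma L2_closure_square_integrable: "F \<in> L2_closure M A \<Longrightarrow> square_integrable M F"
  by (simp add: L2_closure_def)

lemma L2_closure_idem:
  fixes A :: "('a \<Rightarrow> 'b::{real_normed_vector, second_countable_topology}) set"
  assumes A: "\<And>S. S \<in> A \<Longrightarrow> square_integrable M S" and F: "F \<in> L2_closure M (L2_closure M A)"
  shows "F \<in> L2_closure M A"
proof (rule L2_closureI)
  show F2: "square_integrable M F" using F by (rule L2_closure_square_integrable)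
  fix e :: real assume e: "e > 0"
  \<comment> \<open>Errors below e/4 suffice, because the triangle inequality for mean squares
    carries a factor 2.\<close>
  obtain G where G: "G \<in> L2_closure M A" "msq M (\<lambda>\<omega>. G \<omega> - F \<omega>) < e / 4"
    using L2_closureD[OF F, of "e/4"] e by auto
  obtain S where S: "S \<in> A" "msq M (\<lambda>\<omega>. S \<omega> - G \<omega>) < e / 4"
    using L2_closureD[OF G(1), of "e/4"] e by auto
  have "msq M (\<lambda>\<omega>. S \<omega> - F \<omega>) < e"
    using msq_diff_le[OF A[OF S(1)] L2_closure_square_integrable[OF G(1)] F2] G(2) S(2) by linarith
  then show "\<exists>S\<in>A. msq M (\<lambda>\<omega>. S \<omega> - F \<omega>) < e" using S(1) by blast
qed

lemma L2_closure_incl: "F \<in> A \<Longrightarrow> square_integrable M F \<Longrightarrow> F \<in> L2_closure M A"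
  by (rule L2_closureI) (auto simp: msq_def intro!: bexI[of _ F])

text \<open>Reduces an inclusion of closures to the approximation of generators. This is how
  polynomial variables, which are not compactly supported, enter the domain of the
  derivative.\<close>

lemma L2_closure_mono_closure:
  fixes A B :: "('a \<Rightarrow> 'b::{real_normed_vector, second_countable_topology}) set"
  assumes "\<And>S. S \<in> B \<Longrightarrow> square_integrable M S" "A \<subseteq> L2_closure M B"
  shows "L2_closure M A \<subseteq> L2_closure M B"
proof
  fix F assume "F \<in> L2_closure M A"
  then have "F \<in> L2_closure M (L2_closure M B)" using assms(2) by (auto simp: L2_closure_def)
  then show "F \<in> L2_closure M B" using L2_closure_idem[OF assms(1)] by blast
qed

lemma L2_closure_add:
  fixes A :: "('a \<Rightarrow> 'b::{real_normed_vector, second_countable_topology}) set"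
  assumes A: "\<And>S. S \<in> A \<Longrightarrow> square_integrable M S" "\<And>S T. S \<in> A \<Longrightarrow> T \<in> A \<Longrightarrow> (\<lambda>\<omega>. S \<omega> + T \<omega>) \<in> A"
    and F: "F \<in> L2_closure M A" and G: "G \<in> L2_closure M A"
  shows "(\<lambda>\<omega>. F \<omega> + G \<omega>) \<in> L2_closure M A"
proof -
  obtain S T where S: "\<And>n. S n \<in> A" "L2_converges M S F" "square_integrable M F"
    and T: "\<And>n. T n \<in> A" "L2_converges M T G" "square_integrable M G"
    using F G by (auto simp: L2_closure_def)
  have "L2_converges M (\<lambda>n \<omega>. S n \<omega> + T n \<omega>) (\<lambda>\<omega>. F \<omega> + G \<omega>)"
    by (intro L2_converges_add S T A(1))
  then show ?thesis
    unfolding L2_closure_def using S T A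
    by (auto intro!: square_integrable_add exI[of _ "\<lambda>n \<omega>. S n \<omega> + T n \<omega>"])
qed

lemma L2_closure_scaleR:
  fixes A :: "('a \<Rightarrow> 'b::{real_normed_vector, second_countable_topology}) set"
  assumes A: "\<And>S. S \<in> A \<Longrightarrow> (\<lambda>\<omega>. c *\<^sub>R S \<omega>) \<in> A" and F: "F \<in> L2_closure M A"
  shows "(\<lambda>\<omega>. c *\<^sub>R F \<omega>) \<in> L2_closure M A"
proof -
  obtain S where S: "\<And>n. S n \<in> A" "L2_converges M S F" "square_integrable M F"
    using F by (auto simp: L2_closure_def)
  then have "L2_converges M (\<lambda>n \<omega>. c *\<^sub>R S n \<omega>) (\<lambda>\<omega>. c *\<^sub>R F \<omega>)"
    by (intro L2_converges_scaleR)
  then show ?thesis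
    unfolding L2_closure_def using S A
    by (auto intro!: square_integrable_scaleR exI[of _ "\<lambda>n \<omega>. c *\<^sub>R S n \<omega>"])
qed

text \<open>Pointwise, x \<le> t x^2 + 1/t for nonnegative x. The weight t stays free: for mean
  squares of order 4^-k, the choice t = 2^k makes both terms of order 2^-k.\<close>

lemma (in prob_space) integral_norm_le_msq:
  fixes f :: "'a \<Rightarrow> 'b::{real_normed_vector, second_countable_topology}"
  assumes f: "square_integrable M f" and t: "t > 0"
  shows "integrable M (\<lambda>\<omega>. norm (f \<omega>))" and "(\<integral>\<omega>. norm (f \<omega>) \<partial>M) \<le> t * msq M f + 1 / t"
proof -
  have [measurable]: "f \<in> borel_measurable M" using f by auto
  have le: "norm (f \<omega>) \<le> s * (norm (f \<omega>))\<^sup>2 + 1 / s" if "s > 0" for \<omega> s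
  proof -
    have "0 \<le> (s * norm (f \<omega>) - 1)\<^sup>2 + s * norm (f \<omega>)" using that by simp
    then have "s * norm (f \<omega>) \<le> s * (s * (norm (f \<omega>))\<^sup>2 + 1 / s)"
      using that by (simp add: power2_eq_square algebra_simps)
    then show ?thesis using that by simp
  qed
  have i: "integrable M (\<lambda>\<omega>. t * (norm (f \<omega>))\<^sup>2 + 1 / t)"
    using f by (simp add: square_integrable_norm_sq)
  show 1: "integrable M (\<lambda>\<omega>. norm (f \<omega>))"
    by (rule Bochner_Integration.integrable_bound[OF i]) (use le[OF t] t in \<open>auto\<close>)
  have "(\<integral>\<omega>. norm (f \<omega>) \<partial>M) \<le> (\<integral>\<omega>. t * (norm (f \<omega>))\<^sup>2 + 1 / t \<partial>M)"
    by (rule integral_mono[OF 1 i le[OF t]])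
  also have "\<dots> = t * msq M f + 1 / t"
    using f by (simp add: square_integrable_norm_sq msq_def prob_space)
  finally show "(\<integral>\<omega>. norm (f \<omega>) \<partial>M) \<le> t * msq M f + 1 / t" .
qed

lemma Cauchy_of_summable_steps:
  fixes s :: "nat \<Rightarrow> 'b::real_normed_vector"
  assumes "summable (\<lambda>k. norm (s (Suc k) - s k))"
  shows "Cauchy s"
proof -
  let ?a = "\<lambda>n. \<Sum>k<n. norm (s (Suc k) - s k)"
  have step: "norm (s n - s m) \<le> ?a n - ?a m" if "m \<le> n" for m n
    using that
  proof (induction n rule: dec_induct)
    case (step n)
    have "norm (s (Suc n) - s m) \<le> norm (s (Suc n) - s n) + norm (s n - s m)"
      using norm_triangle_ineq[of "s (Suc n) - s n" "s n - s m"] by simp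
    with step show ?case by simp
  qed simp
  have C: "Cauchy ?a"
    using assms by (intro convergent_Cauchy) (simp add: summable_iff_convergent)
  show ?thesis
  proof (rule metric_CauchyI)
    fix e :: real assume "e > 0"
    then obtain N where N: "\<And>m n. m \<ge> N \<Longrightarrow> n \<ge> N \<Longrightarrow> dist (?a m) (?a n) < e"
      using metric_CauchyD[OF C] by blast
    have "dist (s m) (s n) < e" if "m \<ge> N" "n \<ge> N" for m n
    proof (cases "m \<le> n")
      case True
      then show ?thesis using step[OF True] N[OF that]
        by (simp add: dist_norm norm_minus_commute)
    next
      case False
      then show ?thesis using step[of n m] N[OF that]
        by (simp add: dist_norm norm_minus_commute)
    qed
    then show "\<exists>N. \<forall>m\<ge>N. \<forall>n\<ge>N. dist (s m) (s n) < e" by blast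
  qed
qed

text \<open>Riesz-Fischer for vector-valued functions: along a subsequence whose successive mean
  squares are below 4^-k the steps are summable almost surely, and Fatou's lemma transfers the
  Cauchy estimate to the pointwise limit.\<close>

lemma (in prob_space) L2_complete:
  fixes S :: "nat \<Rightarrow> 'a \<Rightarrow> 'b::{real_normed_vector, complete_space, second_countable_topology}"
  assumes S: "\<And>n. square_integrable M (S n)"
    and C: "\<And>e. e > 0 \<Longrightarrow> \<exists>N. \<forall>m\<ge>N. \<forall>n\<ge>N. msq M (\<lambda>\<omega>. S m \<omega> - S n \<omega>) < e"
  obtains f where "square_integrable M f" "L2_converges M S f"
proof -
  have [measurable]: "S n \<in> borel_measurable M" for n using S by auto
  have "\<forall>k. \<exists>N. \<forall>m\<ge>N. \<forall>n\<ge>N. msq M (\<lambda>\<omega>. S m \<omega> - S n \<omega>) < (1/4)^k"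
    using C by (auto simp: zero_less_power)
  then obtain N where N: "\<And>k m n. m \<ge> N k \<Longrightarrow> n \<ge> N k \<Longrightarrow> msq M (\<lambda>\<omega>. S m \<omega> - S n \<omega>) < (1/4)^k"
    by metis
  \<comment> \<open>The summand \<open>k\<close> makes \<open>r\<close> dominate the identity;
    summing over all \<open>i \<le> k\<close> makes it both monotone and at least
    \<open>N k\<close>.\<close>
  define r where "r k = k + (\<Sum>i\<le>k. N i)" for k
  have r1: "r k \<ge> N k" "r k \<ge> k" for k
    using member_le_sum[of k "{..k}" N] by (auto simp: r_def)
  have r2: "r l \<ge> r k" if "k \<le> l" for k l
    unfolding r_def using that by (intro add_mono sum_mono2) auto
  define D where "D k \<omega> = norm (S (r (Suc k)) \<omega> - S (r k) \<omega>)" for k \<omega>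
  have [measurable]: "D k \<in> borel_measurable M" for k unfolding D_def by measurable
  have Ds: "square_integrable M (\<lambda>\<omega>. S (r (Suc k)) \<omega> - S (r k) \<omega>)" for k
    by (intro square_integrable_diff S)
  have Di: "integrable M (D k)" for k
    unfolding D_def by (rule integral_norm_le_msq[OF Ds, of 1]) simp
  have Db: "(\<integral>\<omega>. D k \<omega> \<partial>M) \<le> 2 * (1/2)^k" for k
  proof -
    have "(\<integral>\<omega>. D k \<omega> \<partial>M) \<le> 2^k * msq M (\<lambda>\<omega>. S (r (Suc k)) \<omega> - S (r k) \<omega>) + 1 / 2^k"
      unfolding D_def by (rule integral_norm_le_msq[OF Ds]) simp
    also have "\<dots> \<le> 2^k * (1/4)^k + 1/2^k"
      using N[of k "r (Suc k)" "r k"] r1[of k] r2[of k "Suc k"] by (intro add_mono mult_left_mono) auto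
    also have "\<dots> = 2 * (1/2)^k"
      by (simp add: power_divide flip: power_mult_distrib) (simp add: field_simps power_mult_distrib flip: power_mult_distrib)
    finally show ?thesis .
  qed
  have "(\<integral>\<^sup>+\<omega>. (\<Sum>k. ennreal (D k \<omega>)) \<partial>M) = (\<Sum>k. \<integral>\<^sup>+\<omega>. ennreal (D k \<omega>) \<partial>M)"
    by (rule nn_integral_suminf) simp
  also have "\<dots> = (\<Sum>k. ennreal (\<integral>\<omega>. D k \<omega> \<partial>M))"
    by (intro suminf_cong nn_integral_eq_integral Di) (simp add: D_def)
  also have "\<dots> \<le> (\<Sum>k. ennreal (2 * (1/2)^k))"
    by (intro suminf_le ennreal_leI Db) auto
  also have "\<dots> = ennreal (\<Sum>k. 2 * (1/2)^k)"
    by (intro suminf_ennreal2) (auto intro!: summable_mult summable_geometric)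
  also have "\<dots> < \<infinity>" by simp
  finally have "AE \<omega> in M. (\<Sum>k. ennreal (D k \<omega>)) \<noteq> \<infinity>"
    by (intro nn_integral_PInf_AE) auto
  then have "AE \<omega> in M. summable (\<lambda>k. D k \<omega>)"
    by eventually_elim (auto intro!: summable_suminf_not_top simp: D_def)
  then have ae: "AE \<omega> in M. Cauchy (\<lambda>k. S (r k) \<omega>)"
    by eventually_elim (rule Cauchy_of_summable_steps, simp add: D_def)
  \<comment> \<open>Set to 0 where the subsequence is not Cauchy, so that the limit exists at every
    point and is measurable.\<close>
  define T where "T k \<omega> = (if Cauchy (\<lambda>k. S (r k) \<omega>) then S (r k) \<omega> else 0)" for k \<omega>
  have [measurable]: "Measurable.pred M (\<lambda>\<omega>. Cauchy (\<lambda>k. S (r k) \<omega>))"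
    by (simp add: pred_def)
  have Tm [measurable]: "T k \<in> borel_measurable M" for k unfolding T_def by measurable
  have "convergent (\<lambda>k. T k \<omega>)" for \<omega>
    by (cases "Cauchy (\<lambda>k. S (r k) \<omega>)") (simp_all add: T_def Cauchy_convergent convergent_const)
  then have Tlim: "(\<lambda>k. T k \<omega>) \<longlonglongrightarrow> lim (\<lambda>k. T k \<omega>)" for \<omega>
    by (simp add: convergent_LIMSEQ_iff)
  define f where "f \<omega> = lim (\<lambda>k. T k \<omega>)" for \<omega>
  have [measurable]: "f \<in> borel_measurable M"
    by (rule borel_measurable_LIMSEQ_metric[where f = T]) (simp_all add: f_def Tlim)
  have conv: "AE \<omega> in M. (\<lambda>k. S (r k) \<omega>) \<longlonglongrightarrow> f \<omega>"
    using ae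
  proof eventually_elim
    case (elim \<omega>)
    then show ?case using Tlim[of \<omega>] by (simp add: T_def f_def)
  qed
  \<comment> \<open>The index is shifted by \<open>L\<close> so that every member of the subsequence
    lies in the range where the assumed estimate holds.\<close>
  have fatou: "(\<integral>\<^sup>+\<omega>. ennreal ((norm (S n \<omega> - f \<omega>))\<^sup>2) \<partial>M) \<le> ennreal e"
    if e: "e > 0" and n: "\<And>m. m \<ge> L \<Longrightarrow> msq M (\<lambda>\<omega>. S n \<omega> - S m \<omega>) < e" for e n L
  proof -
    have "(\<integral>\<^sup>+\<omega>. ennreal ((norm (S n \<omega> - f \<omega>))\<^sup>2) \<partial>M) =
        (\<integral>\<^sup>+\<omega>. liminf (\<lambda>k. ennreal ((norm (S n \<omega> - S (r (k + L)) \<omega>))\<^sup>2)) \<partial>M)"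
    proof (rule nn_integral_cong_AE, use conv in eventually_elim)
      case (elim \<omega>)
      have "(\<lambda>k. S (r (k + L)) \<omega>) \<longlonglongrightarrow> f \<omega>" using elim by (rule LIMSEQ_ignore_initial_segment)
      then have "(\<lambda>k. ennreal ((norm (S n \<omega> - S (r (k + L)) \<omega>))\<^sup>2)) \<longlonglongrightarrow> ennreal ((norm (S n \<omega> - f \<omega>))\<^sup>2)"
        by (intro tendsto_intros)
      then show ?case by (subst lim_imp_Liminf) auto
    qed
    also have "\<dots> \<le> liminf (\<lambda>k. \<integral>\<^sup>+\<omega>. ennreal ((norm (S n \<omega> - S (r (k + L)) \<omega>))\<^sup>2) \<partial>M)"
      by (intro nn_integral_liminf) measurable
    also have "\<dots> \<le> liminf (\<lambda>k::nat. ennreal e)"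
    proof (intro Liminf_mono always_eventually allI)
      fix k
      have "r (k + L) \<ge> L" using r1(2)[of "k + L"] by simp
      then have "msq M (\<lambda>\<omega>. S n \<omega> - S (r (k + L)) \<omega>) \<le> e" using n less_imp_le by blast
      moreover have "(\<integral>\<^sup>+\<omega>. ennreal ((norm (S n \<omega> - S (r (k + L)) \<omega>))\<^sup>2) \<partial>M)
          = ennreal (msq M (\<lambda>\<omega>. S n \<omega> - S (r (k + L)) \<omega>))"
        unfolding msq_def
        by (intro nn_integral_eq_integral square_integrable_norm_sq square_integrable_diff S) simp
      ultimately show "(\<integral>\<^sup>+\<omega>. ennreal ((norm (S n \<omega> - S (r (k + L)) \<omega>))\<^sup>2) \<partial>M) \<le> ennreal e"
        by (simp add: ennreal_leI)
    qed
    also have "\<dots> = ennreal e" by (simp add: Liminf_const)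
    finally show ?thesis .
  qed
  have diff: "square_integrable M (\<lambda>\<omega>. S n \<omega> - f \<omega>) \<and> msq M (\<lambda>\<omega>. S n \<omega> - f \<omega>) \<le> e"
    if e: "e > 0" and n: "\<And>m. m \<ge> L \<Longrightarrow> msq M (\<lambda>\<omega>. S n \<omega> - S m \<omega>) < e" for e n L
  proof -
    have F: "(\<integral>\<^sup>+\<omega>. ennreal ((norm (S n \<omega> - f \<omega>))\<^sup>2) \<partial>M) \<le> ennreal e"
      using e n by (rule fatou)
    have "(\<integral>\<^sup>+\<omega>. ennreal (norm ((norm (S n \<omega> - f \<omega>))\<^sup>2)) \<partial>M) < \<infinity>"
      using F by (auto intro: le_less_trans)
    then have i: "integrable M (\<lambda>\<omega>. (norm (S n \<omega> - f \<omega>))\<^sup>2)"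
      by (intro integrableI_bounded) auto
    have "ennreal (msq M (\<lambda>\<omega>. S n \<omega> - f \<omega>)) \<le> ennreal e"
      unfolding msq_def using F by (subst nn_integral_eq_integral[OF i, symmetric]) auto
    then show ?thesis using i e by (auto simp: square_integrable_def ennreal_le_iff)
  qed
  show thesis
  proof
    obtain L where L: "\<And>m n. m \<ge> L \<Longrightarrow> n \<ge> L \<Longrightarrow> msq M (\<lambda>\<omega>. S m \<omega> - S n \<omega>) < 1"
      using C[of 1] by auto
    have "square_integrable M (\<lambda>\<omega>. S L \<omega> - f \<omega>)" using diff[of 1 L L] L by auto
    from square_integrable_diff[OF S[of L] this] show "square_integrable M f" by simp
    show "L2_converges M S f"
      unfolding L2_converges_msq
    proof (rule LIMSEQ_I)
      fix e :: real assume e: "e > 0"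
      obtain L where L: "\<And>m n. m \<ge> L \<Longrightarrow> n \<ge> L \<Longrightarrow> msq M (\<lambda>\<omega>. S m \<omega> - S n \<omega>) < e / 2"
        using C[of "e / 2"] e by auto
      have "norm (msq M (\<lambda>\<omega>. S n \<omega> - f \<omega>) - 0) < e" if "n \<ge> L" for n
        using diff[of "e / 2" L n] L[OF that] e by simp
      then show "\<exists>no. \<forall>n\<ge>no. norm (msq M (\<lambda>\<omega>. S n \<omega> - f \<omega>) - 0) < e" by blast
    qed
  qed
qed

text \<open>A minimizing sequence is Cauchy by the parallelogram law.\<close>

lemma (in prob_space) L2_projection:
  fixes V :: "('a \<Rightarrow> 'b::{real_inner, complete_space, second_countable_topology}) set"
  assumes V: "\<And>f. f \<in> V \<Longrightarrow> square_integrable M f" "(\<lambda>\<omega>. 0) \<in> V"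
      "\<And>f g. f \<in> V \<Longrightarrow> g \<in> V \<Longrightarrow> (\<lambda>\<omega>. f \<omega> + g \<omega>) \<in> V"
      "\<And>f c. f \<in> V \<Longrightarrow> (\<lambda>\<omega>. c *\<^sub>R f \<omega>) \<in> V"
    and closed: "L2_closure M V \<subseteq> V"
    and Z: "square_integrable M Z"
  obtains Y where "Y \<in> V" "\<And>W. W \<in> V \<Longrightarrow> (\<integral>\<omega>. inner (Z \<omega> - Y \<omega>) (W \<omega>) \<partial>M) = 0"
proof -
  define q where "q f = msq M (\<lambda>\<omega>. Z \<omega> - f \<omega>)" for f
  define d where "d = Inf (q ` V)"
  have bdd: "bdd_below (q ` V)" by (auto intro!: bdd_belowI[of _ 0] simp: q_def)
  have d_le: "d \<le> q f" if "f \<in> V" for f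
    unfolding d_def using that bdd by (intro cInf_lower) auto
  have "\<forall>n. \<exists>f\<in>V. q f < d + inverse (real (Suc n))"
  proof
    fix n
    have "Inf (q ` V) < d + inverse (real (Suc n))" by (simp add: d_def)
    then show "\<exists>f\<in>V. q f < d + inverse (real (Suc n))"
      using cInf_lessD[of "q ` V"] V(2) by blast
  qed
  then obtain S where S: "\<And>n. S n \<in> V" "\<And>n. q (S n) < d + inverse (real (Suc n))" by metis
  have ZS: "square_integrable M (\<lambda>\<omega>. Z \<omega> - f \<omega>)" if "f \<in> V" for f
    using that by (intro square_integrable_diff Z V)
  have par: "msq M (\<lambda>\<omega>. f \<omega> - g \<omega>) \<le> 2 * q f + 2 * q g - 4 * d" if f: "f \<in> V" and g: "g \<in> V" for f g
  proof -
    \<comment> \<open>The midpoint stays in \<open>V\<close>, hence its distance to \<open>Z\<close>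
      is at least \<open>d\<close>.\<close>
    have h: "(\<lambda>\<omega>. (1/2) *\<^sub>R (f \<omega> + g \<omega>)) \<in> V" using f g by (intro V)
    have "msq M (\<lambda>\<omega>. (Z \<omega> - g \<omega>) - (Z \<omega> - f \<omega>)) + msq M (\<lambda>\<omega>. (Z \<omega> - g \<omega>) + (Z \<omega> - f \<omega>)) = 2 * q f + 2 * q g"
      using msq_add[OF ZS[OF g] ZS[OF f]] msq_diff[OF ZS[OF g] ZS[OF f]] by (simp add: q_def)
    moreover have "(\<lambda>\<omega>. (Z \<omega> - g \<omega>) + (Z \<omega> - f \<omega>)) = (\<lambda>\<omega>. 2 *\<^sub>R (Z \<omega> - (1/2) *\<^sub>R (f \<omega> + g \<omega>)))"
      by (simp add: fun_eq_iff scaleR_2 scaleR_right_diff_distrib)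
    then have "msq M (\<lambda>\<omega>. (Z \<omega> - g \<omega>) + (Z \<omega> - f \<omega>)) = 4 * q (\<lambda>\<omega>. (1/2) *\<^sub>R (f \<omega> + g \<omega>))"
      by (simp only: msq_scaleR q_def) simp
    ultimately show ?thesis using d_le[OF h] by simp
  qed
  obtain Y where Y: "square_integrable M Y" "L2_converges M S Y"
  proof (rule L2_complete[of S])
    show "square_integrable M (S n)" for n by (rule V(1)[OF S(1)])
    fix e :: real assume "e > 0"
    then obtain N where N: "inverse (real (Suc N)) < e / 4" using reals_Archimedean[of "e/4"] by auto
    have "msq M (\<lambda>\<omega>. S m \<omega> - S n \<omega>) < e" if "m \<ge> N" "n \<ge> N" for m n
    proof -
      have "inverse (real (Suc m)) \<le> inverse (real (Suc N))" "inverse (real (Suc n)) \<le> inverse (real (Suc N))"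
        using that by (auto intro!: le_imp_inverse_le)
      then show ?thesis using par[OF S(1)[of m] S(1)[of n]] S(2)[of m] S(2)[of n] N by linarith
    qed
    then show "\<exists>N. \<forall>m\<ge>N. \<forall>n\<ge>N. msq M (\<lambda>\<omega>. S m \<omega> - S n \<omega>) < e" by blast
  qed
  have YV: "Y \<in> V" using closed Y S(1) by (auto simp: L2_closure_def)
  have "q Y \<le> d"
  proof (rule LIMSEQ_le)
    have "L2_converges M (\<lambda>n \<omega>. Z \<omega> - S n \<omega>) (\<lambda>\<omega>. Z \<omega> - Y \<omega>)"
      using Y(2) unfolding L2_converges_msq by (simp add: msq_minus_commute)
    then show "(\<lambda>n. q (S n)) \<longlonglongrightarrow> q Y"
      unfolding q_def msq_eq_inner by (intro L2_converges_inner ZS S YV)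
    have "(\<lambda>n. d + inverse (real (Suc n))) \<longlonglongrightarrow> d + 0"
      by (intro tendsto_add tendsto_const LIMSEQ_inverse_real_of_nat)
    then show "(\<lambda>n. d + inverse (real (Suc n))) \<longlonglongrightarrow> d" by simp
    show "\<exists>N. \<forall>n\<ge>N. q (S n) \<le> d + inverse (real (Suc n))" using S(2) less_imp_le by blast
  qed
  have "(\<integral>\<omega>. inner (Z \<omega> - Y \<omega>) (W \<omega>) \<partial>M) = 0" if W: "W \<in> V" for W
  proof -
    define c where "c = (\<integral>\<omega>. inner (Z \<omega> - Y \<omega>) (W \<omega>) \<partial>M)"
    \<comment> \<open>Minimality of \<open>Y\<close> compared with Y + tW. Taking t = c, or t = c
      divided by the mean square of \<open>W\<close> when that is positive, leaves only c =
      0.\<close>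
    have q: "2 * t * c \<le> t\<^sup>2 * msq M W" for t
    proof -
      have "(\<lambda>\<omega>. Y \<omega> + t *\<^sub>R W \<omega>) \<in> V" using YV W by (intro V)
      then have "q Y \<le> q (\<lambda>\<omega>. Y \<omega> + t *\<^sub>R W \<omega>)" using d_le \<open>q Y \<le> d\<close> by (meson order_trans)
      moreover have "q (\<lambda>\<omega>. Y \<omega> + t *\<^sub>R W \<omega>) = q Y - 2 * t * c + t\<^sup>2 * msq M W"
        using msq_diff[OF ZS[OF YV] square_integrable_scaleR[OF V(1)[OF W], of t]]
        by (simp add: q_def msq_scaleR c_def diff_diff_eq)
      ultimately show ?thesis by simp
    qed
    have "c = 0"
    proof (cases "msq M W = 0")
      case True
      then show ?thesis using q[of c] by (simp add: mult_le_0_iff not_less[symmetric])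
    next
      case False
      then have p: "msq M W > 0" using msq_nonneg[of M W] by linarith
      have "2 * c * c / msq M W \<le> c * c / msq M W"
        using q[of "c / msq M W"] p by (simp add: power2_eq_square field_simps)
      then have "c * c \<le> 0" using p by (simp add: field_simps)
      then show ?thesis by (auto simp: mult_le_0_iff)
    qed
    then show ?thesis by (simp add: c_def)
  qed
  then show thesis using that YV by blast
qed

section \<open>Uniqueness of signed measures with vanishing characteristic function\<close>

text \<open>The hypotheses say that the positive and the negative part of G give Y the same Fourier
  transform. Normalized to probability measures, they give Y the same law by Levy's uniqueness
  theorem.\<close>

lemma (in prob_space) trig_orthogonal_unique:
  fixes G Y :: "'a \<Rightarrow> real"
  assumes G: "integrable M G" and [measurable]: "Y \<in> borel_measurable M" and B: "B \<in> sets borel"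
    and cos0: "\<And>t. (\<integral>\<omega>. G \<omega> * cos (t * Y \<omega>) \<partial>M) = 0"
    and sin0: "\<And>t. (\<integral>\<omega>. G \<omega> * sin (t * Y \<omega>) \<partial>M) = 0"
  shows "(\<integral>\<omega>. G \<omega> * indicator B (Y \<omega>) \<partial>M) = 0"
proof -
  note [measurable] = B
  have Gm [measurable]: "G \<in> borel_measurable M" using G by auto
  define P where "P \<omega> = max 0 (G \<omega>)" for \<omega>
  define N where "N \<omega> = max 0 (- G \<omega>)" for \<omega>
  have PN: "integrable M P" "integrable M N"
    unfolding P_def N_def using G by auto
  have [measurable]: "P \<in> borel_measurable M" "N \<in> borel_measurable M" using PN by auto
  have G_eq: "G \<omega> = P \<omega> - N \<omega>" for \<omega> by (simp add: P_def N_def max_def)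
  have pos: "0 \<le> P \<omega>" "0 \<le> N \<omega>" for \<omega> by (simp_all add: P_def N_def)
  have bd: "integrable M (\<lambda>\<omega>. F \<omega> * h \<omega>)"
    if "integrable M F" "h \<in> borel_measurable M" "\<And>\<omega>. \<bar>h \<omega>\<bar> \<le> 1" for F h :: "'a \<Rightarrow> real"
    by (rule Bochner_Integration.integrable_bound[OF that(1)])
      (use that in \<open>auto simp: abs_mult intro!: mult_left_le\<close>)
  have eq: "(\<integral>\<omega>. P \<omega> * h \<omega> \<partial>M) = (\<integral>\<omega>. N \<omega> * h \<omega> \<partial>M)"
    if "h \<in> borel_measurable M" "\<And>\<omega>. \<bar>h \<omega>\<bar> \<le> 1" "(\<integral>\<omega>. G \<omega> * h \<omega> \<partial>M) = 0" for h
    using that bd[OF PN(1) that(1,2)] bd[OF PN(2) that(1,2)] by (simp add: G_eq left_diff_distrib)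
  define c where "c = (\<integral>\<omega>. P \<omega> \<partial>M)"
  \<comment> \<open>The parameter t = 0 shows that both parts have the same total mass.\<close>
  have cN: "c = (\<integral>\<omega>. N \<omega> \<partial>M)" using eq[of "\<lambda>_. 1"] cos0[of 0] by (simp add: c_def)
  show ?thesis
  proof (cases "c = 0")
    case True
    then have "AE \<omega> in M. P \<omega> = 0" "AE \<omega> in M. N \<omega> = 0"
      using integral_nonneg_eq_0_iff_AE[OF PN(1)] integral_nonneg_eq_0_iff_AE[OF PN(2)] pos
      by (auto simp: c_def[symmetric] cN[symmetric])
    then have "AE \<omega> in M. G \<omega> * indicator B (Y \<omega>) = 0"
      by eventually_elim (simp add: G_eq)
    then show ?thesis using integral_cong_AE[of "\<lambda>\<omega>. G \<omega> * indicator B (Y \<omega>)" M "\<lambda>_. 0"] by simp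
  next
    case False
    have c: "c > 0" using False pos by (simp add: c_def less_le integral_nonneg_AE)
    \<comment> \<open>The law of \<open>Y\<close> under the probability density F / c. The case c =
      0, where this normalization fails, is the one in which \<open>G\<close> vanishes almost
      surely.\<close>
    define D where "D F = distr (density M (\<lambda>\<omega>. F \<omega> / c)) borel Y" for F :: "'a \<Rightarrow> real"
    have D: "real_distribution (D F) \<and>
        char (D F) t = of_real ((\<integral>\<omega>. F \<omega> * cos (t * Y \<omega>) \<partial>M) / c) + \<i> * of_real ((\<integral>\<omega>. F \<omega> * sin (t * Y \<omega>) \<partial>M) / c) \<and>
        measure (D F) B = (\<integral>\<omega>. F \<omega> * indicator B (Y \<omega>) \<partial>M) / c"
      if F: "integrable M F" "\<And>\<omega>. 0 \<le> F \<omega>" "(\<integral>\<omega>. F \<omega> \<partial>M) = c" for F t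
    proof -
      have [measurable]: "F \<in> borel_measurable M" using F by auto
      have pos: "0 \<le> F \<omega> / c" for \<omega> using F(2) c by simp
      have "prob_space (density M (\<lambda>\<omega>. F \<omega> / c))"
      proof
        have "emeasure (density M (\<lambda>\<omega>. ennreal (F \<omega> / c))) (space M) = (\<integral>\<^sup>+\<omega>. ennreal (F \<omega> / c) \<partial>M)"
          by (simp add: emeasure_density cong: nn_integral_cong)
        also have "\<dots> = ennreal (\<integral>\<omega>. F \<omega> / c \<partial>M)"
          using F pos by (intro nn_integral_eq_integral) auto
        also have "\<dots> = 1" using F c by simp
        finally show "emeasure (density M (\<lambda>\<omega>. ennreal (F \<omega> / c))) (space (density M (\<lambda>\<omega>. ennreal (F \<omega> / c)))) = 1" by simp
      qed
      then interpret P: prob_space "density M (\<lambda>\<omega>. F \<omega> / c)" .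
      have 1: "real_distribution (D F)" unfolding D_def by (rule P.real_distribution_distr) simp
      have ii: "integrable M (\<lambda>\<omega>. F \<omega> * cos (t * Y \<omega>))" "integrable M (\<lambda>\<omega>. F \<omega> * sin (t * Y \<omega>))"
        by (intro bd F; simp)+
      have "char (D F) t = (\<integral>\<omega>. (F \<omega> / c) *\<^sub>R iexp (t * Y \<omega>) \<partial>M)"
        unfolding char_def D_def
        by (subst integral_distr, simp, simp, subst integral_density) (use pos in auto)
      also have "\<dots> = (\<integral>\<omega>. (of_real (F \<omega> * cos (t * Y \<omega>)) + \<i> * of_real (F \<omega> * sin (t * Y \<omega>))) / of_real c \<partial>M)"
      proof (intro Bochner_Integration.integral_cong refl)
        fix \<omega>
        have "iexp (t * Y \<omega>) = of_real (cos (t * Y \<omega>)) + \<i> * of_real (sin (t * Y \<omega>))"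
          by (simp only: exp_Euler cos_of_real sin_of_real)
        then show "(F \<omega> / c) *\<^sub>R iexp (t * Y \<omega>) =
            (of_real (F \<omega> * cos (t * Y \<omega>)) + \<i> * of_real (F \<omega> * sin (t * Y \<omega>))) / of_real c"
          by (simp only: scaleR_conv_of_real of_real_mult of_real_divide) (simp add: field_simps)
      qed
      also have "\<dots> = of_real ((\<integral>\<omega>. F \<omega> * cos (t * Y \<omega>) \<partial>M) / c) + \<i> * of_real ((\<integral>\<omega>. F \<omega> * sin (t * Y \<omega>) \<partial>M) / c)"
        using ii by (simp add: add_divide_distrib del: of_real_mult)
      finally have 2: "char (D F) t = of_real ((\<integral>\<omega>. F \<omega> * cos (t * Y \<omega>) \<partial>M) / c) + \<i> * of_real ((\<integral>\<omega>. F \<omega> * sin (t * Y \<omega>) \<partial>M) / c)" .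
      interpret R: real_distribution "D F" by (rule 1)
      have "measure (D F) B = (\<integral>x. indicator B x \<partial>(D F))" by simp
      also have "\<dots> = (\<integral>\<omega>. (F \<omega> / c) *\<^sub>R indicator B (Y \<omega>) \<partial>M)"
        unfolding D_def
        by (subst integral_distr, simp, simp, subst integral_density) (use pos in auto)
      finally show ?thesis using 1 2 by simp
    qed
    have "D P = D N"
    proof (rule Levy_uniqueness)
      show "real_distribution (D P)" "real_distribution (D N)"
        using D[of P] D[of N] PN pos c_def cN by auto
      show "char (D P) = char (D N)"
      proof
        fix t
        show "char (D P) t = char (D N) t"
          using D[of P t] D[of N t] PN pos c_def cN
            eq[of "\<lambda>\<omega>. cos (t * Y \<omega>)"] eq[of "\<lambda>\<omega>. sin (t * Y \<omega>)"] cos0 sin0 by simp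
      qed
    qed
    then have "(\<integral>\<omega>. P \<omega> * indicator B (Y \<omega>) \<partial>M) = (\<integral>\<omega>. N \<omega> * indicator B (Y \<omega>) \<partial>M)"
      using D[of P] D[of N] PN pos c_def cN c by auto
    then show ?thesis
      using bd[OF PN(1), of "\<lambda>\<omega>. indicator B (Y \<omega>)"] bd[OF PN(2), of "\<lambda>\<omega>. indicator B (Y \<omega>)"]
      by (simp add: G_eq left_diff_distrib indicator_def)
  qed
qed

text \<open>The signed measure with density R has vanishing Fourier transform along every finite
  linear combination of the family; cosine and sine keep the statement real. Only integrability is
  asked of R, so that multiplication with indicators stays inside the class.\<close>

definition trig_orthogonal :: "'a measure \<Rightarrow> ('i \<Rightarrow> 'a \<Rightarrow> real) \<Rightarrow> ('a \<Rightarrow> real) \<Rightarrow> bool" where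
  "trig_orthogonal M Y R \<longleftrightarrow> integrable M R \<and>
    (\<forall>(n::nat) c i. (\<integral>\<omega>. R \<omega> * cos (\<Sum>j<n. c j * Y (i j) \<omega>) \<partial>M) = 0 \<and>
       (\<integral>\<omega>. R \<omega> * sin (\<Sum>j<n. c j * Y (i j) \<omega>) \<partial>M) = 0)"

lemma trig_orthogonalD:
  fixes n :: nat
  assumes "trig_orthogonal M Y R"
  shows "integrable M R" "(\<integral>\<omega>. R \<omega> * cos (\<Sum>j<n. c j * Y (i j) \<omega>) \<partial>M) = 0"
    "(\<integral>\<omega>. R \<omega> * sin (\<Sum>j<n. c j * Y (i j) \<omega>) \<partial>M) = 0"
  using assms unfolding trig_orthogonal_def by blast+

lemma trig_orthogonalI:
  assumes "integrable M R" "\<And>(n::nat) c i. (\<integral>\<omega>. R \<omega> * cos (\<Sum>j<n. c j * Y (i j) \<omega>) \<partial>M) = 0"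
    "\<And>(n::nat) c i. (\<integral>\<omega>. R \<omega> * sin (\<Sum>j<n. c j * Y (i j) \<omega>) \<partial>M) = 0"
  shows "trig_orthogonal M Y R"
  using assms unfolding trig_orthogonal_def by blast

text \<open>The generating sets are cut with \<open>space M\<close>, so identities between products
  with their indicators hold only there.\<close>

lemma trig_orthogonal_cong:
  assumes "trig_orthogonal M Y R" "\<And>\<omega>. \<omega> \<in> space M \<Longrightarrow> R \<omega> = R' \<omega>"
  shows "trig_orthogonal M Y R'"
proof (rule trig_orthogonalI)
  show "integrable M R'"
    using trig_orthogonalD(1)[OF assms(1)] assms(2) Bochner_Integration.integrable_cong[of M M R R'] by simp
  fix n :: nat and c i
  show "(\<integral>\<omega>. R' \<omega> * cos (\<Sum>j<n. c j * Y (i j) \<omega>) \<partial>M) = 0"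
    by (rule trans[OF Bochner_Integration.integral_cong[OF refl] trig_orthogonalD(2)[OF assms(1), where n = n and c = c and i = i]])
      (simp add: assms(2))
  show "(\<integral>\<omega>. R' \<omega> * sin (\<Sum>j<n. c j * Y (i j) \<omega>) \<partial>M) = 0"
    by (rule trans[OF Bochner_Integration.integral_cong[OF refl] trig_orthogonalD(3)[OF assms(1), where n = n and c = c and i = i]])
      (simp add: assms(2))
qed

lemma integrable_mult_bounded:
  fixes F h :: "'a \<Rightarrow> real"
  assumes "integrable M F" and [measurable]: "h \<in> borel_measurable M" and "\<And>\<omega>. \<bar>h \<omega>\<bar> \<le> C"
  shows "integrable M (\<lambda>\<omega>. F \<omega> * h \<omega>)"
proof (rule Bochner_Integration.integrable_bound)
  show "integrable M (\<lambda>\<omega>. F \<omega> * C)" using assms by simp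
  show "AE \<omega> in M. norm (F \<omega> * h \<omega>) \<le> norm (F \<omega> * C)"
  proof (rule AE_I2)
    fix \<omega>
    have "\<bar>h \<omega>\<bar> \<le> \<bar>C\<bar>" using assms(3)[of \<omega>] by linarith
    then show "norm (F \<omega> * h \<omega>) \<le> norm (F \<omega> * C)" by (simp add: abs_mult mult_left_mono)
  qed
qed (use assms in measurable)

text \<open>For a fixed linear combination \<theta>, the product formulas express g(\<theta>) cos
  (tY) and g(\<theta>) sin (tY) through \<theta> + tY and \<theta> - tY, again linear combinations
  of the family. Hence R g(\<theta>) satisfies the one-dimensional criterion with respect to the
  variable of index \<open>k\<close>.\<close>

lemma (in prob_space) trig_orthogonal_indicator:
  fixes Y :: "'i \<Rightarrow> 'a \<Rightarrow> real"
  assumes R: "trig_orthogonal M Y R" and Y [measurable]: "\<And>i. Y i \<in> borel_measurable M"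
    and B [measurable]: "B \<in> sets borel"
  shows "trig_orthogonal M Y (\<lambda>\<omega>. R \<omega> * indicator B (Y k \<omega>))"
proof -
  have Ri: "integrable M R" using R by (rule trig_orthogonalD)
  have [measurable]: "R \<in> borel_measurable M" using Ri by auto
  have bd: "integrable M (\<lambda>\<omega>. R \<omega> * h \<omega>)"
    if "h \<in> borel_measurable M" "\<And>\<omega>. \<bar>h \<omega>\<bar> \<le> 1" for h
    by (rule integrable_mult_bounded[OF Ri that])
  have tr: "(\<integral>\<omega>. R \<omega> * cos ((\<Sum>j<n. c j * Y (i j) \<omega>) + s * Y k \<omega>) \<partial>M) = 0 \<and>
      (\<integral>\<omega>. R \<omega> * sin ((\<Sum>j<n. c j * Y (i j) \<omega>) + s * Y k \<omega>) \<partial>M) = 0" for n :: nat and c i s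
  proof -
    \<comment> \<open>The extra term becomes the summand with index \<open>n\<close>.\<close>
    have eq: "(\<Sum>j<n. c j * Y (i j) \<omega>) + s * Y k \<omega> = (\<Sum>j<Suc n. (c(n := s)) j * Y ((i(n := k)) j) \<omega>)" for \<omega>
      by simp
    show ?thesis unfolding eq using trig_orthogonalD(2,3)[OF R] by blast
  qed
  have zero: "(\<integral>\<omega>. R \<omega> * indicator B (Y k \<omega>) * g (\<Sum>j<n. c j * Y (i j) \<omega>) \<partial>M) = 0"
    if g: "g = cos \<or> g = sin" for n :: nat and c i and g :: "real \<Rightarrow> real"
  proof -
    let ?\<theta> = "\<lambda>\<omega>. \<Sum>j<n. c j * Y (i j) \<omega>"
    have [measurable]: "g \<in> borel_measurable borel" using g by auto
    have gb: "\<bar>g x\<bar> \<le> 1" for x using g by auto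
    have "(\<integral>\<omega>. (R \<omega> * g (?\<theta> \<omega>)) * indicator B (Y k \<omega>) \<partial>M) = 0"
    proof (rule trig_orthogonal_unique)
      show "integrable M (\<lambda>\<omega>. R \<omega> * g (?\<theta> \<omega>))" by (rule bd) (auto simp: gb)
      fix t
      have b: "integrable M (\<lambda>\<omega>. R \<omega> * cos (?\<theta> \<omega> + s * Y k \<omega>))" "integrable M (\<lambda>\<omega>. R \<omega> * sin (?\<theta> \<omega> + s * Y k \<omega>))" for s
        by (rule bd; simp)+
      have cc: "(\<integral>\<omega>. R \<omega> * (cos (?\<theta> \<omega>) * cos (t * Y k \<omega>)) \<partial>M) = 0"
      proof -
        have "(\<lambda>\<omega>. R \<omega> * (cos (?\<theta> \<omega>) * cos (t * Y k \<omega>)))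
            = (\<lambda>\<omega>. (R \<omega> * cos (?\<theta> \<omega> + t * Y k \<omega>) + R \<omega> * cos (?\<theta> \<omega> + (-t) * Y k \<omega>)) / 2)"
          by (simp add: fun_eq_iff cos_add cos_diff algebra_simps)
        then show ?thesis using tr[of c i n t] tr[of c i n "-t"] b[of t] b[of "-t"] by simp
      qed
      have ss: "(\<integral>\<omega>. R \<omega> * (sin (?\<theta> \<omega>) * sin (t * Y k \<omega>)) \<partial>M) = 0"
      proof -
        have "(\<lambda>\<omega>. R \<omega> * (sin (?\<theta> \<omega>) * sin (t * Y k \<omega>)))
            = (\<lambda>\<omega>. (R \<omega> * cos (?\<theta> \<omega> + (-t) * Y k \<omega>) - R \<omega> * cos (?\<theta> \<omega> + t * Y k \<omega>)) / 2)"
          by (simp add: fun_eq_iff cos_add cos_diff algebra_simps)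
        then show ?thesis using tr[of c i n t] tr[of c i n "-t"] b[of t] b[of "-t"] by simp
      qed
      have sc: "(\<integral>\<omega>. R \<omega> * (sin (?\<theta> \<omega>) * cos (t * Y k \<omega>)) \<partial>M) = 0"
      proof -
        have "(\<lambda>\<omega>. R \<omega> * (sin (?\<theta> \<omega>) * cos (t * Y k \<omega>)))
            = (\<lambda>\<omega>. (R \<omega> * sin (?\<theta> \<omega> + t * Y k \<omega>) + R \<omega> * sin (?\<theta> \<omega> + (-t) * Y k \<omega>)) / 2)"
          by (simp add: fun_eq_iff sin_add sin_diff algebra_simps)
        then show ?thesis using tr[of c i n t] tr[of c i n "-t"] b[of t] b[of "-t"] by simp
      qed
      have cs: "(\<integral>\<omega>. R \<omega> * (cos (?\<theta> \<omega>) * sin (t * Y k \<omega>)) \<partial>M) = 0"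
      proof -
        have "(\<lambda>\<omega>. R \<omega> * (cos (?\<theta> \<omega>) * sin (t * Y k \<omega>)))
            = (\<lambda>\<omega>. (R \<omega> * sin (?\<theta> \<omega> + t * Y k \<omega>) - R \<omega> * sin (?\<theta> \<omega> + (-t) * Y k \<omega>)) / 2)"
          by (simp add: fun_eq_iff sin_add sin_diff algebra_simps)
        then show ?thesis using tr[of c i n t] tr[of c i n "-t"] b[of t] b[of "-t"] by simp
      qed
      show "(\<integral>\<omega>. R \<omega> * g (?\<theta> \<omega>) * cos (t * Y k \<omega>) \<partial>M) = 0"
        "(\<integral>\<omega>. R \<omega> * g (?\<theta> \<omega>) * sin (t * Y k \<omega>) \<partial>M) = 0"
        using g cc ss sc cs by (auto simp: mult.assoc)
    qed auto
    then show ?thesis by (simp add: ac_simps)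
  qed
  have "integrable M (\<lambda>\<omega>. R \<omega> * indicator B (Y k \<omega>))" by (rule bd) (auto simp: indicator_def)
  then show ?thesis by (rule trig_orthogonalI) (auto intro!: zero)
qed

text \<open>The sets \<open>A\<close> such that multiplication with the indicator of \<open>A\<close> preserves orthogonality to
  all trigonometric polynomials form a \<open>\<sigma>\<close>-algebra; stability under finite intersections is
  automatic, as such multiplications compose.\<close>

lemma (in prob_space) trig_orthogonal_sigma_sets:
  fixes Y :: "'i \<Rightarrow> 'a \<Rightarrow> real"
  assumes Y [measurable]: "\<And>i. Y i \<in> borel_measurable M"
    and R: "trig_orthogonal M Y R"
    and A: "A \<in> sigma_sets (space M) {Y i -` B \<inter> space M | i B. B \<in> sets borel}"
  shows "(\<integral>\<omega>. R \<omega> * indicator A \<omega> \<partial>M) = 0"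
proof -
  define good where "good A \<longleftrightarrow> A \<in> sets M \<and> (\<forall>R. trig_orthogonal M Y R \<longrightarrow> trig_orthogonal M Y (\<lambda>\<omega>. R \<omega> * indicator A \<omega>))" for A
  have good_cong: "good A" if good: "A \<in> sets M" "\<And>R. trig_orthogonal M Y R \<Longrightarrow>
      \<exists>R'. trig_orthogonal M Y R' \<and> (\<forall>\<omega>\<in>space M. R' \<omega> = R \<omega> * indicator A \<omega>)" for A
    unfolding good_def
  proof (intro conjI allI impI good)
    fix R assume "trig_orthogonal M Y R"
    then obtain R' where "trig_orthogonal M Y R'" "\<forall>\<omega>\<in>space M. R' \<omega> = R \<omega> * indicator A \<omega>"
      using good(2) by blast
    then show "trig_orthogonal M Y (\<lambda>\<omega>. R \<omega> * indicator A \<omega>)"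
      by (auto intro: trig_orthogonal_cong)
  qed
  have int: "integrable M (\<lambda>\<omega>. R \<omega> * g (\<Sum>j<n. c j * Y (i j) \<omega>))"
    if "trig_orthogonal M Y R" "g = cos \<or> g = sin" for R and n :: nat and c i and g :: "real \<Rightarrow> real"
  proof (rule integrable_mult_bounded[where C = 1])
    show "integrable M R" using that(1) by (rule trig_orthogonalD)
    have [measurable]: "g \<in> borel_measurable borel" using that by auto
    show "(\<lambda>\<omega>. g (\<Sum>j<n. c j * Y (i j) \<omega>)) \<in> borel_measurable M" by measurable
  qed (use that in auto)
  have diff: "trig_orthogonal M Y (\<lambda>\<omega>. R \<omega> - R' \<omega>)" if "trig_orthogonal M Y R" "trig_orthogonal M Y R'" for R R'
    by (rule trig_orthogonalI)
      (simp_all add: left_diff_distrib int[OF that(1)] int[OF that(2)] trig_orthogonalD(1)[OF that(1)]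
        trig_orthogonalD(1)[OF that(2)] trig_orthogonalD(2,3)[OF that(1)] trig_orthogonalD(2,3)[OF that(2)])
  have compl: "good (space M - A)" if A: "good A" for A
  proof (rule good_cong)
    show "space M - A \<in> sets M" using A by (auto simp: good_def)
    fix R assume R: "trig_orthogonal M Y R"
    with A have "trig_orthogonal M Y (\<lambda>\<omega>. R \<omega> * indicator A \<omega>)" by (auto simp: good_def)
    then have "trig_orthogonal M Y (\<lambda>\<omega>. R \<omega> - R \<omega> * indicator A \<omega>)" by (rule diff[OF R])
    then show "\<exists>R'. trig_orthogonal M Y R' \<and> (\<forall>\<omega>\<in>space M. R' \<omega> = R \<omega> * indicator (space M - A) \<omega>)"
      by (intro exI[of _ "\<lambda>\<omega>. R \<omega> - R \<omega> * indicator A \<omega>"]) (auto simp: indicator_def)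
  qed
  have inter: "good (A \<inter> B)" if A: "good A" and B: "good B" for A B
  proof (rule good_cong)
    show "A \<inter> B \<in> sets M" using A B by (auto simp: good_def)
    fix R assume R: "trig_orthogonal M Y R"
    with A B have "trig_orthogonal M Y (\<lambda>\<omega>. (R \<omega> * indicator A \<omega>) * indicator B \<omega>)" by (auto simp: good_def)
    then show "\<exists>R'. trig_orthogonal M Y R' \<and> (\<forall>\<omega>\<in>space M. R' \<omega> = R \<omega> * indicator (A \<inter> B) \<omega>)"
      by (intro exI[of _ "\<lambda>\<omega>. (R \<omega> * indicator A \<omega>) * indicator B \<omega>"]) (auto simp: indicator_def)
  qed
  have "good A"
    using A
  proof (induction rule: sigma_sets.induct)
    case (Basic a)
    then obtain i B where a: "a = Y i -` B \<inter> space M" "B \<in> sets borel" by auto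
    note [measurable] = a(2)
    show ?case
    proof (rule good_cong)
      show "a \<in> sets M" unfolding a by measurable
      fix R assume "trig_orthogonal M Y R"
      then have "trig_orthogonal M Y (\<lambda>\<omega>. R \<omega> * indicator B (Y i \<omega>))"
        by (rule trig_orthogonal_indicator[OF _ Y a(2)])
      then show "\<exists>R'. trig_orthogonal M Y R' \<and> (\<forall>\<omega>\<in>space M. R' \<omega> = R \<omega> * indicator a \<omega>)"
        by (intro exI[of _ "\<lambda>\<omega>. R \<omega> * indicator B (Y i \<omega>)"]) (auto simp: indicator_def a)
    qed
  next
    case Empty
    then show ?case by (auto simp: good_def intro!: trig_orthogonalI)
  next
    case (Compl a)
    then show ?case by (intro compl)
  next
    case (Union a)
    \<comment> \<open>Finite intersections of complements, so that \<open>u n\<close> is the union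
      of \<open>a 0\<close> up to \<open>a n\<close>. These increase to the countable union, and
      dominated convergence with bound |R| applies.\<close>
    define b where "b n = (\<Inter>k\<le>n. space M - a k)" for n
    have b: "good (b n)" for n
      by (induction n) (simp_all add: b_def atMost_Suc compl Union.IH inter)
    define u where "u n = space M - b n" for n
    have u: "good (u n)" for n unfolding u_def by (intro compl b)
    have am: "a k \<subseteq> space M" for k using Union.IH[of k] sets.sets_into_space by (auto simp: good_def)
    have u_eq: "u n = (\<Union>k\<le>n. a k)" for n using am by (auto simp: u_def b_def)
    show ?case
      unfolding good_def
    proof (intro conjI allI impI)
      show um [measurable]: "\<Union> (range a) \<in> sets M" using Union.IH by (auto simp: good_def)
      fix R assume R: "trig_orthogonal M Y R"
      then have Ri: "integrable M R" by (rule trig_orthogonalD)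
      have [measurable]: "R \<in> borel_measurable M" using Ri by auto
      have [measurable]: "u n \<in> sets M" for n using u by (auto simp: good_def)
      have lim: "(\<integral>\<omega>. R \<omega> * indicator (\<Union> (range a)) \<omega> * h \<omega> \<partial>M) = 0"
        if h [measurable]: "h \<in> borel_measurable M" "\<And>\<omega>. \<bar>h \<omega>\<bar> \<le> 1"
          and 0: "\<And>n. (\<integral>\<omega>. R \<omega> * indicator (u n) \<omega> * h \<omega> \<partial>M) = 0" for h
      proof -
        have "(\<lambda>n. \<integral>\<omega>. R \<omega> * indicator (u n) \<omega> * h \<omega> \<partial>M) \<longlonglongrightarrow> (\<integral>\<omega>. R \<omega> * indicator (\<Union> (range a)) \<omega> * h \<omega> \<partial>M)"
        proof (rule integral_dominated_convergence[where w = "\<lambda>\<omega>. \<bar>R \<omega>\<bar>"])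
          show "integrable M (\<lambda>\<omega>. \<bar>R \<omega>\<bar>)" using Ri by simp
          show "AE \<omega> in M. (\<lambda>n. R \<omega> * indicator (u n) \<omega> * h \<omega>) \<longlonglongrightarrow> R \<omega> * indicator (\<Union> (range a)) \<omega> * h \<omega>"
          proof (intro AE_I2 tendsto_intros)
            fix \<omega>
            have "(\<Union>n. u n) = \<Union> (range a)" by (auto simp: u_eq)
            moreover have "incseq u" by (intro incseq_SucI) (auto simp: u_eq atMost_Suc)
            ultimately show "(\<lambda>n. indicator (u n) \<omega> :: real) \<longlonglongrightarrow> indicator (\<Union> (range a)) \<omega>"
              using LIMSEQ_indicator_incseq[of u \<omega>] by simp
          qed
          show "AE \<omega> in M. norm (R \<omega> * indicator (u n) \<omega> * h \<omega>) \<le> \<bar>R \<omega>\<bar>" for n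
            using h(2) by (auto simp: abs_mult indicator_def intro!: mult_left_le)
        qed measurable
        then show ?thesis using 0 by (simp add: LIMSEQ_const_iff)
      qed
      have "integrable M (\<lambda>\<omega>. R \<omega> * indicator (\<Union> (range a)) \<omega>)"
        by (rule integrable_mult_bounded[OF Ri borel_measurable_indicator[OF um], where C = 1])
          (auto simp: indicator_def)
      moreover have "trig_orthogonal M Y (\<lambda>\<omega>. R \<omega> * indicator (u n) \<omega>)" for n
        using u R by (auto simp: good_def)
      ultimately show "trig_orthogonal M Y (\<lambda>\<omega>. R \<omega> * indicator (\<Union> (range a)) \<omega>)"
        by (intro trig_orthogonalI lim) (auto intro: trig_orthogonalD)
    qed
  qed
  then have "trig_orthogonal M Y (\<lambda>\<omega>. R \<omega> * indicator A \<omega>)" using R by (simp add: good_def)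
  \<comment> \<open>The empty linear combination, whose cosine is 1.\<close>
  then have "(\<integral>\<omega>. R \<omega> * indicator A \<omega> * cos (\<Sum>j<(0::nat). 0 * Y undefined \<omega>) \<partial>M) = 0"
    by (rule trig_orthogonalD)
  then show ?thesis by simp
qed

text \<open>Since the family generates the \<sigma>-algebra, R integrates to 0 over every event; the
  events R \<ge> 0 and R \<le> 0 show that both parts of R vanish.\<close>

lemma (in prob_space) trig_orthogonal_AE_zero:
  fixes Y :: "'i \<Rightarrow> 'a \<Rightarrow> real"
  assumes Y: "\<And>i. Y i \<in> borel_measurable M" and R: "trig_orthogonal M Y R"
    and gen: "sets M = sigma_sets (space M) {Y i -` B \<inter> space M | i B. B \<in> sets borel}"
  shows "AE \<omega> in M. R \<omega> = 0"
proof -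
  have Ri: "integrable M R" using R by (rule trig_orthogonalD)
  have [measurable]: "R \<in> borel_measurable M" using Ri by auto
  have zero: "(\<integral>\<omega>. R \<omega> * indicator A \<omega> \<partial>M) = 0" if "A \<in> sets M" for A
    using that unfolding gen by (rule trig_orthogonal_sigma_sets[OF Y R])
  have i: "integrable M (\<lambda>\<omega>. max 0 (R \<omega>))" "integrable M (\<lambda>\<omega>. max 0 (- R \<omega>))" using Ri by auto
  have "(\<integral>\<omega>. max 0 (R \<omega>) \<partial>M) = (\<integral>\<omega>. R \<omega> * indicator {\<omega>\<in>space M. 0 \<le> R \<omega>} \<omega> \<partial>M)"
    by (intro Bochner_Integration.integral_cong) (auto simp: indicator_def max_def)
  then have 1: "(\<integral>\<omega>. max 0 (R \<omega>) \<partial>M) = 0" using zero by simp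
  have "(\<integral>\<omega>. max 0 (- R \<omega>) \<partial>M) = - (\<integral>\<omega>. R \<omega> * indicator {\<omega>\<in>space M. R \<omega> \<le> 0} \<omega> \<partial>M)"
    by (subst integral_minus[symmetric], intro Bochner_Integration.integral_cong) (auto simp: indicator_def max_def)
  then have 2: "(\<integral>\<omega>. max 0 (- R \<omega>) \<partial>M) = 0" using zero by simp
  have "AE \<omega> in M. max 0 (R \<omega>) = 0" "AE \<omega> in M. max 0 (- R \<omega>) = 0"
    using 1 2 integral_nonneg_eq_0_iff_AE[OF i(1)] integral_nonneg_eq_0_iff_AE[OF i(2)] by auto
  then show ?thesis by eventually_elim (auto simp: max_def split: if_splits)
qed

section \<open>Gaussian variables\<close>

text \<open>By completing the square, s|x| \<le> s^2 \<sigma>^2 + x^2 / (4 \<sigma>^2). This spends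
  half of the Gaussian exponent, and what remains is a normal density with standard deviation sqrt 2
  \<sigma>; the factor sqrt 2 adjusts the normalization.\<close>

lemma normal_density_exp_bound:
  assumes "\<sigma> > 0"
  shows "normal_density 0 \<sigma> x * exp (s * \<bar>x\<bar>) \<le> sqrt 2 * exp (s\<^sup>2 * \<sigma>\<^sup>2) * normal_density 0 (sqrt 2 * \<sigma>) x"
proof -
  have "(s * \<sigma> - \<bar>x\<bar> / (2 * \<sigma>))\<^sup>2 = s\<^sup>2 * \<sigma>\<^sup>2 - s * \<bar>x\<bar> + x\<^sup>2 / (4 * \<sigma>\<^sup>2)"
    using assms by (simp add: power2_diff power_mult_distrib power_divide)
  then have "s * \<bar>x\<bar> \<le> s\<^sup>2 * \<sigma>\<^sup>2 + x\<^sup>2 / (4 * \<sigma>\<^sup>2)"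
    using zero_le_power2[of "s * \<sigma> - \<bar>x\<bar> / (2 * \<sigma>)"] by linarith
  moreover have "- x\<^sup>2 / (2 * (sqrt 2 * \<sigma>)\<^sup>2) = - (x\<^sup>2 / (4 * \<sigma>\<^sup>2))"
    "- x\<^sup>2 / (2 * \<sigma>\<^sup>2) = - 2 * (x\<^sup>2 / (4 * \<sigma>\<^sup>2))"
    by (simp_all add: power_mult_distrib)
  ultimately have "- x\<^sup>2 / (2 * \<sigma>\<^sup>2) + s * \<bar>x\<bar> \<le> s\<^sup>2 * \<sigma>\<^sup>2 + - x\<^sup>2 / (2 * (sqrt 2 * \<sigma>)\<^sup>2)"
    by linarith
  then have "exp (- x\<^sup>2 / (2 * \<sigma>\<^sup>2)) * exp (s * \<bar>x\<bar>) \<le> exp (s\<^sup>2 * \<sigma>\<^sup>2) * exp (- x\<^sup>2 / (2 * (sqrt 2 * \<sigma>)\<^sup>2))"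
    unfolding exp_add[symmetric] by simp
  then have "exp (- x\<^sup>2 / (2 * \<sigma>\<^sup>2)) * exp (s * \<bar>x\<bar>) / sqrt (2 * pi * \<sigma>\<^sup>2)
      \<le> exp (s\<^sup>2 * \<sigma>\<^sup>2) * exp (- x\<^sup>2 / (2 * (sqrt 2 * \<sigma>)\<^sup>2)) / sqrt (2 * pi * \<sigma>\<^sup>2)"
    by (intro divide_right_mono) auto
  moreover have q: "sqrt 2 / sqrt (2 * pi * (sqrt 2 * \<sigma>)\<^sup>2) = 1 / sqrt (2 * pi * \<sigma>\<^sup>2)"
    using assms by (simp add: real_sqrt_mult power_mult_distrib field_simps)
  have "sqrt 2 * exp (s\<^sup>2 * \<sigma>\<^sup>2) * normal_density 0 (sqrt 2 * \<sigma>) x =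
      sqrt 2 / sqrt (2 * pi * (sqrt 2 * \<sigma>)\<^sup>2) * (exp (s\<^sup>2 * \<sigma>\<^sup>2) * exp (- x\<^sup>2 / (2 * (sqrt 2 * \<sigma>)\<^sup>2)))"
    unfolding normal_density_def by simp
  then have "sqrt 2 * exp (s\<^sup>2 * \<sigma>\<^sup>2) * normal_density 0 (sqrt 2 * \<sigma>) x =
      exp (s\<^sup>2 * \<sigma>\<^sup>2) * exp (- x\<^sup>2 / (2 * (sqrt 2 * \<sigma>)\<^sup>2)) / sqrt (2 * pi * \<sigma>\<^sup>2)"
    unfolding q by simp
  ultimately show ?thesis by (simp add: normal_density_def)
qed

lemma integrable_normal_density_exp:
  assumes "\<sigma> > 0" and [measurable]: "g \<in> borel_measurable borel" and g: "\<And>x. \<bar>g x\<bar> \<le> C * exp (s * \<bar>x\<bar>)"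
  shows "integrable lborel (\<lambda>x. normal_density 0 \<sigma> x * g x)"
proof (rule Bochner_Integration.integrable_bound)
  show "integrable lborel (\<lambda>x. C * (sqrt 2 * exp (s\<^sup>2 * \<sigma>\<^sup>2) * normal_density 0 (sqrt 2 * \<sigma>) x))"
    using assms by (intro integrable_mult_right integrable_normal_density) auto
  show "AE x in lborel. norm (normal_density 0 \<sigma> x * g x)
      \<le> norm (C * (sqrt 2 * exp (s\<^sup>2 * \<sigma>\<^sup>2) * normal_density 0 (sqrt 2 * \<sigma>) x))"
  proof (rule AE_I2)
    fix x
    have "0 \<le> C * exp (s * \<bar>x\<bar>)" using g[of x] by linarith
    then have C: "0 \<le> C" by (simp add: zero_le_mult_iff)
    have "norm (normal_density 0 \<sigma> x * g x) \<le> normal_density 0 \<sigma> x * (C * exp (s * \<bar>x\<bar>))"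
      using g[of x] by (simp add: abs_mult mult_left_mono)
    also have "\<dots> = C * (normal_density 0 \<sigma> x * exp (s * \<bar>x\<bar>))" by simp
    also have "\<dots> \<le> C * (sqrt 2 * exp (s\<^sup>2 * \<sigma>\<^sup>2) * normal_density 0 (sqrt 2 * \<sigma>) x)"
      using normal_density_exp_bound[OF assms(1)] C by (intro mult_left_mono) auto
    finally show "norm (normal_density 0 \<sigma> x * g x)
      \<le> norm (C * (sqrt 2 * exp (s\<^sup>2 * \<sigma>\<^sup>2) * normal_density 0 (sqrt 2 * \<sigma>) x))" by simp
  qed
qed simp

lemma abs_le_exp_abs: "\<bar>x\<bar> \<le> exp \<bar>x\<bar>" for x :: real
  using exp_ge_add_one_self[of "\<bar>x\<bar>"] by linarith

text \<open>The derivative of the density is -x times the density, so the product of density and g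
  has the difference of both integrands as its derivative. The exponential growth bound makes this
  product vanish at both ends of the line.\<close>

lemma std_normal_integration_by_parts:
  fixes g g' :: "real \<Rightarrow> real"
  assumes deriv: "\<And>x. (g has_real_derivative g' x) (at x)" and cont: "continuous_on UNIV g'"
    and g: "\<And>x. \<bar>g x\<bar> \<le> C * exp (s * \<bar>x\<bar>)" and g': "\<And>x. \<bar>g' x\<bar> \<le> C * exp (s * \<bar>x\<bar>)"
  shows "(\<integral>x. std_normal_density x * (x * g x) \<partial>lborel) = (\<integral>x. std_normal_density x * g' x \<partial>lborel)"
proof -
  have contg: "continuous_on UNIV g"
    using deriv by (meson DERIV_isCont continuous_at_imp_continuous_on)
  have [measurable]: "g \<in> borel_measurable borel" "g' \<in> borel_measurable borel"
    by (intro borel_measurable_continuous_onI cont contg)+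
  \<comment> \<open>The factor x is absorbed by raising the exponential rate by 1.\<close>
  have b: "\<bar>x * g x\<bar> \<le> C * exp ((1 + s) * \<bar>x\<bar>)" for x
  proof -
    have "exp ((1 + s) * \<bar>x\<bar>) = exp \<bar>x\<bar> * exp (s * \<bar>x\<bar>)" by (simp add: distrib_right exp_add)
    then show ?thesis using mult_mono[OF abs_le_exp_abs[of x] g[of x]] by (simp add: abs_mult ac_simps)
  qed
  have i1: "integrable lborel (\<lambda>x. std_normal_density x * (x * g x))"
    by (rule integrable_normal_density_exp[OF _ _ b]) auto
  have i2: "integrable lborel (\<lambda>x. std_normal_density x * g' x)"
    by (rule integrable_normal_density_exp[OF _ _ g']) auto
  define F where "F x = std_normal_density x * g x" for x
  define f where "f x = std_normal_density x * g' x - std_normal_density x * (x * g x)" for x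
  define c :: real where "c = 1 / sqrt (2 * pi)"
  have dens: "std_normal_density = (\<lambda>x. c * exp (- x\<^sup>2 / 2))"
    by (simp add: fun_eq_iff std_normal_density_def c_def)
  have D: "(F has_vector_derivative f x) (at x)" for x
    unfolding has_real_derivative_iff_has_vector_derivative[symmetric] F_def f_def dens
    by (auto intro!: derivative_eq_intros deriv simp: algebra_simps)
  have cf: "isCont f x" for x
    using cont contg unfolding f_def std_normal_density_def
    by (auto intro!: continuous_intros simp: continuous_on_eq_continuous_at)
  have i: "integrable lborel f" unfolding f_def using i1 i2 by simp
  \<comment> \<open>\<open>C\<close> times the constant of \<open>normal_density_exp_bound\<close>
    for \<sigma> = 1.\<close>
  define K where "K = C * (sqrt 2 * exp (s\<^sup>2))"
  have Fb: "\<bar>F x\<bar> \<le> K * normal_density 0 (sqrt 2) x" for x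
  proof -
    have "0 \<le> C * exp (s * \<bar>x\<bar>)" using g[of x] by linarith
    then have C: "0 \<le> C" by (simp add: zero_le_mult_iff)
    have "\<bar>F x\<bar> \<le> std_normal_density x * (C * exp (s * \<bar>x\<bar>))"
      using g[of x] by (simp add: F_def abs_mult mult_left_mono)
    also have "\<dots> = C * (std_normal_density x * exp (s * \<bar>x\<bar>))" by simp
    also have "\<dots> \<le> C * (sqrt 2 * exp (s\<^sup>2 * 1\<^sup>2) * normal_density 0 (sqrt 2 * 1) x)"
      using normal_density_exp_bound[of 1 x s] C by (intro mult_left_mono) auto
    finally show ?thesis by (simp add: K_def)
  qed
  have lim: "(normal_density 0 (sqrt 2) \<longlongrightarrow> 0) at_top" "(normal_density 0 (sqrt 2) \<longlongrightarrow> 0) at_bot"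
    unfolding normal_density_def by real_asymp+
  have lF: "(F \<longlongrightarrow> 0) at_top" "(F \<longlongrightarrow> 0) at_bot"
    by (rule Lim_null_comparison[where g = "\<lambda>x. K * normal_density 0 (sqrt 2) x"],
        use Fb tendsto_mult_right_zero[OF lim(1), of K] tendsto_mult_right_zero[OF lim(2), of K] in auto)+
  have "(LBINT x=-\<infinity>..\<infinity>. f x) = 0 - 0"
    by (rule interval_integral_FTC_integrable[where F = F])
      (use D cf i lF in \<open>auto simp: einterval_def set_integrable_def ereal_tendsto_simps\<close>)
  then have "(\<integral>x. f x \<partial>lborel) = 0"
    by (simp add: interval_lebesgue_integral_def einterval_def set_lebesgue_integral_def)
  then show ?thesis using i1 i2 by (simp add: f_def)
qed

section \<open>Integrability, linearity and independence for the Gaussian process\<close>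

context isonormal_gaussian_process
begin

lemma X_gaussian: "centered_gaussian M (X h)"
  using jointly_gaussian[where n = 1 and c = "\<lambda>_. 1" and h = "\<lambda>_. h"] by simp

lemma X_measurable [measurable]: "X h \<in> borel_measurable M"
  using X_gaussian by (simp add: centered_gaussian_def)

lemma X_cases:
  obtains "AE \<omega> in M. X h \<omega> = 0" | \<sigma> where "\<sigma> > 0" "distributed M lborel (X h) (normal_density 0 \<sigma>)"
  using X_gaussian[of h] by (auto simp: centered_gaussian_def)

lemma X_exp_integrable: "integrable M (\<lambda>\<omega>. exp (s * \<bar>X h \<omega>\<bar>))"
proof (cases rule: X_cases[of h])
  case 1
  have "integrable M (\<lambda>\<omega>. 1 :: real)" by simp
  then show ?thesis
    by (rule integrable_cong_AE_imp) (use 1 in auto)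
next
  case (2 \<sigma>)
  have "integrable lborel (\<lambda>x. normal_density 0 \<sigma> x * exp (s * \<bar>x\<bar>))"
    by (rule integrable_normal_density_exp[OF 2(1), of _ 1 s]) auto
  then show ?thesis
    using distributed_integrable[OF 2(2), of "\<lambda>x. exp (s * \<bar>x\<bar>)"] by simp
qed

text \<open>The variables may be dependent, so one factor at a time is split off as a product of two
  square-integrable functions. Squaring doubles the rate, which is why the induction keeps
  \<open>C\<close> arbitrary.\<close>

lemma exp_sum_integrable: "integrable M (\<lambda>\<omega>. exp (C * (\<Sum>j<n::nat. \<bar>X (\<phi> j) \<omega>\<bar>)))"
proof (induction n arbitrary: C)
  case (Suc n)
  have "integrable M (\<lambda>\<omega>. exp (C * (\<Sum>j<n::nat. \<bar>X (\<phi> j) \<omega>\<bar>)) * exp (C * \<bar>X (\<phi> n) \<omega>\<bar>))"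
  proof (rule integrable_mult_sq)
    show "square_integrable M (\<lambda>\<omega>. exp (C * (\<Sum>j<n::nat. \<bar>X (\<phi> j) \<omega>\<bar>)))"
      using Suc[of "2 * C"] by (simp add: square_integrable_def flip: exp_double) (simp add: mult.assoc)
    show "square_integrable M (\<lambda>\<omega>. exp (C * \<bar>X (\<phi> n) \<omega>\<bar>))"
      using X_exp_integrable[of "2 * C" "\<phi> n"] by (simp add: square_integrable_def flip: exp_double) (simp add: mult.assoc)
  qed
  then show ?case by (simp add: distrib_left exp_add)
qed simp

lemma exp_growth_square_integrable:
  fixes f :: "'a \<Rightarrow> 'c::{real_normed_vector, second_countable_topology}" and n :: nat
  assumes [measurable]: "f \<in> borel_measurable M"
    and b: "\<And>\<omega>. norm (f \<omega>) \<le> C * exp (C * (\<Sum>j<n. \<bar>X (\<phi> j) \<omega>\<bar>))"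
  shows "square_integrable M f"
proof (rule square_integrable_bound)
  show "integrable M (\<lambda>\<omega>. C\<^sup>2 * exp ((2 * C) * (\<Sum>j<n. \<bar>X (\<phi> j) \<omega>\<bar>)))"
    by (intro integrable_mult_right exp_sum_integrable)
  show "AE \<omega> in M. (norm (f \<omega>))\<^sup>2 \<le> C\<^sup>2 * exp ((2 * C) * (\<Sum>j<n. \<bar>X (\<phi> j) \<omega>\<bar>))"
  proof (rule AE_I2)
    fix \<omega>
    have "(norm (f \<omega>))\<^sup>2 \<le> (C * exp (C * (\<Sum>j<n. \<bar>X (\<phi> j) \<omega>\<bar>)))\<^sup>2"
      using b by (intro power_mono) auto
    then show "(norm (f \<omega>))\<^sup>2 \<le> C\<^sup>2 * exp ((2 * C) * (\<Sum>j<n. \<bar>X (\<phi> j) \<omega>\<bar>))"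
      by (simp add: power_mult_distrib mult.assoc flip: exp_double)
  qed
qed measurable

lemma X_square_integrable: "square_integrable M (X h)"
proof (rule exp_growth_square_integrable[where C = 1 and n = 1 and \<phi> = "\<lambda>_. h"])
  show "norm (X h \<omega>) \<le> 1 * exp (1 * (\<Sum>j<(1::nat). \<bar>X h \<omega>\<bar>))" for \<omega>
    using abs_le_exp_abs[of "X h \<omega>"] by simp
qed simp

text \<open>Linearity is not an axiom of the process. It follows from the covariance: the mean
  square of the difference expands into inner products that cancel.\<close>

lemma X_linear: "AE \<omega> in M. (\<Sum>i<n::nat. c i * X (h i) \<omega>) = X (\<Sum>i<n. c i *\<^sub>R h i) \<omega>"
proof -
  define Y where "Y \<omega> = (\<Sum>i<n. c i * X (h i) \<omega>)" for \<omega>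
  define k where "k = (\<Sum>i<n. c i *\<^sub>R h i)"
  have Y: "square_integrable M Y"
    unfolding Y_def by (intro square_integrable_sum square_integrable_mult X_square_integrable)
  have Yk: "(\<integral>\<omega>. Y \<omega> * W \<omega> \<partial>M) = (\<Sum>i<n. c i * (\<integral>\<omega>. X (h i) \<omega> * W \<omega> \<partial>M))"
    if "square_integrable M W" for W
    unfolding Y_def sum_distrib_right
    by (subst Bochner_Integration.integral_sum)
      (auto simp: mult.assoc intro!: integrable_mult_right integrable_mult_sq X_square_integrable that)
  have 1: "(\<integral>\<omega>. Y \<omega> * X g \<omega> \<partial>M) = inner k g" for g
    by (simp add: Yk[OF X_square_integrable] covariance k_def inner_sum_left)
  have 2: "(\<integral>\<omega>. Y \<omega> * Y \<omega> \<partial>M) = inner k k"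
  proof -
    have "(\<integral>\<omega>. Y \<omega> * Y \<omega> \<partial>M) = (\<Sum>i<n. c i * inner k (h i))"
      using Yk[OF Y] by (simp add: mult.commute[of "X _ _" "Y _"] 1)
    also have "\<dots> = inner k k" by (simp add: inner_sum_right k_def)
    finally show ?thesis .
  qed
  have "msq M (\<lambda>\<omega>. Y \<omega> - X k \<omega>) = 0"
    unfolding msq_diff[OF Y X_square_integrable] by (simp add: msq_eq_inner 1 2 covariance)
  moreover have "square_integrable M (\<lambda>\<omega>. Y \<omega> - X k \<omega>)" by (intro square_integrable_diff Y X_square_integrable)
  ultimately have "AE \<omega> in M. (norm (Y \<omega> - X k \<omega>))\<^sup>2 = 0"
    by (subst integral_nonneg_eq_0_iff_AE[OF square_integrable_norm_sq, symmetric]) (auto simp: msq_def)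
  then show ?thesis by eventually_elim (simp add: Y_def k_def)
qed

lemma X_scale: "AE \<omega> in M. X (c *\<^sub>R h) \<omega> = c * X h \<omega>"
  using X_linear[where n = 1 and c = "\<lambda>_. c" and h = "\<lambda>_. h"] by auto

text \<open>The covariance excludes the degenerate law and fixes the variance to 1.\<close>

lemma X_std_normal:
  assumes "norm h = 1"
  shows "distributed M lborel (X h) std_normal_density"
proof (cases rule: X_cases[of h])
  case 1
  have "(\<integral>\<omega>. X h \<omega> * X h \<omega> \<partial>M) = (\<integral>\<omega>. 0 \<partial>M)"
    by (rule integral_cong_AE) (use 1 in auto)
  then show ?thesis using assms covariance[of h h] by (simp add: dot_square_norm)
next
  case (2 \<sigma>)
  have "variance (X h) = \<sigma>\<^sup>2" "expectation (X h) = 0"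
    using normal_distributed_variance[OF 2] normal_distributed_expectation[OF 2] by auto
  then have "\<sigma>\<^sup>2 = 1" using assms covariance[of h h] by (simp add: dot_square_norm power2_eq_square)
  then have "\<sigma> = 1" using 2(1) by (simp add: power2_eq_1_iff)
  then show ?thesis using 2 by simp
qed

lemma X_trig:
  "(\<integral>\<omega>. cos (X h \<omega>) \<partial>M) = exp (- (norm h)\<^sup>2 / 2)" "(\<integral>\<omega>. sin (X h \<omega>) \<partial>M) = 0"
proof -
  have "(\<integral>\<omega>. cos (X h \<omega>) \<partial>M) = exp (- (norm h)\<^sup>2 / 2) \<and> (\<integral>\<omega>. sin (X h \<omega>) \<partial>M) = 0"
  proof (cases "h = 0")
    case True
    then have "AE \<omega> in M. X h \<omega> = 0" using X_scale[of 0 0] by simp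
    then have "(\<integral>\<omega>. cos (X h \<omega>) \<partial>M) = (\<integral>\<omega>. 1 \<partial>M)" "(\<integral>\<omega>. sin (X h \<omega>) \<partial>M) = (\<integral>\<omega>. 0 \<partial>M)"
      by (intro integral_cong_AE; auto)+
    then show ?thesis by (simp add: True prob_space)
  next
    case False
    define u where "u = (1 / norm h) *\<^sub>R h"
    have u: "norm u = 1" "h = norm h *\<^sub>R u" using False by (simp_all add: u_def)
    have d: "distr M lborel (X u) = density lborel std_normal_density"
      using X_std_normal[OF u(1)] by (rule distributed_distr_eq_density)
    have dist: "distr M borel (X u) = density lborel std_normal_density"
      unfolding d[symmetric] by (rule distr_cong) auto
    have ae: "AE \<omega> in M. X h \<omega> = norm h * X u \<omega>" using X_scale[of "norm h" u] u(2) by simp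
    have "(\<integral>\<omega>. iexp (norm h * X u \<omega>) \<partial>M) = char (distr M borel (X u)) (norm h)"
      by (simp add: char_def integral_distr)
    also have "\<dots> = of_real (exp (- (norm h)\<^sup>2 / 2))"
      unfolding dist by (simp add: char_std_normal_distribution)
    finally have c: "(\<integral>\<omega>. iexp (norm h * X u \<omega>) \<partial>M) = of_real (exp (- (norm h)\<^sup>2 / 2))" .
    have i: "integrable M (\<lambda>\<omega>. iexp (norm h * X u \<omega>))"
      by (rule integrable_iexp) auto
    have euler: "Re (iexp r) = cos r" "Im (iexp r) = sin r" for r by (simp_all add: Re_exp Im_exp)
    have "(\<integral>\<omega>. cos (X h \<omega>) \<partial>M) = (\<integral>\<omega>. Re (iexp (norm h * X u \<omega>)) \<partial>M)"
      unfolding euler by (rule integral_cong_AE) (use ae in auto)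
    moreover have "(\<integral>\<omega>. sin (X h \<omega>) \<partial>M) = (\<integral>\<omega>. Im (iexp (norm h * X u \<omega>)) \<partial>M)"
      unfolding euler by (rule integral_cong_AE) (use ae in auto)
    ultimately show ?thesis
      using integral_Re[OF i] integral_Im[OF i] c by simp
  qed
  then show "(\<integral>\<omega>. cos (X h \<omega>) \<partial>M) = exp (- (norm h)\<^sup>2 / 2)" "(\<integral>\<omega>. sin (X h \<omega>) \<partial>M) = 0" by auto
qed

lemma X_trig_sum:
  fixes n :: nat
  shows "(\<integral>\<omega>. cos ((\<Sum>i<n. c i * X (h i) \<omega>) + t * X k \<omega>) \<partial>M) = exp (- (norm ((\<Sum>i<n. c i *\<^sub>R h i) + t *\<^sub>R k))\<^sup>2 / 2)"
    and "(\<integral>\<omega>. sin ((\<Sum>i<n. c i * X (h i) \<omega>) + t * X k \<omega>) \<partial>M) = 0"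
proof -
  define H where "H = (\<Sum>i<n. c i *\<^sub>R h i) + t *\<^sub>R k"
  have "AE \<omega> in M. (\<Sum>i<Suc n. (c(n := t)) i * X ((h(n := k)) i) \<omega>) = X (\<Sum>i<Suc n. (c(n := t)) i *\<^sub>R (h(n := k)) i) \<omega>"
    by (rule X_linear)
  then have ae: "AE \<omega> in M. (\<Sum>i<n. c i * X (h i) \<omega>) + t * X k \<omega> = X H \<omega>" by (simp add: H_def)
  have "(\<integral>\<omega>. cos ((\<Sum>i<n. c i * X (h i) \<omega>) + t * X k \<omega>) \<partial>M) = (\<integral>\<omega>. cos (X H \<omega>) \<partial>M)"
    "(\<integral>\<omega>. sin ((\<Sum>i<n. c i * X (h i) \<omega>) + t * X k \<omega>) \<partial>M) = (\<integral>\<omega>. sin (X H \<omega>) \<partial>M)"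
    by (rule integral_cong_AE; use ae in auto)+
  then show "(\<integral>\<omega>. cos ((\<Sum>i<n. c i * X (h i) \<omega>) + t * X k \<omega>) \<partial>M) = exp (- (norm ((\<Sum>i<n. c i *\<^sub>R h i) + t *\<^sub>R k))\<^sup>2 / 2)"
    "(\<integral>\<omega>. sin ((\<Sum>i<n. c i * X (h i) \<omega>) + t * X k \<omega>) \<partial>M) = 0"
    by (simp_all add: X_trig H_def)
qed

text \<open>Orthogonality makes the characteristic functions factor, by Pythagoras in the exponent.
  Factorization is then extended from trigonometric functions to events, first on the side of
  \<open>X h\<close>, then on the side of the family. \<open>indep_var\<close> takes two variables
  with values in one type, so \<open>X h\<close> enters as a constant sequence.\<close>

lemma X_indep:
  fixes k :: "nat \<Rightarrow> 'h"
  assumes orth: "\<And>i. inner (k i) h = 0"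
  shows "indep_var borel (\<lambda>\<omega> _. X h \<omega>) borel (\<lambda>\<omega> i. X (k i) \<omega>)"
proof -
  let ?W = "\<lambda>\<omega> i. X (k i) \<omega>" and ?V = "\<lambda>\<omega> (_::nat). X h \<omega>"
  have Vm: "?V \<in> borel_measurable M" by (rule measurable_coordinatewise_then_product) simp
  have Wm: "?W \<in> borel_measurable M" by (rule measurable_coordinatewise_then_product) simp
  have bint: "integrable M f" if [measurable]: "f \<in> borel_measurable M" and "\<And>\<omega>. \<bar>f \<omega>\<bar> \<le> 1" for f :: "'a \<Rightarrow> real"
    using integrable_mult_bounded[of M "\<lambda>_. 1" f 1] that by simp
  have step1: "(\<integral>\<omega>. cos (\<Sum>j<n. c j * X (k (i j)) \<omega>) * indicator B (X h \<omega>) \<partial>M)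
        = (\<integral>\<omega>. cos (\<Sum>j<n. c j * X (k (i j)) \<omega>) \<partial>M) * (\<integral>\<omega>. indicator B (X h \<omega>) \<partial>M) \<and>
      (\<integral>\<omega>. sin (\<Sum>j<n. c j * X (k (i j)) \<omega>) * indicator B (X h \<omega>) \<partial>M)
        = (\<integral>\<omega>. sin (\<Sum>j<n. c j * X (k (i j)) \<omega>) \<partial>M) * (\<integral>\<omega>. indicator B (X h \<omega>) \<partial>M)"
    if B [measurable]: "B \<in> sets borel" for B and n :: nat and c i
  proof -
    define \<theta> where "\<theta> \<omega> = (\<Sum>j<n. c j * X (k (i j)) \<omega>)" for \<omega>
    have [measurable]: "\<theta> \<in> borel_measurable M" unfolding \<theta>_def by measurable
    define \<kappa> where "\<kappa> = (\<Sum>j<n. c j *\<^sub>R k (i j))"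
    have "inner \<kappa> h = 0" by (simp add: \<kappa>_def inner_sum_left orth)
    then have pyth: "(norm (\<kappa> + t *\<^sub>R h))\<^sup>2 = (norm \<kappa>)\<^sup>2 + (norm (t *\<^sub>R h))\<^sup>2" for t
      by (simp add: power2_norm_eq_inner inner_add_left inner_add_right inner_commute[of h \<kappa>] power_mult_distrib)
        (simp add: power2_eq_square)
    have tc: "(\<integral>\<omega>. cos (\<theta> \<omega> + t * X h \<omega>) \<partial>M) = exp (- (norm \<kappa>)\<^sup>2 / 2) * exp (- (norm (t *\<^sub>R h))\<^sup>2 / 2)" for t
      using X_trig_sum(1)[where n = n and c = c and h = "\<lambda>j. k (i j)" and t = t and k = h]
      by (simp only: pyth \<theta>_def[symmetric] \<kappa>_def[symmetric] exp_add[symmetric]) (simp add: field_simps)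
    have ts: "(\<integral>\<omega>. sin (\<theta> \<omega> + t * X h \<omega>) \<partial>M) = 0" for t
      using X_trig_sum(2)[where n = n and c = c and h = "\<lambda>j. k (i j)" and t = t and k = h]
      by (simp only: \<theta>_def[symmetric])
    have hc: "(\<integral>\<omega>. cos (t * X h \<omega>) \<partial>M) = exp (- (norm (t *\<^sub>R h))\<^sup>2 / 2)" "(\<integral>\<omega>. sin (t * X h \<omega>) \<partial>M) = 0" for t
      using X_trig_sum[where n = 0 and t = t and k = h] by simp_all
    have \<theta>c: "(\<integral>\<omega>. cos (\<theta> \<omega>) \<partial>M) = exp (- (norm \<kappa>)\<^sup>2 / 2)" "(\<integral>\<omega>. sin (\<theta> \<omega>) \<partial>M) = 0"
      using tc[of 0] ts[of 0] by simp_all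
    have ii: "integrable M (\<lambda>\<omega>. cos (\<theta> \<omega> + t * X h \<omega>))" "integrable M (\<lambda>\<omega>. sin (\<theta> \<omega> + t * X h \<omega>))"
      "integrable M (\<lambda>\<omega>. cos (t * X h \<omega>))" "integrable M (\<lambda>\<omega>. sin (t * X h \<omega>))"
      "integrable M (\<lambda>\<omega>. cos (\<theta> \<omega>))" "integrable M (\<lambda>\<omega>. sin (\<theta> \<omega>))"
      "integrable M (\<lambda>\<omega>. cos (\<theta> \<omega>) * cos (t * X h \<omega>))" "integrable M (\<lambda>\<omega>. cos (\<theta> \<omega>) * sin (t * X h \<omega>))"
      "integrable M (\<lambda>\<omega>. sin (\<theta> \<omega>) * cos (t * X h \<omega>))" "integrable M (\<lambda>\<omega>. sin (\<theta> \<omega>) * sin (t * X h \<omega>))"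
      "integrable M (\<lambda>\<omega>. indicator B (X h \<omega>) :: real)"
      "integrable M (\<lambda>\<omega>. cos (\<theta> \<omega>) * indicator B (X h \<omega>))" "integrable M (\<lambda>\<omega>. sin (\<theta> \<omega>) * indicator B (X h \<omega>))" for t
      by (rule bint; simp add: abs_mult mult_le_one indicator_def)+
    have ii2: "integrable M (\<lambda>\<omega>. cos (\<theta> \<omega> + t * X h \<omega>))" "integrable M (\<lambda>\<omega>. cos (\<theta> \<omega> + (-t) * X h \<omega>))"
      "integrable M (\<lambda>\<omega>. sin (\<theta> \<omega> + t * X h \<omega>))" "integrable M (\<lambda>\<omega>. sin (\<theta> \<omega> + (-t) * X h \<omega>))" for t
      by (rule ii)+
    have cc: "(\<integral>\<omega>. cos (\<theta> \<omega>) * cos (t * X h \<omega>) \<partial>M) = exp (- (norm \<kappa>)\<^sup>2 / 2) * exp (- (norm (t *\<^sub>R h))\<^sup>2 / 2)" for t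
    proof -
      have "(\<lambda>\<omega>. cos (\<theta> \<omega>) * cos (t * X h \<omega>)) = (\<lambda>\<omega>. (cos (\<theta> \<omega> + t * X h \<omega>) + cos (\<theta> \<omega> + (-t) * X h \<omega>)) / 2)"
        by (simp add: fun_eq_iff cos_add cos_diff)
      then show ?thesis using ii2[of t] tc[of t] tc[of "-t"] by (simp only: integral_divide_zero Bochner_Integration.integral_add) simp
    qed
    have ss: "(\<integral>\<omega>. sin (\<theta> \<omega>) * sin (t * X h \<omega>) \<partial>M) = 0" for t
    proof -
      have "(\<lambda>\<omega>. sin (\<theta> \<omega>) * sin (t * X h \<omega>)) = (\<lambda>\<omega>. (cos (\<theta> \<omega> + (-t) * X h \<omega>) - cos (\<theta> \<omega> + t * X h \<omega>)) / 2)"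
        by (simp add: fun_eq_iff cos_add cos_diff)
      then show ?thesis using ii2[of t] tc[of t] tc[of "-t"] by (simp only: integral_divide_zero Bochner_Integration.integral_diff) simp
    qed
    have sc: "(\<integral>\<omega>. sin (\<theta> \<omega>) * cos (t * X h \<omega>) \<partial>M) = 0" for t
    proof -
      have "(\<lambda>\<omega>. sin (\<theta> \<omega>) * cos (t * X h \<omega>)) = (\<lambda>\<omega>. (sin (\<theta> \<omega> + t * X h \<omega>) + sin (\<theta> \<omega> + (-t) * X h \<omega>)) / 2)"
        by (simp add: fun_eq_iff sin_add sin_diff)
      then show ?thesis using ii2[of t] ts[of t] ts[of "-t"] by (simp only: integral_divide_zero Bochner_Integration.integral_add) simp
    qed
    have cs: "(\<integral>\<omega>. cos (\<theta> \<omega>) * sin (t * X h \<omega>) \<partial>M) = 0" for t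
    proof -
      have "(\<lambda>\<omega>. cos (\<theta> \<omega>) * sin (t * X h \<omega>)) = (\<lambda>\<omega>. (sin (\<theta> \<omega> + t * X h \<omega>) - sin (\<theta> \<omega> + (-t) * X h \<omega>)) / 2)"
        by (simp add: fun_eq_iff sin_add sin_diff)
      then show ?thesis using ii2[of t] ts[of t] ts[of "-t"] by (simp only: integral_divide_zero Bochner_Integration.integral_diff) simp
    qed
    \<comment> \<open>Once its mean is subtracted, cos \<theta> is orthogonal to every cos (t X h)
      and sin (t X h), hence to indicators of events of \<open>X h\<close>.\<close>
    have "(\<integral>\<omega>. (cos (\<theta> \<omega>) - exp (- (norm \<kappa>)\<^sup>2 / 2)) * indicator B (X h \<omega>) \<partial>M) = 0"
      by (rule trig_orthogonal_unique[OF _ _ B])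
        (use ii cc cs hc in \<open>auto simp: left_diff_distrib\<close>)
    moreover have "(\<integral>\<omega>. sin (\<theta> \<omega>) * indicator B (X h \<omega>) \<partial>M) = 0"
      by (rule trig_orthogonal_unique[OF _ _ B])
        (use ii ss sc in auto)
    ultimately show ?thesis
      unfolding \<theta>_def[symmetric] using ii by (simp add: left_diff_distrib \<theta>c)
  qed
  have step2: "prob ((X h -` B \<inter> space M) \<inter> A) = prob (X h -` B \<inter> space M) * prob A"
    if B [measurable]: "B \<in> sets borel" and A: "A \<in> sigma_sets (space M) {X (k i) -` B \<inter> space M | i B. B \<in> sets borel}" for A B
  proof -
    define p :: real where "p = (\<integral>\<omega>. indicator B (X h \<omega>) \<partial>M)"
    have [measurable]: "A \<in> sets M"
      using A by (rule sets.sigma_sets_subset[THEN subsetD, rotated]) auto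
    have iB: "integrable M (\<lambda>\<omega>. indicator B (X h \<omega>) :: real)" by (rule bint) (auto simp: indicator_def)
    have iBA: "integrable M (\<lambda>\<omega>. indicator B (X h \<omega>) * indicator A \<omega> :: real)" by (rule bint) (auto simp: indicator_def)
    have iA: "integrable M (\<lambda>\<omega>. indicator A \<omega> :: real)" by (rule bint) (auto simp: indicator_def)
    have iT: "integrable M (\<lambda>\<omega>. indicator B (X h \<omega>) * cos (\<Sum>j<n. c j * X (k (i j)) \<omega>))"
      "integrable M (\<lambda>\<omega>. indicator B (X h \<omega>) * sin (\<Sum>j<n. c j * X (k (i j)) \<omega>))"
      "integrable M (\<lambda>\<omega>. p * cos (\<Sum>j<n. c j * X (k (i j)) \<omega>))"
      "integrable M (\<lambda>\<omega>. p * sin (\<Sum>j<n. c j * X (k (i j)) \<omega>))" for n :: nat and c i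
      by ((intro integrable_mult_right)?, rule bint; simp add: abs_mult mult_le_one indicator_def)+
    \<comment> \<open>The roles are exchanged: the centred indicator is now orthogonal to the
      trigonometric functions of the family, hence to every event that the family generates.\<close>
    have "trig_orthogonal M (\<lambda>i. X (k i)) (\<lambda>\<omega>. indicator B (X h \<omega>) - p)"
    proof (rule trig_orthogonalI)
      show "integrable M (\<lambda>\<omega>. indicator B (X h \<omega>) - p)" using iB by simp
      fix n :: nat and c i
      show "(\<integral>\<omega>. (indicator B (X h \<omega>) - p) * cos (\<Sum>j<n. c j * X (k (i j)) \<omega>) \<partial>M) = 0"
        unfolding left_diff_distrib Bochner_Integration.integral_diff[OF iT(1) iT(3)] integral_mult_right_zero
        using step1[OF B, of c i n] by (simp add: p_def mult.commute)
      show "(\<integral>\<omega>. (indicator B (X h \<omega>) - p) * sin (\<Sum>j<n. c j * X (k (i j)) \<omega>) \<partial>M) = 0"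
        unfolding left_diff_distrib Bochner_Integration.integral_diff[OF iT(2) iT(4)] integral_mult_right_zero
        using step1[OF B, of c i n] by (simp add: p_def mult.commute)
    qed
    from trig_orthogonal_sigma_sets[OF _ this A]
    have "(\<integral>\<omega>. (indicator B (X h \<omega>) - p) * indicator A \<omega> \<partial>M) = 0" by simp
    then have "(\<integral>\<omega>. indicator B (X h \<omega>) * indicator A \<omega> \<partial>M) = p * (\<integral>\<omega>. indicator A \<omega> \<partial>M)"
      using iBA iA by (simp add: left_diff_distrib)
    moreover have "(\<integral>\<omega>. (indicator B (X h \<omega>) * indicator A \<omega> :: real) \<partial>M) = (\<integral>\<omega>. indicator ((X h -` B \<inter> space M) \<inter> A) \<omega> \<partial>M)"
      by (intro Bochner_Integration.integral_cong) (auto simp: indicator_def)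
    moreover have "p = (\<integral>\<omega>. indicator (X h -` B \<inter> space M) \<omega> \<partial>M)"
      unfolding p_def by (intro Bochner_Integration.integral_cong) (auto simp: indicator_def)
    ultimately show ?thesis by simp
  qed
  have sub: "sigma_sets (space M) {?W -` A \<inter> space M | A. A \<in> sets borel}
      \<subseteq> sigma_sets (space M) {X (k i) -` B \<inter> space M | i B. B \<in> sets borel}"
  proof (rule sigma_sets_mono, safe)
    fix A :: "(nat \<Rightarrow> real) set" assume A: "A \<in> sets borel"
    let ?N = "sigma (space M) {X (k i) -` B \<inter> space M | i B. B \<in> sets borel}"
    have G: "{X (k i) -` B \<inter> space M | i B. B \<in> sets borel} \<subseteq> Pow (space M)" by auto
    have "?W \<in> borel_measurable ?N"
    proof (rule measurable_coordinatewise_then_product)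
      fix i
      show "(\<lambda>\<omega>. ?W \<omega> i) \<in> borel_measurable ?N"
        using G by (intro measurableI) (auto simp: space_measure_of intro!: in_measure_of)
    qed
    then have "?W -` A \<inter> space ?N \<in> sets ?N" using A by (rule measurable_sets)
    then show "?W -` A \<inter> space M \<in> sigma_sets (space M) {X (k i) -` B \<inter> space M | i B. B \<in> sets borel}"
      using G by (simp add: space_measure_of sets_measure_of)
  qed
  have sub2: "\<exists>B\<in>sets borel. A = X h -` B \<inter> space M"
    if "A \<in> sigma_sets (space M) {?V -` B \<inter> space M | B. B \<in> sets borel}" for A
  proof -
    have "A \<in> sets (vimage_algebra (space M) ?V borel)"
      using that by (simp add: sets_vimage_algebra)
    then obtain B where B: "B \<in> sets borel" "A = ?V -` B \<inter> space M" by (auto simp: sets_vimage_algebra2)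
    \<comment> \<open>The embedding of reals as constant sequences pulls a Borel set of sequences
      back to a Borel set of reals.\<close>
    have "(\<lambda>x::real. (\<lambda>_::nat. x)) \<in> borel_measurable borel"
      by (rule measurable_coordinatewise_then_product) simp
    from measurable_sets[OF this B(1)] show ?thesis using B(2)
      by (intro bexI[of _ "(\<lambda>x _. x) -` B"]) auto
  qed
  show ?thesis
    unfolding indep_var_eq indep_sets2_eq
  proof (intro conjI ballI)
    fix A C assume A: "A \<in> sigma_sets (space M) {?V -` B \<inter> space M | B. B \<in> sets borel}"
      and C: "C \<in> sigma_sets (space M) {?W -` A \<inter> space M | A. A \<in> sets borel}"
    obtain B where "B \<in> sets borel" "A = X h -` B \<inter> space M" using sub2[OF A] by blast
    then show "prob (A \<inter> C) = prob A * prob C" using step2[of B C] C sub by auto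
  next
    show "sigma_sets (space M) {?V -` A \<inter> space M | A. A \<in> sets borel} \<subseteq> events"
      using Vm by (intro sets.sigma_sets_subset) auto
    show "sigma_sets (space M) {?W -` A \<inter> space M | A. A \<in> sets borel} \<subseteq> events"
      using Wm by (intro sets.sigma_sets_subset) auto
  qed (use Wm Vm in auto)
qed

end

section \<open>Gaussian integration by parts\<close>

lemma sum_lessThan_plus: "(\<Sum>i<n + m. f i) = (\<Sum>i<n. f i) + (\<Sum>i<m. f (n + i))"
  for f :: "nat \<Rightarrow> 'c::comm_monoid_add" and n m :: nat
  by (induction m) (simp_all add: add.assoc)

lemma tendsto_coordinatewise:
  fixes f :: "'a \<Rightarrow> 'i \<Rightarrow> 'b::topological_space"
  assumes "\<And>i. ((\<lambda>t. f t i) \<longlongrightarrow> l i) F"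
  shows "(f \<longlongrightarrow> l) F"
proof -
  have "limitin (product_topology (\<lambda>i. euclidean) UNIV) f l F"
    unfolding limitin_componentwise using assms by auto
  then show ?thesis by (simp add: euclidean_product_topology)
qed

lemma MVT_abs:
  fixes f :: "real \<Rightarrow> real"
  assumes "\<And>x. (f has_real_derivative f' x) (at x)"
  obtains z where "\<bar>z - a\<bar> \<le> \<bar>b - a\<bar>" "f b - f a = (b - a) * f' z"
proof (cases a b rule: linorder_cases)
  case less
  obtain z where "a < z" "z < b" "f b - f a = (b - a) * f' z" using MVT2[OF less, of f f'] assms by blast
  then show ?thesis by (intro that[of z]) auto
next
  case equal
  then show ?thesis by (intro that[of a]) auto
next
  case greater
  obtain z where "b < z" "z < a" "f a - f b = (a - b) * f' z" using MVT2[OF greater, of f f'] assms by blast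
  then show ?thesis by (intro that[of z]) (auto simp: algebra_simps)
qed

text \<open>The chain rule from continuous partial derivatives on the product space. The coordinates
  are moved one at a time; the mean value theorem evaluates each increment at an intermediate point,
  which converges coordinatewise to the base point.\<close>

lemma has_real_derivative_along_line:
  fixes \<gamma> :: "(nat \<Rightarrow> real) \<Rightarrow> real"
  assumes dep: "depends_on_first n \<gamma>"
    and d: "\<And>i x. i < n \<Longrightarrow> ((\<lambda>t. \<gamma> (x(i := t))) has_real_derivative \<gamma>' i x) (at (x i))"
    and cont: "\<And>i. i < n \<Longrightarrow> continuous_on UNIV (\<gamma>' i)"
  shows "((\<lambda>t. \<gamma> (\<lambda>j. w j + t * c j)) has_real_derivative (\<Sum>i<n. c i * \<gamma>' i (\<lambda>j. w j + t0 * c j))) (at t0)"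
proof -
  have part: "((\<lambda>t. \<gamma> (\<lambda>j. if j < m then w j + t * c j else w j)) has_real_derivative (\<Sum>i<m. c i * \<gamma>' i w)) (at 0)"
    if "m \<le> n" for m w
    using that
  proof (induction m)
    case (Suc m)
    define u where "u t = (\<lambda>j. if j < m then w j + t * c j else w j)" for t
    define B where "B t = \<gamma> ((u t)(m := w m + t * c m)) - \<gamma> (u t)" for t
    have um: "(u t)(m := w m) = u t" for t by (auto simp: u_def)
    have "\<exists>\<xi>. \<bar>\<xi> - w m\<bar> \<le> \<bar>t * c m\<bar> \<and> B t = t * c m * \<gamma>' m ((u t)(m := \<xi>))" for t
    proof -
      have "((\<lambda>s. \<gamma> ((u t)(m := s))) has_real_derivative \<gamma>' m ((u t)(m := s))) (at s)" for s
        using d[of m "(u t)(m := s)"] Suc.prems by simp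
      from MVT_abs[OF this, of "w m" "w m + t * c m"] show ?thesis by (metis B_def um add_diff_cancel_left')
    qed
    then obtain \<xi> where \<xi>: "\<And>t. \<bar>\<xi> t - w m\<bar> \<le> \<bar>t * c m\<bar>" "\<And>t. B t = t * c m * \<gamma>' m ((u t)(m := \<xi> t))" by metis
    have "((\<lambda>t. \<xi> t - w m) \<longlongrightarrow> 0) (at 0)"
    proof (rule Lim_null_comparison)
      show "\<forall>\<^sub>F t in at 0. norm (\<xi> t - w m) \<le> \<bar>t * c m\<bar>" using \<xi>(1) by simp
      show "((\<lambda>t. \<bar>t * c m\<bar>) \<longlongrightarrow> 0) (at 0)" by (auto intro!: tendsto_eq_intros)
    qed
    then have \<xi>lim: "(\<xi> \<longlongrightarrow> w m) (at 0)" by (rule LIM_zero_cancel)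
    have "((\<lambda>t. (u t)(m := \<xi> t)) \<longlongrightarrow> w) (at 0)"
    proof (rule tendsto_coordinatewise)
      fix i
      have "((\<lambda>t. w i + t * c i) \<longlongrightarrow> w i) (at 0)" by (auto intro!: tendsto_eq_intros)
      then show "((\<lambda>t. ((u t)(m := \<xi> t)) i) \<longlongrightarrow> w i) (at 0)"
        using \<xi>lim by (cases "i = m"; cases "i < m") (auto simp: u_def)
    qed
    moreover have "isCont (\<gamma>' m) w" using cont[of m] Suc.prems by (simp add: continuous_on_eq_continuous_at)
    ultimately have "((\<lambda>t. \<gamma>' m ((u t)(m := \<xi> t))) \<longlongrightarrow> \<gamma>' m w) (at 0)" by (rule isCont_tendsto_compose[rotated])
    then have "((\<lambda>t. c m * \<gamma>' m ((u t)(m := \<xi> t))) \<longlongrightarrow> c m * \<gamma>' m w) (at 0)" by (intro tendsto_intros)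
    moreover have "\<forall>\<^sub>F t in at 0. c m * \<gamma>' m ((u t)(m := \<xi> t)) = (B t - B 0) / (t - 0)"
      using \<xi>(2)[of 0] by (auto simp: eventually_at_filter \<xi>(2))
    ultimately have "((\<lambda>t. (B t - B 0) / (t - 0)) \<longlongrightarrow> c m * \<gamma>' m w) (at 0)" by (rule Lim_transform_eventually)
    then have "(B has_real_derivative c m * \<gamma>' m w) (at 0)" by (simp add: has_field_derivative_iff)
    then have "((\<lambda>t. \<gamma> (u t) + B t) has_real_derivative (\<Sum>i<m. c i * \<gamma>' i w) + c m * \<gamma>' m w) (at 0)"
      using Suc unfolding u_def by (intro DERIV_add) auto
    moreover have "\<gamma> (u t) + B t = \<gamma> (\<lambda>j. if j < Suc m then w j + t * c j else w j)" for t
    proof -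
      have "(u t)(m := w m + t * c m) = (\<lambda>j. if j < Suc m then w j + t * c j else w j)"
        by (auto simp: u_def fun_eq_iff)
      then show ?thesis by (simp add: B_def)
    qed
    ultimately show ?case by simp
  qed simp
  \<comment> \<open>The induction differentiates at parameter 0 from an arbitrary base point;
    parameter t0 is reached by moving the base point along the line.\<close>
  let ?w = "\<lambda>j. w j + t0 * c j"
  have "((\<lambda>t. \<gamma> (\<lambda>j. if j < n then ?w j + t * c j else ?w j)) has_real_derivative (\<Sum>i<n. c i * \<gamma>' i ?w)) (at 0)"
    by (rule part) simp
  moreover have "\<gamma> (\<lambda>j. if j < n then ?w j + t * c j else ?w j) = \<gamma> (\<lambda>j. w j + (t0 + t) * c j)" for t
    using dep unfolding depends_on_first_def by (auto simp: algebra_simps)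
  ultimately have "((\<lambda>t. \<gamma> (\<lambda>j. w j + (t0 + t) * c j)) has_real_derivative (\<Sum>i<n. c i * \<gamma>' i ?w)) (at 0)" by simp
  then show ?thesis
    using DERIV_shift[of "\<lambda>t. \<gamma> (\<lambda>j. w j + t * c j)" "\<Sum>i<n. c i * \<gamma>' i ?w" 0 t0] by (simp add: add.commute)
qed

text \<open>A class for integration by parts that contains both the compactly supported smooth
  functions and the polynomials and is closed under products. The partial derivatives are carried as
  data. One constant serves as factor and as exponential rate, so that bounds can simply be
  enlarged.\<close>

definition tame :: "nat \<Rightarrow> ((nat \<Rightarrow> real) \<Rightarrow> real) \<Rightarrow> (nat \<Rightarrow> (nat \<Rightarrow> real) \<Rightarrow> real) \<Rightarrow> bool" where
  "tame n \<gamma> \<gamma>' \<longleftrightarrow> depends_on_first n \<gamma> \<and> continuous_on UNIV \<gamma> \<and>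
     (\<forall>i<n. continuous_on UNIV (\<gamma>' i) \<and>
        (\<forall>x. ((\<lambda>t. \<gamma> (x(i := t))) has_real_derivative \<gamma>' i x) (at (x i)))) \<and>
     (\<exists>C. \<forall>x. \<bar>\<gamma> x\<bar> \<le> C * exp (C * (\<Sum>j<n. \<bar>x j\<bar>)) \<and>
        (\<forall>i<n. \<bar>\<gamma>' i x\<bar> \<le> C * exp (C * (\<Sum>j<n. \<bar>x j\<bar>))))"

definition tame_cylindrical ::
    "('h::real_inner \<Rightarrow> 'a \<Rightarrow> real) \<Rightarrow> ('a \<Rightarrow> real) \<Rightarrow> ('a \<Rightarrow> 'h) \<Rightarrow> bool" where
  "tame_cylindrical X G DG \<longleftrightarrow> (\<exists>n \<gamma> \<gamma>' \<phi>. tame n \<gamma> \<gamma>' \<and> G = (\<lambda>\<omega>. \<gamma> (\<lambda>j. X (\<phi> j) \<omega>)) \<and>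
     DG = (\<lambda>\<omega>. \<Sum>i<n. \<gamma>' i (\<lambda>j. X (\<phi> j) \<omega>) *\<^sub>R \<phi> i))"

lemma tameD:
  assumes "tame n \<gamma> \<gamma>'"
  shows "depends_on_first n \<gamma>" "continuous_on UNIV \<gamma>" "\<And>i. i < n \<Longrightarrow> continuous_on UNIV (\<gamma>' i)"
    "\<And>i x. i < n \<Longrightarrow> ((\<lambda>t. \<gamma> (x(i := t))) has_real_derivative \<gamma>' i x) (at (x i))"
  using assms by (auto simp: tame_def)

lemma tame_bound:
  assumes "tame n \<gamma> \<gamma>'"
  obtains C where "C \<ge> 0" "\<And>x. \<bar>\<gamma> x\<bar> \<le> C * exp (C * (\<Sum>j<n. \<bar>x j\<bar>))"
    "\<And>i x. i < n \<Longrightarrow> \<bar>\<gamma>' i x\<bar> \<le> C * exp (C * (\<Sum>j<n. \<bar>x j\<bar>))"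
proof -
  obtain C where C: "\<And>x. \<bar>\<gamma> x\<bar> \<le> C * exp (C * (\<Sum>j<n. \<bar>x j\<bar>))"
    "\<And>i x. i < n \<Longrightarrow> \<bar>\<gamma>' i x\<bar> \<le> C * exp (C * (\<Sum>j<n. \<bar>x j\<bar>))"
  proof -
    obtain C where "\<forall>x. \<bar>\<gamma> x\<bar> \<le> C * exp (C * (\<Sum>j<n. \<bar>x j\<bar>)) \<and>
        (\<forall>i<n. \<bar>\<gamma>' i x\<bar> \<le> C * exp (C * (\<Sum>j<n. \<bar>x j\<bar>)))"
      using assms unfolding tame_def by blast
    then show thesis by (intro that[of C]) auto
  qed
  have "0 \<le> C * exp (C * (\<Sum>j<n. \<bar>0\<bar>))" using C(1)[of "\<lambda>_. 0"] by linarith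
  then have "C \<ge> 0" by simp
  then show thesis using that C by blast
qed

lemma mult_exp_mono: "0 \<le> C \<Longrightarrow> C \<le> D \<Longrightarrow> 0 \<le> s \<Longrightarrow> C * exp (C * s) \<le> D * exp (D * s)" for C D s :: real
  by (intro mult_mono) (auto intro: mult_right_mono)

text \<open>The second factor reads the coordinates from \<open>n\<close> on. The factors then
  depend on disjoint coordinates, and every partial derivative of the product consists of a single
  term.\<close>

lemma tame_mult:
  assumes \<gamma>: "tame n \<gamma> \<gamma>'" and \<delta>: "tame m \<delta> \<delta>'"
  shows "tame (n + m) (\<lambda>x. \<gamma> x * \<delta> (\<lambda>j. x (n + j)))
    (\<lambda>i x. if i < n then \<gamma>' i x * \<delta> (\<lambda>j. x (n + j)) else \<gamma> x * \<delta>' (i - n) (\<lambda>j. x (n + j)))"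
proof -
  let ?s = "\<lambda>x j. x (n + j) :: real"
  note d\<gamma> = tameD[OF \<gamma>] and d\<delta> = tameD[OF \<delta>]
  obtain C where C: "C \<ge> 0" "\<And>x. \<bar>\<gamma> x\<bar> \<le> C * exp (C * (\<Sum>j<n. \<bar>x j\<bar>))"
    "\<And>i x. i < n \<Longrightarrow> \<bar>\<gamma>' i x\<bar> \<le> C * exp (C * (\<Sum>j<n. \<bar>x j\<bar>))" using tame_bound[OF \<gamma>] by blast
  obtain D where D: "D \<ge> 0" "\<And>x. \<bar>\<delta> x\<bar> \<le> D * exp (D * (\<Sum>j<m. \<bar>x j\<bar>))"
    "\<And>i x. i < m \<Longrightarrow> \<bar>\<delta>' i x\<bar> \<le> D * exp (D * (\<Sum>j<m. \<bar>x j\<bar>))" using tame_bound[OF \<delta>] by blast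
  \<comment> \<open>Dominates the rates \<open>C\<close> and \<open>D\<close> as well as the factor
    \<open>C * D\<close>.\<close>
  define E where "E = C + D + C * D"
  have E: "0 \<le> E" "C \<le> E" "D \<le> E" "C * D \<le> E" using C D by (auto simp: E_def)
  have split: "(\<Sum>j<n + m. \<bar>x j\<bar>) = (\<Sum>j<n. \<bar>x j\<bar>) + (\<Sum>j<m. \<bar>x (n + j)\<bar>)" for x :: "nat \<Rightarrow> real"
    by (rule sum_lessThan_plus)
  have b: "\<bar>a * b\<bar> \<le> E * exp (E * (\<Sum>j<n + m. \<bar>x j\<bar>))"
    if "\<bar>a\<bar> \<le> C * exp (C * (\<Sum>j<n. \<bar>x j\<bar>))" "\<bar>b\<bar> \<le> D * exp (D * (\<Sum>j<m. \<bar>x (n + j)\<bar>))" for a b :: real and x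
  proof -
    have "\<bar>a * b\<bar> \<le> (C * exp (C * (\<Sum>j<n. \<bar>x j\<bar>))) * (D * exp (D * (\<Sum>j<m. \<bar>x (n + j)\<bar>)))"
      unfolding abs_mult using that C(1) by (intro mult_mono) auto
    also have "\<dots> = (C * D) * (exp (C * (\<Sum>j<n. \<bar>x j\<bar>)) * exp (D * (\<Sum>j<m. \<bar>x (n + j)\<bar>)))" by simp
    also have "\<dots> \<le> E * (exp (E * (\<Sum>j<n. \<bar>x j\<bar>)) * exp (E * (\<Sum>j<m. \<bar>x (n + j)\<bar>)))"
      using E C(1) D(1) by (intro mult_mono) (auto intro!: mult_right_mono sum_nonneg)
    also have "\<dots> = E * exp (E * (\<Sum>j<n + m. \<bar>x j\<bar>))"
      unfolding split by (simp add: distrib_left exp_add)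
    finally show ?thesis .
  qed
  have scont: "continuous_on UNIV (\<lambda>x. h (?s x))" if "continuous_on UNIV h" for h :: "(nat \<Rightarrow> real) \<Rightarrow> real"
    by (rule continuous_on_compose2[OF that]) (auto intro!: continuous_intros)
  show ?thesis
    unfolding tame_def
  proof (intro conjI allI impI)
    show "depends_on_first (n + m) (\<lambda>x. \<gamma> x * \<delta> (?s x))"
      unfolding depends_on_first_def
    proof (intro allI impI)
      fix x y :: "nat \<Rightarrow> real" assume "\<forall>i<n + m. x i = y i"
      then have "\<gamma> x = \<gamma> y" "\<delta> (?s x) = \<delta> (?s y)"
        using d\<gamma>(1) d\<delta>(1) unfolding depends_on_first_def by (metis trans_less_add1, metis nat_add_left_cancel_less)
      then show "\<gamma> x * \<delta> (?s x) = \<gamma> y * \<delta> (?s y)" by simp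
    qed
    show "continuous_on UNIV (\<lambda>x. \<gamma> x * \<delta> (?s x))"
      by (intro continuous_on_mult d\<gamma> scont d\<delta>)
  next
    fix i assume i: "i < n + m"
    show "continuous_on UNIV (\<lambda>x. if i < n then \<gamma>' i x * \<delta> (?s x) else \<gamma> x * \<delta>' (i - n) (?s x))"
      using i by (cases "i < n") (auto intro!: continuous_on_mult d\<gamma> d\<delta> scont)
    fix x :: "nat \<Rightarrow> real"
    show "((\<lambda>t. \<gamma> (x(i := t)) * \<delta> (?s (x(i := t)))) has_real_derivative
        (if i < n then \<gamma>' i x * \<delta> (?s x) else \<gamma> x * \<delta>' (i - n) (?s x))) (at (x i))"
    proof (cases "i < n")
      case True
      then have "?s (x(i := t)) = ?s x" for t by auto
      then show ?thesis using True by (auto intro!: DERIV_cmult_right d\<gamma>)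
    next
      case False
      then have 1: "\<gamma> (x(i := t)) = \<gamma> x" for t
        using d\<gamma>(1) unfolding depends_on_first_def by auto
      have 2: "?s (x(i := t)) = (?s x)(i - n := t)" for t using False by (auto simp: fun_eq_iff)
      have 3: "?s x (i - n) = x i" using False by simp
      show ?thesis unfolding 1 2 using False i d\<delta>(4)[of "i - n" "?s x"]
        unfolding 3 by (auto intro!: DERIV_cmult)
    qed
  next
    show "\<exists>E. \<forall>x. \<bar>\<gamma> x * \<delta> (?s x)\<bar> \<le> E * exp (E * (\<Sum>j<n + m. \<bar>x j\<bar>)) \<and>
        (\<forall>i<n + m. \<bar>if i < n then \<gamma>' i x * \<delta> (?s x) else \<gamma> x * \<delta>' (i - n) (?s x)\<bar>
           \<le> E * exp (E * (\<Sum>j<n + m. \<bar>x j\<bar>)))"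
      using b C D by (intro exI[of _ E]) auto
  qed
qed

lemma poly_exp_bound:
  fixes p :: "real poly"
  obtains C where "C \<ge> 0" "\<And>x. \<bar>poly p x\<bar> \<le> C * exp (C * \<bar>x\<bar>)"
proof -
  have "\<exists>C\<ge>0. \<forall>x. \<bar>poly p x\<bar> \<le> C * exp (C * \<bar>x\<bar>)"
  proof (induction p)
    case (pCons a p)
    then obtain C where C: "C \<ge> 0" "\<And>x. \<bar>poly p x\<bar> \<le> C * exp (C * \<bar>x\<bar>)" by blast
    \<comment> \<open>The bound |x| \<le> exp |x| raises the rate to C + 1, which the summand 1
      provides for.\<close>
    define D where "D = \<bar>a\<bar> + C + 1"
    have D: "D \<ge> 0" using C by (simp add: D_def)
    have "\<bar>poly (pCons a p) x\<bar> \<le> D * exp (D * \<bar>x\<bar>)" for x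
    proof -
      have "\<bar>poly (pCons a p) x\<bar> \<le> \<bar>a\<bar> + \<bar>x\<bar> * \<bar>poly p x\<bar>"
        using abs_triangle_ineq[of a "x * poly p x"] by (simp add: abs_mult)
      also have "\<bar>x\<bar> * \<bar>poly p x\<bar> \<le> exp \<bar>x\<bar> * (C * exp (C * \<bar>x\<bar>))"
        using C by (intro mult_mono abs_le_exp_abs) auto
      also have "\<dots> = C * exp ((C + 1) * \<bar>x\<bar>)" by (simp add: distrib_right exp_add)
      also have "\<dots> \<le> C * exp (D * \<bar>x\<bar>)"
        using C by (intro mult_left_mono) (auto simp: D_def intro!: mult_right_mono)
      also have "\<bar>a\<bar> + C * exp (D * \<bar>x\<bar>) \<le> D * exp (D * \<bar>x\<bar>)"
      proof -
        have "1 \<le> exp (D * \<bar>x\<bar>)" using D by simp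
        then have "\<bar>a\<bar> * 1 \<le> (\<bar>a\<bar> + 1) * exp (D * \<bar>x\<bar>)" by (intro mult_mono) auto
        then show ?thesis by (simp add: D_def algebra_simps)
      qed
      finally show ?thesis by simp
    qed
    then show ?case using D by blast
  qed (auto intro: exI[of _ 0])
  then show thesis using that by blast
qed

lemma tame_poly: "tame 1 (\<lambda>x. poly p (x 0)) (\<lambda>i x. poly (pderiv p) (x 0))"
proof -
  obtain C where C: "C \<ge> 0" "\<And>x. \<bar>poly p x\<bar> \<le> C * exp (C * \<bar>x\<bar>)" using poly_exp_bound by blast
  obtain D where D: "D \<ge> 0" "\<And>x. \<bar>poly (pderiv p) x\<bar> \<le> D * exp (D * \<bar>x\<bar>)" using poly_exp_bound by blast
  have "C * exp (C * \<bar>x\<bar>) \<le> max C D * exp (max C D * \<bar>x\<bar>)" "D * exp (D * \<bar>x\<bar>) \<le> max C D * exp (max C D * \<bar>x\<bar>)" for x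
    using C(1) D(1) by (auto intro!: mult_exp_mono)
  then have "\<exists>E. \<forall>x. \<bar>poly p (x 0)\<bar> \<le> E * exp (E * (\<Sum>j<1::nat. \<bar>x j\<bar>)) \<and>
      (\<forall>i<1::nat. \<bar>poly (pderiv p) (x 0)\<bar> \<le> E * exp (E * (\<Sum>j<1::nat. \<bar>x j\<bar>)))"
    using C(2) D(2) by (intro exI[of _ "max C D"]) (simp, meson order_trans)
  then show ?thesis
    unfolding tame_def
    by (auto simp: depends_on_first_def intro!: continuous_intros poly_DERIV)
qed

lemma coordinate_borel: "(\<lambda>x. x i) \<in> borel_measurable borel" for i :: nat
  by (intro borel_measurable_continuous_onI continuous_on_product_coordinates)

section \<open>Integration by parts and duality for cylindrical variables\<close>

context isonormal_gaussian_process
begin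

lemma X_family_measurable [measurable]: "(\<lambda>\<omega> j. X (\<phi> j) \<omega>) \<in> borel_measurable M" for \<phi> :: "nat \<Rightarrow> 'h"
  by (rule measurable_coordinatewise_then_product) simp

lemma tame_X_measurable:
  fixes \<phi> :: "nat \<Rightarrow> 'h"
  assumes "continuous_on UNIV \<gamma>"
  shows "(\<lambda>\<omega>. \<gamma> (\<lambda>j. X (\<phi> j) \<omega>)) \<in> borel_measurable M"
  using measurable_compose[OF X_family_measurable borel_measurable_continuous_onI[OF assms]] .

lemma tame_square_integrable:
  fixes \<phi> :: "nat \<Rightarrow> 'h"
  assumes "tame n \<gamma> \<gamma>'"
  shows "square_integrable M (\<lambda>\<omega>. \<gamma> (\<lambda>j. X (\<phi> j) \<omega>))"
    and "i < n \<Longrightarrow> square_integrable M (\<lambda>\<omega>. \<gamma>' i (\<lambda>j. X (\<phi> j) \<omega>))"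
proof -
  obtain C where C: "C \<ge> 0" "\<And>x. \<bar>\<gamma> x\<bar> \<le> C * exp (C * (\<Sum>j<n. \<bar>x j\<bar>))"
    "\<And>i x. i < n \<Longrightarrow> \<bar>\<gamma>' i x\<bar> \<le> C * exp (C * (\<Sum>j<n. \<bar>x j\<bar>))" using tame_bound[OF assms] by blast
  show "square_integrable M (\<lambda>\<omega>. \<gamma> (\<lambda>j. X (\<phi> j) \<omega>))"
    by (rule exp_growth_square_integrable[where C = C and n = n and \<phi> = \<phi>])
      (use C in \<open>auto intro!: tame_X_measurable tameD[OF assms]\<close>)
  show "square_integrable M (\<lambda>\<omega>. \<gamma>' i (\<lambda>j. X (\<phi> j) \<omega>))" if "i < n"
    by (rule exp_growth_square_integrable[where C = C and n = n and \<phi> = \<phi>])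
      (use C that in \<open>auto intro!: tame_X_measurable tameD[OF assms]\<close>)
qed

lemma square_integrable_scaleR_right:
  fixes c :: 'h
  assumes "square_integrable M f"
  shows "square_integrable M (\<lambda>\<omega>. f \<omega> *\<^sub>R c)"
proof -
  have [measurable]: "f \<in> borel_measurable M" using assms by auto
  show ?thesis
    using square_integrable_norm_sq[OF assms]
    by (auto simp: square_integrable_def power_mult_distrib)
qed

lemma tame_cylindrical_square_integrable:
  assumes "tame_cylindrical X G DG"
  shows "square_integrable M G" "square_integrable M DG"
proof -
  obtain n \<gamma> \<gamma>' \<phi> where \<gamma>: "tame n \<gamma> \<gamma>'" and G: "G = (\<lambda>\<omega>. \<gamma> (\<lambda>j. X (\<phi> j) \<omega>))"
    and DG: "DG = (\<lambda>\<omega>. \<Sum>i<n. \<gamma>' i (\<lambda>j. X (\<phi> j) \<omega>) *\<^sub>R \<phi> i)"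
    using assms unfolding tame_cylindrical_def by blast
  show "square_integrable M G" unfolding G by (rule tame_square_integrable(1)[OF \<gamma>])
  show "square_integrable M DG" unfolding DG
    by (intro square_integrable_sum square_integrable_scaleR_right tame_square_integrable(2)[OF \<gamma>]) simp
qed

lemma X_add_scale: "AE \<omega> in M. X (a + c *\<^sub>R b) \<omega> = X a \<omega> + c * X b \<omega>"
  using X_linear[where n = 2 and c = "\<lambda>i. if i = 0 then 1 else c" and h = "\<lambda>i. if i = 0 then a else b"]
  by (simp add: numeral_2_eq_2 eq_commute)

text \<open>\<open>X(h)\<close> is independent of the family \<open>X(\<phi>\<^sub>j - \<langle>h,\<phi>\<^sub>j\<rangle>h)\<close>; conditionally on this
  family the claim is the one-dimensional Gaussian integration by parts.\<close>

lemma integration_by_parts_unit: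
  assumes h: "norm h = 1" and \<gamma>: "tame n \<gamma> \<gamma>'"
  shows "(\<integral>\<omega>. X h \<omega> * \<gamma> (\<lambda>j. X (\<phi> j) \<omega>) \<partial>M) = (\<integral>\<omega>. (\<Sum>i<n. inner h (\<phi> i) * \<gamma>' i (\<lambda>j. X (\<phi> j) \<omega>)) \<partial>M)"
proof -
  note d = tameD[OF \<gamma>]
  define c where "c j = inner h (\<phi> j)" for j
  \<comment> \<open>The component of \<open>\<phi> j\<close> orthogonal to the unit vector
    \<open>h\<close>.\<close>
  define k where "k j = \<phi> j - c j *\<^sub>R h" for j
  have orth: "inner (k j) h = 0" for j
    using h by (simp add: k_def c_def inner_diff_left inner_diff_right inner_commute[of _ h] dot_square_norm)
  let ?W = "\<lambda>\<omega> i. X (k i) \<omega>" and ?V = "\<lambda>\<omega> (_::nat). X h \<omega>"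
  have [measurable]: "?V \<in> borel_measurable M" by (rule measurable_coordinatewise_then_product) simp
  have ind: "distr M borel ?V \<Otimes>\<^sub>M distr M borel ?W = distr M (borel \<Otimes>\<^sub>M borel) (\<lambda>\<omega>. (?V \<omega>, ?W \<omega>))"
    using X_indep[OF orth] by (simp add: indep_var_distribution_eq)
  interpret V: prob_space "distr M borel ?V" by (rule prob_space_distr) simp
  interpret W: prob_space "distr M borel ?W" by (rule prob_space_distr) simp
  interpret P: pair_prob_space "distr M borel ?V" "distr M borel ?W" ..
  have ae: "AE \<omega> in M. \<forall>j. X (\<phi> j) \<omega> = X (k j) \<omega> + X h \<omega> * c j"
    unfolding AE_all_countable
  proof
    fix j
    show "AE \<omega> in M. X (\<phi> j) \<omega> = X (k j) \<omega> + X h \<omega> * c j"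
      using X_add_scale[of "k j" "c j" h] by (simp add: k_def mult.commute)
  qed
  \<comment> \<open>Both sides as functions of the independent pair: \<open>v\<close> matters only
    through its coordinate 0, which is the value of \<open>X h\<close>, and \<open>w\<close> is the
    family of orthogonal components.\<close>
  define K1 where "K1 v w = v 0 * \<gamma> (\<lambda>j. w j + v 0 * c j)" for v w :: "nat \<Rightarrow> real"
  define K2 where "K2 v w = (\<Sum>i<n. c i * \<gamma>' i (\<lambda>j. w j + v 0 * c j))" for v w :: "nat \<Rightarrow> real"
  have coord: "(\<lambda>p :: (nat \<Rightarrow> real) \<times> (nat \<Rightarrow> real). snd p j) \<in> borel_measurable (borel \<Otimes>\<^sub>M borel)"
      "(\<lambda>p :: (nat \<Rightarrow> real) \<times> (nat \<Rightarrow> real). fst p j) \<in> borel_measurable (borel \<Otimes>\<^sub>M borel)" for j :: nat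
    by (rule measurable_compose[OF measurable_snd coordinate_borel] measurable_compose[OF measurable_fst coordinate_borel])+
  have lin [measurable]: "(\<lambda>(p :: (nat \<Rightarrow> real) \<times> (nat \<Rightarrow> real)) j. snd p j + fst p 0 * c j) \<in> borel_measurable (borel \<Otimes>\<^sub>M borel)"
    by (rule measurable_coordinatewise_then_product)
      (intro borel_measurable_add borel_measurable_times borel_measurable_const coord)
  have [measurable]: "(\<lambda>p :: (nat \<Rightarrow> real) \<times> (nat \<Rightarrow> real). \<gamma> (\<lambda>j. snd p j + fst p 0 * c j)) \<in> borel_measurable (borel \<Otimes>\<^sub>M borel)"
    by (rule measurable_compose[OF lin borel_measurable_continuous_onI[OF d(2)]])
  have [measurable]: "(\<lambda>p :: (nat \<Rightarrow> real) \<times> (nat \<Rightarrow> real). \<gamma>' i (\<lambda>j. snd p j + fst p 0 * c j)) \<in> borel_measurable (borel \<Otimes>\<^sub>M borel)" if "i < n" for i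
    by (rule measurable_compose[OF lin borel_measurable_continuous_onI[OF d(3)[OF that]]])
  have K1m [measurable]: "case_prod K1 \<in> borel_measurable (borel \<Otimes>\<^sub>M borel)"
    unfolding K1_def split_beta by (intro borel_measurable_times coord) measurable
  have K2m [measurable]: "case_prod K2 \<in> borel_measurable (borel \<Otimes>\<^sub>M borel)"
    unfolding K2_def split_beta by measurable
  have i1: "integrable M (\<lambda>\<omega>. X h \<omega> * \<gamma> (\<lambda>j. X (\<phi> j) \<omega>))"
    by (intro integrable_mult_sq X_square_integrable tame_square_integrable[OF \<gamma>])
  have i2: "integrable M (\<lambda>\<omega>. \<Sum>i<n. c i * \<gamma>' i (\<lambda>j. X (\<phi> j) \<omega>))"
  proof (intro Bochner_Integration.integrable_sum integrable_mult_right)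
    fix i assume "i \<in> {..<n}"
    then show "integrable M (\<lambda>\<omega>. \<gamma>' i (\<lambda>j. X (\<phi> j) \<omega>))"
      using integrable_mult_sq[OF tame_square_integrable(2)[OF \<gamma>], of i "\<lambda>_. 1" \<phi>]
      by (simp add: square_integrable_def)
  qed
  have e1: "AE \<omega> in M. X h \<omega> * \<gamma> (\<lambda>j. X (\<phi> j) \<omega>) = K1 (?V \<omega>) (?W \<omega>)"
    using ae by eventually_elim (simp add: K1_def)
  have e2: "AE \<omega> in M. (\<Sum>i<n. c i * \<gamma>' i (\<lambda>j. X (\<phi> j) \<omega>)) = K2 (?V \<omega>) (?W \<omega>)"
    using ae by eventually_elim (simp add: K2_def)
  have [measurable]: "(\<lambda>\<omega>. K1 (?V \<omega>) (?W \<omega>)) \<in> borel_measurable M" "(\<lambda>\<omega>. K2 (?V \<omega>) (?W \<omega>)) \<in> borel_measurable M"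
    using measurable_compose[of "\<lambda>\<omega>. (?V \<omega>, ?W \<omega>)" M "borel \<Otimes>\<^sub>M borel", OF _ K1m]
      measurable_compose[of "\<lambda>\<omega>. (?V \<omega>, ?W \<omega>)" M "borel \<Otimes>\<^sub>M borel", OF _ K2m] by simp_all
  \<comment> \<open>Fubini for the joint law, which by independence is the product of the two
    laws.\<close>
  have red: "(\<integral>\<omega>. K (?V \<omega>) (?W \<omega>) \<partial>M) = (\<integral>w. (\<integral>\<omega>. K (?V \<omega>) w \<partial>M) \<partial>distr M borel ?W)"
    if K [measurable]: "case_prod K \<in> borel_measurable (borel \<Otimes>\<^sub>M borel)" and i: "integrable M (\<lambda>\<omega>. K (?V \<omega>) (?W \<omega>))"
    for K :: "(nat \<Rightarrow> real) \<Rightarrow> (nat \<Rightarrow> real) \<Rightarrow> real"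
  proof -
    have i': "integrable (distr M borel ?V \<Otimes>\<^sub>M distr M borel ?W) (case_prod K)"
      unfolding ind by (subst integrable_distr_eq) (use i in auto)
    have "(\<integral>\<omega>. K (?V \<omega>) (?W \<omega>) \<partial>M) = integral\<^sup>L (distr M borel ?V \<Otimes>\<^sub>M distr M borel ?W) (case_prod K)"
      unfolding ind by (subst integral_distr) auto
    also have "\<dots> = (\<integral>w. (\<integral>v. K v w \<partial>distr M borel ?V) \<partial>distr M borel ?W)"
      by (rule P.integral_snd[OF i', symmetric])
    also have "\<dots> = (\<integral>w. (\<integral>\<omega>. K (?V \<omega>) w \<partial>M) \<partial>distr M borel ?W)"
    proof (intro Bochner_Integration.integral_cong refl)
      fix w
      have "(\<lambda>v. K v w) \<in> borel_measurable borel"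
        using measurable_compose[of "\<lambda>v. (v, w)" borel "borel \<Otimes>\<^sub>M borel", OF _ K] by simp
      then show "(\<integral>v. K v w \<partial>distr M borel ?V) = (\<integral>\<omega>. K (?V \<omega>) w \<partial>M)"
        by (subst integral_distr) auto
    qed
    finally show ?thesis .
  qed
  \<comment> \<open>With \<open>w\<close> frozen, the integrands are x g(x) and g'(x) at x = X h,
    for g the restriction of \<gamma> to a line in direction \<open>c\<close>.\<close>
  have inner_eq: "(\<integral>\<omega>. K1 (?V \<omega>) w \<partial>M) = (\<integral>\<omega>. K2 (?V \<omega>) w \<partial>M)" for w
  proof -
    define g where "g x = \<gamma> (\<lambda>j. w j + x * c j)" for x
    define g' where "g' x = (\<Sum>i<n. c i * \<gamma>' i (\<lambda>j. w j + x * c j))" for x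
    have dg: "(g has_real_derivative g' x) (at x)" for x
      unfolding g_def g'_def by (rule has_real_derivative_along_line[OF d(1,4,3)])
    have lc: "continuous_on UNIV (\<lambda>x j. w j + x * c j)" by (intro continuous_intros continuous_on_coordinatewise_then_product)
    have cg': "continuous_on UNIV g'"
      unfolding g'_def
      by (intro continuous_intros continuous_on_compose2[OF d(3) lc]) auto
    obtain C where C: "C \<ge> 0" "\<And>x. \<bar>\<gamma> x\<bar> \<le> C * exp (C * (\<Sum>j<n. \<bar>x j\<bar>))"
      "\<And>i x. i < n \<Longrightarrow> \<bar>\<gamma>' i x\<bar> \<le> C * exp (C * (\<Sum>j<n. \<bar>x j\<bar>))" using tame_bound[OF \<gamma>] by blast
    define s where "s = C * (\<Sum>j<n. \<bar>c j\<bar>)"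
    define E where "E = C * exp (C * (\<Sum>j<n. \<bar>w j\<bar>))"
    have E: "E \<ge> 0" using C by (simp add: E_def)
    have ex: "C * exp (C * (\<Sum>j<n. \<bar>w j + x * c j\<bar>)) \<le> E * exp (s * \<bar>x\<bar>)" for x
    proof -
      have "(\<Sum>j<n. \<bar>w j + x * c j\<bar>) \<le> (\<Sum>j<n. \<bar>w j\<bar> + \<bar>c j\<bar> * \<bar>x\<bar>)"
        by (intro sum_mono) (metis abs_mult abs_triangle_ineq mult.commute)
      also have "\<dots> = (\<Sum>j<n. \<bar>w j\<bar>) + (\<Sum>j<n. \<bar>c j\<bar>) * \<bar>x\<bar>" by (simp add: sum.distrib sum_distrib_right)
      finally have "C * (\<Sum>j<n. \<bar>w j + x * c j\<bar>) \<le> C * (\<Sum>j<n. \<bar>w j\<bar>) + s * \<bar>x\<bar>"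
        using mult_left_mono[OF _ C(1)] by (fastforce simp: s_def algebra_simps)
      then have "exp (C * (\<Sum>j<n. \<bar>w j + x * c j\<bar>)) \<le> exp (C * (\<Sum>j<n. \<bar>w j\<bar>)) * exp (s * \<bar>x\<bar>)"
        by (simp add: exp_add[symmetric])
      from mult_left_mono[OF this C(1)] show ?thesis by (simp add: E_def mult.assoc)
    qed
    \<comment> \<open>One constant for \<open>g\<close>, bounded with factor \<open>E\<close>, and
      for \<open>g'\<close>, whose chain rule brings in the coefficients \<open>c i\<close>.\<close>
    define E' where "E' = E * (1 + (\<Sum>i<n. \<bar>c i\<bar>))"
    have EE': "E * exp (s * \<bar>x\<bar>) \<le> E' * exp (s * \<bar>x\<bar>)" for x
      using E by (intro mult_right_mono) (auto simp: E'_def algebra_simps intro!: mult_nonneg_nonneg sum_nonneg)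
    have b1: "\<bar>g x\<bar> \<le> E' * exp (s * \<bar>x\<bar>)" for x
      using C(2)[of "\<lambda>j. w j + x * c j"] ex[of x] EE'[of x] unfolding g_def by linarith
    have b2: "\<bar>g' x\<bar> \<le> E' * exp (s * \<bar>x\<bar>)" for x
    proof -
      have "\<bar>g' x\<bar> \<le> (\<Sum>i<n. \<bar>c i\<bar> * (E * exp (s * \<bar>x\<bar>)))"
        unfolding g'_def
      proof (rule order_trans[OF sum_abs], rule sum_mono)
        fix i assume "i \<in> {..<n}"
        then have "\<bar>\<gamma>' i (\<lambda>j. w j + x * c j)\<bar> \<le> E * exp (s * \<bar>x\<bar>)"
          using C(3)[of i "\<lambda>j. w j + x * c j"] ex[of x] by simp
        then show "\<bar>c i * \<gamma>' i (\<lambda>j. w j + x * c j)\<bar> \<le> \<bar>c i\<bar> * (E * exp (s * \<bar>x\<bar>))"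
          by (simp add: abs_mult mult_left_mono)
      qed
      also have "\<dots> = (E * (\<Sum>i<n. \<bar>c i\<bar>)) * exp (s * \<bar>x\<bar>)" by (simp add: sum_distrib_right[symmetric])
      also have "\<dots> \<le> E' * exp (s * \<bar>x\<bar>)"
        using E by (intro mult_right_mono) (auto simp: E'_def algebra_simps)
      finally show ?thesis .
    qed
    have cg: "continuous_on UNIV g" using dg by (meson DERIV_isCont continuous_at_imp_continuous_on)
    have [measurable]: "g \<in> borel_measurable borel" "g' \<in> borel_measurable borel"
      using cg cg' by (auto intro: borel_measurable_continuous_onI)
    have "(\<integral>\<omega>. X h \<omega> * g (X h \<omega>) \<partial>M) = (\<integral>x. std_normal_density x * (x * g x) \<partial>lborel)"
      by (rule distributed_integral[OF X_std_normal[OF h], symmetric]) auto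
    also have "\<dots> = (\<integral>x. std_normal_density x * g' x \<partial>lborel)"
      by (rule std_normal_integration_by_parts[OF dg cg' b1 b2])
    also have "\<dots> = (\<integral>\<omega>. g' (X h \<omega>) \<partial>M)"
      by (rule distributed_integral[OF X_std_normal[OF h]]) auto
    finally show ?thesis by (simp add: K1_def K2_def g_def g'_def)
  qed
  have "(\<integral>\<omega>. X h \<omega> * \<gamma> (\<lambda>j. X (\<phi> j) \<omega>) \<partial>M) = (\<integral>\<omega>. K1 (?V \<omega>) (?W \<omega>) \<partial>M)"
    by (rule integral_cong_AE) (use e1 i1 in auto)
  also have "\<dots> = (\<integral>\<omega>. K2 (?V \<omega>) (?W \<omega>) \<partial>M)"
  proof -
    have "integrable M (\<lambda>\<omega>. K1 (?V \<omega>) (?W \<omega>))"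
      by (rule integrable_cong_AE_imp[OF i1]) (use e1 in auto)
    moreover have "integrable M (\<lambda>\<omega>. K2 (?V \<omega>) (?W \<omega>))"
      by (rule integrable_cong_AE_imp[OF i2]) (use e2 in auto)
    ultimately show ?thesis by (simp add: red[OF K1m] red[OF K2m] inner_eq)
  qed
  also have "\<dots> = (\<integral>\<omega>. (\<Sum>i<n. c i * \<gamma>' i (\<lambda>j. X (\<phi> j) \<omega>)) \<partial>M)"
    by (rule integral_cong_AE[symmetric]) (use e2 i2 in auto)
  finally show ?thesis by (simp add: c_def)
qed

text \<open>Both sides are homogeneous in h, which reduces nonzero vectors to unit vectors; for h =
  0 the variable vanishes almost surely.\<close>

theorem integration_by_parts:
  assumes "tame_cylindrical X G DG"
  shows "(\<integral>\<omega>. X h \<omega> * G \<omega> \<partial>M) = (\<integral>\<omega>. inner h (DG \<omega>) \<partial>M)"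
proof -
  obtain n \<gamma> \<gamma>' \<phi> where \<gamma>: "tame n \<gamma> \<gamma>'" and G: "G = (\<lambda>\<omega>. \<gamma> (\<lambda>j. X (\<phi> j) \<omega>))"
    and DG: "DG = (\<lambda>\<omega>. \<Sum>i<n. \<gamma>' i (\<lambda>j. X (\<phi> j) \<omega>) *\<^sub>R \<phi> i)"
    using assms unfolding tame_cylindrical_def by blast
  have GM [measurable]: "G \<in> borel_measurable M" using tame_cylindrical_square_integrable(1)[OF assms] by auto
  show ?thesis
  proof (cases "h = 0")
    case True
    have "(\<integral>\<omega>. X h \<omega> * G \<omega> \<partial>M) = (\<integral>\<omega>. 0 \<partial>M)"
      by (rule integral_cong_AE) (use X_scale[of 0 0] True in auto)
    then show ?thesis by (simp add: True)
  next
    case False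
    define u where "u = (1 / norm h) *\<^sub>R h"
    have u: "norm u = 1" "h = norm h *\<^sub>R u" using False by (simp_all add: u_def)
    have "(\<integral>\<omega>. X h \<omega> * G \<omega> \<partial>M) = (\<integral>\<omega>. norm h * (X u \<omega> * G \<omega>) \<partial>M)"
      by (rule integral_cong_AE) (use X_scale[of "norm h" u] u(2) in auto)
    also have "\<dots> = norm h * (\<integral>\<omega>. inner u (DG \<omega>) \<partial>M)"
      using integration_by_parts_unit[OF u(1) \<gamma>, of \<phi>] by (simp add: G DG inner_sum_right mult.commute)
    also have "\<dots> = (\<integral>\<omega>. inner (norm h *\<^sub>R u) (DG \<omega>) \<partial>M)" by simp
    finally show ?thesis using u(2) by simp
  qed
qed

lemma tame_cylindrical_mult:
  assumes "tame_cylindrical X G DG" "tame_cylindrical X H DH"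
  shows "tame_cylindrical X (\<lambda>\<omega>. G \<omega> * H \<omega>) (\<lambda>\<omega>. G \<omega> *\<^sub>R DH \<omega> + H \<omega> *\<^sub>R DG \<omega>)"
proof -
  obtain n \<gamma> \<gamma>' \<phi> where \<gamma>: "tame n \<gamma> \<gamma>'" and G: "G = (\<lambda>\<omega>. \<gamma> (\<lambda>j. X (\<phi> j) \<omega>))"
    and DG: "DG = (\<lambda>\<omega>. \<Sum>i<n. \<gamma>' i (\<lambda>j. X (\<phi> j) \<omega>) *\<^sub>R \<phi> i)"
    using assms(1) unfolding tame_cylindrical_def by blast
  obtain m \<delta> \<delta>' \<zeta> where \<delta>: "tame m \<delta> \<delta>'" and H: "H = (\<lambda>\<omega>. \<delta> (\<lambda>j. X (\<zeta> j) \<omega>))"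
    and DH: "DH = (\<lambda>\<omega>. \<Sum>i<m. \<delta>' i (\<lambda>j. X (\<zeta> j) \<omega>) *\<^sub>R \<zeta> i)"
    using assms(2) unfolding tame_cylindrical_def by blast
  define \<psi> where "\<psi> j = (if j < n then \<phi> j else \<zeta> (j - n))" for j
  \<comment> \<open>That \<gamma>' depends only on the first \<open>n\<close> coordinates is not
    part of \<open>tame\<close>; it follows from uniqueness of derivatives.\<close>
  have dep': "\<gamma>' i x = \<gamma>' i y" if "i < n" "\<And>j. j < n \<Longrightarrow> x j = y j" for i x y
  proof -
    have "\<gamma> (x(i := t)) = \<gamma> (y(i := t))" for t
      using tameD(1)[OF \<gamma>] that(2) unfolding depends_on_first_def by auto
    then have "((\<lambda>t. \<gamma> (y(i := t))) has_real_derivative \<gamma>' i x) (at (y i))"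
      using tameD(4)[OF \<gamma> that(1), of x] that by simp
    then show ?thesis using tameD(4)[OF \<gamma> that(1), of y] by (rule DERIV_unique)
  qed
  have dep: "\<gamma> x = \<gamma> y" if "\<And>j. j < n \<Longrightarrow> x j = y j" for x y
    using tameD(1)[OF \<gamma>] that by (auto simp: depends_on_first_def)
  have shift: "(\<lambda>j. X (\<psi> (n + j)) \<omega>) = (\<lambda>j. X (\<zeta> j) \<omega>)" for \<omega> by (simp add: \<psi>_def)
  have first: "\<gamma> (\<lambda>j. X (\<psi> j) \<omega>) = G \<omega>" for \<omega> unfolding G by (rule dep) (simp add: \<psi>_def)
  have first': "\<gamma>' i (\<lambda>j. X (\<psi> j) \<omega>) = \<gamma>' i (\<lambda>j. X (\<phi> j) \<omega>)" if "i < n" for i \<omega>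
    by (rule dep') (use that in \<open>simp_all add: \<psi>_def\<close>)
  show ?thesis
    unfolding tame_cylindrical_def
  proof (intro exI conjI)
    show "tame (n + m) (\<lambda>x. \<gamma> x * \<delta> (\<lambda>j. x (n + j)))
      (\<lambda>i x. if i < n then \<gamma>' i x * \<delta> (\<lambda>j. x (n + j)) else \<gamma> x * \<delta>' (i - n) (\<lambda>j. x (n + j)))"
      by (rule tame_mult[OF \<gamma> \<delta>])
    show "(\<lambda>\<omega>. G \<omega> * H \<omega>) = (\<lambda>\<omega>. \<gamma> (\<lambda>j. X (\<psi> j) \<omega>) * \<delta> (\<lambda>j. X (\<psi> (n + j)) \<omega>))"
      by (simp add: first shift H)
    show "(\<lambda>\<omega>. G \<omega> *\<^sub>R DH \<omega> + H \<omega> *\<^sub>R DG \<omega>) = (\<lambda>\<omega>. \<Sum>i<n + m. (if i < n then \<gamma>' i (\<lambda>j. X (\<psi> j) \<omega>) * \<delta> (\<lambda>j. X (\<psi> (n + j)) \<omega>)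
         else \<gamma> (\<lambda>j. X (\<psi> j) \<omega>) * \<delta>' (i - n) (\<lambda>j. X (\<psi> (n + j)) \<omega>)) *\<^sub>R \<psi> i)"
    proof
      fix \<omega>
      have "(\<Sum>i<n. (\<gamma>' i (\<lambda>j. X (\<psi> j) \<omega>) * H \<omega>) *\<^sub>R \<psi> i) = H \<omega> *\<^sub>R DG \<omega>"
        unfolding DG scaleR_sum_right
        by (rule sum.cong) (simp_all add: first' mult.commute, simp add: \<psi>_def)
      moreover have "(\<Sum>i<m. (G \<omega> * \<delta>' i (\<lambda>j. X (\<zeta> j) \<omega>)) *\<^sub>R \<zeta> i) = G \<omega> *\<^sub>R DH \<omega>"
        by (simp add: DH scaleR_sum_right)
      moreover have "\<psi> (n + i) = \<zeta> i" for i by (simp add: \<psi>_def)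
      ultimately show "G \<omega> *\<^sub>R DH \<omega> + H \<omega> *\<^sub>R DG \<omega> = (\<Sum>i<n + m. (if i < n then \<gamma>' i (\<lambda>j. X (\<psi> j) \<omega>) * \<delta> (\<lambda>j. X (\<psi> (n + j)) \<omega>)
         else \<gamma> (\<lambda>j. X (\<psi> j) \<omega>) * \<delta>' (i - n) (\<lambda>j. X (\<psi> (n + j)) \<omega>)) *\<^sub>R \<psi> i)"
        unfolding sum_lessThan_plus shift first by (simp add: H add.commute)
    qed
  qed
qed

lemma tame_cylindrical_poly:
  "tame_cylindrical X (\<lambda>\<omega>. poly p (X h \<omega>)) (\<lambda>\<omega>. poly (pderiv p) (X h \<omega>) *\<^sub>R h)"
  unfolding tame_cylindrical_def
  by (intro exI[of _ 1] exI conjI, rule tame_poly[of p]) (auto intro!: exI[of _ "\<lambda>_. h"])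

text \<open>Integration by parts for the product G P. It says that the adjoint of the derivative
  maps G h to X(h) G minus the inner product of h with DG.\<close>

lemma divergence_duality:
  assumes G: "tame_cylindrical X G DG" and P: "tame_cylindrical X P DP"
  shows "(\<integral>\<omega>. G \<omega> * inner h (DP \<omega>) \<partial>M) = (\<integral>\<omega>. X h \<omega> * G \<omega> * P \<omega> \<partial>M) - (\<integral>\<omega>. inner h (DG \<omega>) * P \<omega> \<partial>M)"
proof -
  note sG = tame_cylindrical_square_integrable[OF G] and sP = tame_cylindrical_square_integrable[OF P]
  have i: "integrable M (\<lambda>\<omega>. inner h (f \<omega>) * g \<omega>)" if "square_integrable M f" "square_integrable M g" for f :: "'a \<Rightarrow> 'h" and g
    using integrable_inner[OF square_integrable_scaleR_right[OF that(2), of h] that(1)] by (simp add: mult.commute)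
  have "(\<integral>\<omega>. X h \<omega> * (G \<omega> * P \<omega>) \<partial>M) = (\<integral>\<omega>. inner h (DP \<omega>) * G \<omega> + inner h (DG \<omega>) * P \<omega> \<partial>M)"
    using integration_by_parts[OF tame_cylindrical_mult[OF G P], of h] by (simp add: inner_add_right mult.commute)
  also have "\<dots> = (\<integral>\<omega>. inner h (DP \<omega>) * G \<omega> \<partial>M) + (\<integral>\<omega>. inner h (DG \<omega>) * P \<omega> \<partial>M)"
    by (intro Bochner_Integration.integral_add i sG sP)
  finally show ?thesis by (simp add: mult.assoc mult.commute[of "inner h _" "G _"])
qed

end

section \<open>Hermite polynomials\<close>

lemma hermite_Suc: "hermite (Suc m) x = x * hermite m x - real m * hermite (m - 1) x"
  by (cases m) auto

text \<open>The same recurrence on the type of polynomials, where \<open>pderiv\<close> and the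
  growth bounds for polynomials are available.\<close>

fun hermite_poly :: "nat \<Rightarrow> real poly" where
  "hermite_poly 0 = 1"
| "hermite_poly (Suc 0) = [:0, 1:]"
| "hermite_poly (Suc (Suc k)) = [:0, 1:] * hermite_poly (Suc k) - of_nat (Suc k) * hermite_poly k"

lemma poly_hermite_poly: "poly (hermite_poly m) x = hermite m x"
  by (induction m rule: hermite_poly.induct) (auto simp: poly_of_nat[symmetric] simp del: of_nat_Suc)

text \<open>Differentiating the recurrence reproduces it one degree lower. The truncated index
  \<open>m - 1\<close> is harmless for m = 0, as its coefficient is then 0.\<close>

lemma DERIV_hermite: "(hermite m has_real_derivative real m * hermite (m - 1) x) (at x)"
proof (induction m rule: hermite_poly.induct)
  case (3 k)
  have "((\<lambda>x. x * hermite (Suc k) x - real (Suc k) * hermite k x) has_real_derivative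
      (1 * hermite (Suc k) x + real (Suc k) * hermite k x * x) - real (Suc k) * (real k * hermite (k - 1) x)) (at x)"
    using 3 by (intro DERIV_diff DERIV_mult DERIV_cmult DERIV_ident) auto
  moreover have "(1 * hermite (Suc k) x + real (Suc k) * hermite k x * x) - real (Suc k) * (real k * hermite (k - 1) x)
      = real (Suc (Suc k)) * hermite (Suc k) x"
    unfolding hermite_Suc[of k] by (simp add: algebra_simps)
  moreover have "hermite (Suc (Suc k)) = (\<lambda>x. x * hermite (Suc k) x - real (Suc k) * hermite k x)" by auto
  ultimately show ?case by simp
qed (auto intro!: derivative_eq_intros)

lemma pderiv_hermite_poly: "poly (pderiv (hermite_poly m)) x = real m * hermite (m - 1) x"
proof -
  have "poly (hermite_poly m) = hermite m" by (auto simp: poly_hermite_poly)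
  then have "(hermite m has_real_derivative poly (pderiv (hermite_poly m)) x) (at x)"
    using poly_DERIV[of "hermite_poly m" x] by simp
  then show ?thesis using DERIV_hermite by (rule DERIV_unique)
qed

context isonormal_gaussian_process
begin

lemma tame_cylindrical_hermite:
  "tame_cylindrical X (\<lambda>\<omega>. hermite m (X h \<omega>)) (\<lambda>\<omega>. (real m * hermite (m - 1) (X h \<omega>)) *\<^sub>R h)"
  using tame_cylindrical_poly[of "hermite_poly m" h] by (simp add: poly_hermite_poly pderiv_hermite_poly)

lemma hermite_square_integrable: "square_integrable M (\<lambda>\<omega>. hermite m (X h \<omega>))"
  by (rule tame_cylindrical_square_integrable[OF tame_cylindrical_hermite])

text \<open>The Hermite polynomials are the iterated divergences of the constant \<open>1\<close>.\<close>

lemma hermite_duality: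
  assumes h: "norm h = 1" and P: "tame_cylindrical X P DP"
  shows "(\<integral>\<omega>. hermite (Suc m) (X h \<omega>) * P \<omega> \<partial>M) = (\<integral>\<omega>. hermite m (X h \<omega>) * inner h (DP \<omega>) \<partial>M)"
proof -
  note T = tame_cylindrical_hermite[of m h]
  have i1: "integrable M (\<lambda>\<omega>. X h \<omega> * hermite m (X h \<omega>) * P \<omega>)"
    using tame_cylindrical_square_integrable(1)[OF tame_cylindrical_mult[OF T P]]
    by (simp add: mult.assoc integrable_mult_sq X_square_integrable)
  have i2: "integrable M (\<lambda>\<omega>. real m * (hermite (m - 1) (X h \<omega>) * P \<omega>))"
    by (intro integrable_mult_right integrable_mult_sq hermite_square_integrable tame_cylindrical_square_integrable[OF P])
  have "(\<integral>\<omega>. hermite (Suc m) (X h \<omega>) * P \<omega> \<partial>M)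
      = (\<integral>\<omega>. X h \<omega> * hermite m (X h \<omega>) * P \<omega> - real m * (hermite (m - 1) (X h \<omega>) * P \<omega>) \<partial>M)"
    by (simp add: hermite_Suc left_diff_distrib mult.assoc)
  also have "\<dots> = (\<integral>\<omega>. hermite m (X h \<omega>) * inner h (DP \<omega>) \<partial>M)"
    using divergence_duality[OF T P, of h] i1 i2 h by (simp add: dot_square_norm mult.assoc)
  finally show ?thesis .
qed

text \<open>Each application of the duality lowers both degrees by one and contributes the factor
  \<open>real l * inner h k\<close>; it stops when one degree is 0.\<close>

lemma hermite_orthogonal:
  assumes h: "norm h = 1" and k: "norm k = 1"
  shows "(\<integral>\<omega>. hermite m (X h \<omega>) * hermite l (X k \<omega>) \<partial>M) = (if m = l then fact m * inner h k ^ m else 0)"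
  using h k
proof (induction m arbitrary: h k l)
  case 0
  show ?case
  proof (cases l)
    case 0
    then show ?thesis by (simp add: prob_space)
  next
    case (Suc l')
    then show ?thesis
      \<comment> \<open>Duality against the constant 1, whose derivative is 0.\<close>
      using hermite_duality[OF 0(2) tame_cylindrical_hermite[of 0 h], of l'] by (simp add: mult.commute)
  qed
next
  case (Suc m)
  have "(\<integral>\<omega>. hermite (Suc m) (X h \<omega>) * hermite l (X k \<omega>) \<partial>M)
      = (\<integral>\<omega>. real l * inner h k * (hermite m (X h \<omega>) * hermite (l - 1) (X k \<omega>)) \<partial>M)"
    using hermite_duality[OF Suc.prems(1) tame_cylindrical_hermite[of l k], of m] by (simp add: ac_simps)
  also have "\<dots> = real l * inner h k * (if m = l - 1 then fact m * inner h k ^ m else 0)"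
    using Suc.IH[OF Suc.prems, of "l - 1"] by simp
  also have "\<dots> = (if Suc m = l then fact (Suc m) * inner h k ^ Suc m else 0)"
    by (cases l) auto
  finally show ?case .
qed

end

section \<open>Smooth and polynomial cylindrical variables\<close>

lemma partial_deriv_eq:
  assumes "((\<lambda>t. \<psi> (x(i := t))) has_real_derivative D) (at (x i))"
  shows "partial_deriv i \<psi> x = D"
  using assms unfolding partial_deriv_def by (rule DERIV_imp_deriv)

lemma C_class_continuous: "C_class n k \<psi> \<Longrightarrow> continuous_on UNIV \<psi>"
  by (cases k) auto

lemma C_class_SucD:
  assumes "C_class n (Suc k) \<psi>" "i < n"
  shows "((\<lambda>t. \<psi> (x(i := t))) has_real_derivative partial_deriv i \<psi> x) (at (x i))"
    and "C_class n k (partial_deriv i \<psi>)"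
proof -
  show "((\<lambda>t. \<psi> (x(i := t))) has_real_derivative partial_deriv i \<psi> x) (at (x i))"
    unfolding partial_deriv_def DERIV_deriv_iff_field_differentiable using assms by simp
  show "C_class n k (partial_deriv i \<psi>)" using assms by simp
qed

lemma C_class_SucI:
  assumes "continuous_on UNIV \<psi>"
    and d: "\<And>i x. i < n \<Longrightarrow> ((\<lambda>t. \<psi> (x(i := t))) has_real_derivative \<psi>' i x) (at (x i))"
    and "\<And>i. i < n \<Longrightarrow> C_class n k (\<psi>' i)"
  shows "C_class n (Suc k) \<psi>"
proof -
  have "partial_deriv i \<psi> = \<psi>' i" if "i < n" for i
    by (rule ext, rule partial_deriv_eq, rule d[OF that])
  then show ?thesis using assms by (auto simp: field_differentiable_def)
qed

text \<open>Product and chain rule multiply a derivative by an undifferentiated function, which then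
  has to be available one order lower.\<close>

lemma C_class_Suc_imp: "C_class n (Suc k) \<psi> \<Longrightarrow> C_class n k \<psi>"
proof (induction k arbitrary: \<psi>)
  case (Suc k)
  show ?case
    by (rule C_class_SucI[where \<psi>' = "\<lambda>i. partial_deriv i \<psi>"])
      (use Suc C_class_SucD[OF Suc.prems] C_class_continuous[OF Suc.prems] in blast)+
qed simp

lemma C_class_const: "C_class n k (\<lambda>x. c)"
proof (induction k arbitrary: c)
  case (Suc k)
  show ?case by (rule C_class_SucI[where \<psi>' = "\<lambda>i x. 0"]) (auto intro: Suc)
qed simp

lemma C_class_coordinate: "C_class n k (\<lambda>x. x j)"
proof (cases k)
  case 0
  then show ?thesis by (auto intro: continuous_on_product_coordinates)
next
  case (Suc k)
  have "((\<lambda>t. (x(i := t)) j) has_real_derivative (if i = j then 1 else 0)) (at (x i))" for i and x :: "nat \<Rightarrow> real"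
    by (cases "i = j") auto
  then show ?thesis
    unfolding Suc
    by (intro C_class_SucI[where \<psi>' = "\<lambda>i x. if i = j then 1 else 0"]) (auto intro: C_class_const continuous_on_product_coordinates)
qed

lemma C_class_add: "C_class n k a \<Longrightarrow> C_class n k b \<Longrightarrow> C_class n k (\<lambda>x. a x + b x)"
proof (induction k arbitrary: a b)
  case (Suc k)
  show ?case
  proof (rule C_class_SucI[where \<psi>' = "\<lambda>i x. partial_deriv i a x + partial_deriv i b x"])
    fix i assume i: "i < n"
    show "((\<lambda>t. a (x(i := t)) + b (x(i := t))) has_real_derivative partial_deriv i a x + partial_deriv i b x) (at (x i))" for x
      by (intro DERIV_add C_class_SucD(1)[OF Suc.prems(1) i] C_class_SucD(1)[OF Suc.prems(2) i])
    show "C_class n k (\<lambda>x. partial_deriv i a x + partial_deriv i b x)"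
      by (intro Suc.IH C_class_SucD(2)[OF Suc.prems(1) i] C_class_SucD(2)[OF Suc.prems(2) i])
  qed (intro continuous_on_add C_class_continuous[OF Suc.prems(1)] C_class_continuous[OF Suc.prems(2)])
qed (auto intro: continuous_on_add)

lemma C_class_mult: "C_class n k a \<Longrightarrow> C_class n k b \<Longrightarrow> C_class n k (\<lambda>x. a x * b x)"
proof (induction k arbitrary: a b)
  case (Suc k)
  show ?case
  proof (rule C_class_SucI[where \<psi>' = "\<lambda>i x. partial_deriv i a x * b x + partial_deriv i b x * a x"])
    fix i assume i: "i < n"
    show "((\<lambda>t. a (x(i := t)) * b (x(i := t))) has_real_derivative partial_deriv i a x * b x + partial_deriv i b x * a x) (at (x i))" for x
      using DERIV_mult[OF C_class_SucD(1)[OF Suc.prems(1) i, where x = x] C_class_SucD(1)[OF Suc.prems(2) i, where x = x]]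
      by (simp only: fun_upd_triv)
    show "C_class n k (\<lambda>x. partial_deriv i a x * b x + partial_deriv i b x * a x)"
      by (intro C_class_add Suc.IH C_class_SucD(2)[OF Suc.prems(1) i] C_class_SucD(2)[OF Suc.prems(2) i]
          C_class_Suc_imp[OF Suc.prems(1)] C_class_Suc_imp[OF Suc.prems(2)])
  qed (intro continuous_on_mult C_class_continuous[OF Suc.prems(1)] C_class_continuous[OF Suc.prems(2)])
qed (auto intro: continuous_on_mult)

lemma C_class_sum: "(\<And>i. i \<in> I \<Longrightarrow> C_class n k (f i)) \<Longrightarrow> C_class n k (\<lambda>x. \<Sum>i\<in>I. f i x)"
  by (induction I rule: infinite_finite_induct) (auto intro: C_class_const C_class_add)

lemma C_class_prod: "(\<And>i. i \<in> I \<Longrightarrow> C_class n k (f i)) \<Longrightarrow> C_class n k (\<lambda>x. \<Prod>i\<in>I. f i x)"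
  by (induction I rule: infinite_finite_induct) (auto intro: C_class_const C_class_mult)

text \<open>All derivatives are given by one explicit sequence, so that the chain rule can be
  iterated without computing derivatives.\<close>

definition smooth_real :: "(real \<Rightarrow> real) \<Rightarrow> bool" where
  "smooth_real f \<longleftrightarrow> (\<exists>d. d 0 = f \<and> (\<forall>n x. (d n has_real_derivative d (Suc n) x) (at x)))"

text \<open>The induction on \<open>k\<close> treats all derivatives \<open>d m\<close> at once,
  because one differentiation leads from \<open>d m\<close> to \<open>d (Suc m)\<close>.\<close>

lemma C_class_compose:
  assumes f: "smooth_real f" and \<psi>: "C_class n k \<psi>"
  shows "C_class n k (\<lambda>x. f (\<psi> x))"
proof -
  obtain d where d0: "d 0 = f" and d: "\<And>n x. (d n has_real_derivative d (Suc n) x) (at x)"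
    using f by (auto simp: smooth_real_def)
  have cont: "continuous_on UNIV (\<lambda>x. d m (\<psi> x))" if "continuous_on UNIV \<psi>" for m \<psi>
    using d by (intro continuous_on_compose2[OF _ that, of UNIV])
      (auto intro!: DERIV_isCont continuous_at_imp_continuous_on)
  have "C_class n k (\<lambda>x. d m (\<psi> x))" for m
    using \<psi>
  proof (induction k arbitrary: m)
    case 0
    then show ?case by (auto intro: cont)
  next
    case (Suc k)
    show ?case
    proof (rule C_class_SucI[where \<psi>' = "\<lambda>i x. d (Suc m) (\<psi> x) * partial_deriv i \<psi> x"])
      show "continuous_on UNIV (\<lambda>x. d m (\<psi> x))" by (rule cont[OF C_class_continuous[OF Suc.prems]])
      fix i assume i: "i < n"
      show "((\<lambda>t. d m (\<psi> (x(i := t)))) has_real_derivative d (Suc m) (\<psi> x) * partial_deriv i \<psi> x) (at (x i))" for x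
        by (rule DERIV_chain2[OF _ C_class_SucD(1)[OF Suc.prems i, where x = x]]) (simp add: d)
      show "C_class n k (\<lambda>x. d (Suc m) (\<psi> x) * partial_deriv i \<psi> x)"
        by (intro C_class_mult Suc.IH C_class_Suc_imp[OF Suc.prems] C_class_SucD(2)[OF Suc.prems i])
    qed
  qed
  from this[of 0] show ?thesis by (simp add: d0)
qed

lemma smooth_real_poly: "smooth_real (poly p)"
  unfolding smooth_real_def
  by (rule exI[of _ "\<lambda>m. poly ((pderiv ^^ m) p)"]) (auto intro: poly_DERIV)

text \<open>The standard smooth function that is flat at 0, used to build a bump function.\<close>

definition exp_inverse :: "real \<Rightarrow> real" where
  "exp_inverse x = (if x > 0 then exp (- (1 / x)) else 0)"

lemma poly_times_exp_minus_tendsto: "((\<lambda>y. poly p y * exp (- y)) \<longlongrightarrow> 0) at_top" for p :: "real poly"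
proof -
  have "((\<lambda>y. \<Sum>i\<le>degree p. coeff p i * (y ^ i / exp y)) \<longlongrightarrow> (\<Sum>i\<le>degree p. coeff p i * 0)) at_top"
    by (intro tendsto_sum tendsto_mult tendsto_const tendsto_power_div_exp_0)
  moreover have "(\<lambda>y. poly p y * exp (- y)) = (\<lambda>y. \<Sum>i\<le>degree p. coeff p i * (y ^ i / exp y))"
    by (simp add: fun_eq_iff poly_altdef sum_distrib_right exp_minus divide_inverse mult.assoc)
  ultimately show ?thesis by simp
qed

text \<open>Every derivative has the form p(1/x) exp (-1/x) for x > 0. With y = 1/x, differentiation
  replaces p by y^2 (p - p'), which is the iterated operator below. At 0 the right difference
  quotient is y p(y) exp (-y), which tends to 0 as y grows.\<close>

lemma smooth_real_exp_inverse: "smooth_real exp_inverse"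
proof -
  define p :: "nat \<Rightarrow> real poly" where "p m = ((\<lambda>q. [:0, 0, 1:] * (q - pderiv q)) ^^ m) 1" for m
  define d where "d m x = (if x > 0 then poly (p m) (1 / x) * exp (- (1 / x)) else 0)" for m and x :: real
  have "(d m has_real_derivative d (Suc m) x) (at x)" for m x
  proof (cases x "0 :: real" rule: linorder_cases)
    case less
    have "((\<lambda>x. 0) has_real_derivative d (Suc m) x) (at x)" using less by (simp add: d_def)
    then show ?thesis
      by (rule has_field_derivative_transform_within_open[where S = "{..<0}"]) (use less in \<open>auto simp: d_def\<close>)
  next
    case greater
    have "((\<lambda>x. poly (p m) (1 / x) * exp (- (1 / x))) has_real_derivative
        (poly (pderiv (p m)) (1 / x) * (- (1 / x\<^sup>2))) * exp (- (1 / x)) + (exp (- (1 / x)) * (1 / x\<^sup>2)) * poly (p m) (1 / x)) (at x)"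
    proof (intro DERIV_mult)
      have i: "((\<lambda>x. 1 / x) has_real_derivative - (1 / x\<^sup>2)) (at x)"
        using greater by (auto intro!: derivative_eq_intros simp: power2_eq_square field_simps)
      show "((\<lambda>x. poly (p m) (1 / x)) has_real_derivative poly (pderiv (p m)) (1 / x) * (- (1 / x\<^sup>2))) (at x)"
        using DERIV_chain2[OF poly_DERIV i] .
      show "((\<lambda>x. exp (- (1 / x))) has_real_derivative exp (- (1 / x)) * (1 / x\<^sup>2)) (at x)"
        using DERIV_chain2[OF DERIV_exp DERIV_minus[OF i]] by simp
    qed
    moreover have "(poly (pderiv (p m)) (1 / x) * (- (1 / x\<^sup>2))) * exp (- (1 / x)) + (exp (- (1 / x)) * (1 / x\<^sup>2)) * poly (p m) (1 / x)
        = d (Suc m) x"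
      using greater by (simp add: d_def p_def algebra_simps power2_eq_square)
    ultimately have "((\<lambda>x. poly (p m) (1 / x) * exp (- (1 / x))) has_real_derivative d (Suc m) x) (at x)" by simp
    then show ?thesis
      by (rule has_field_derivative_transform_within_open[where S = "{0<..}"]) (use greater in \<open>auto simp: d_def\<close>)
  next
    case equal
    have "((\<lambda>y. d m y / y) \<longlongrightarrow> 0) (at 0)"
      unfolding filterlim_at_split
    proof
      have "\<forall>\<^sub>F y in at_left 0. 0 = d m y / y" by (auto simp: d_def eventually_at_filter)
      then show "((\<lambda>y. d m y / y) \<longlongrightarrow> 0) (at_left 0)" by (rule Lim_transform_eventually[OF tendsto_const])
      have "((\<lambda>y. poly ([:0, 1:] * p m) (inverse y) * exp (- (inverse y))) \<longlongrightarrow> 0) (at_right 0)"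
        by (rule filterlim_compose[OF poly_times_exp_minus_tendsto filterlim_inverse_at_top_right])
      moreover have "\<forall>\<^sub>F y in at_right 0. poly ([:0, 1:] * p m) (inverse y) * exp (- (inverse y)) = d m y / y"
        by (auto simp: d_def eventually_at_filter inverse_eq_divide)
      ultimately show "((\<lambda>y. d m y / y) \<longlongrightarrow> 0) (at_right 0)" by (rule Lim_transform_eventually)
    qed
    then show ?thesis unfolding equal by (simp add: has_field_derivative_iff d_def)
  qed
  moreover have "d 0 = exp_inverse" by (auto simp: d_def exp_inverse_def p_def)
  ultimately show ?thesis unfolding smooth_real_def by blast
qed

lemma smooth_compact_supportD:
  assumes "smooth_compact_support n \<psi>"
  shows "depends_on_first n \<psi>" "C_class n k \<psi>"
    "i < n \<Longrightarrow> ((\<lambda>t. \<psi> (x(i := t))) has_real_derivative partial_deriv i \<psi> x) (at (x i))"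
proof -
  show 1: "depends_on_first n \<psi>" "C_class n k \<psi>" for k
    using assms by (auto simp: smooth_compact_support_def)
  show "i < n \<Longrightarrow> ((\<lambda>t. \<psi> (x(i := t))) has_real_derivative partial_deriv i \<psi> x) (at (x i))"
    by (rule C_class_SucD(1)[OF 1(2)])
qed

text \<open>The bounding box is kept. At a point whose coordinate j is too large, the function
  vanishes along the whole line in direction i if j differs from i, and on an open part of it around
  the point if j = i.\<close>

lemma smooth_compact_support_partial_deriv:
  assumes \<psi>: "smooth_compact_support n \<psi>" and i: "i < n"
  shows "smooth_compact_support n (partial_deriv i \<psi>)"
proof -
  note d = smooth_compact_supportD[OF \<psi>]
  obtain K where K: "\<And>x j. \<psi> x \<noteq> 0 \<Longrightarrow> j < n \<Longrightarrow> \<bar>x j\<bar> \<le> K"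
    using \<psi> unfolding smooth_compact_support_def by blast
  have dep: "partial_deriv i \<psi> x = partial_deriv i \<psi> y" if "\<forall>j<n. x j = y j" for x y
  proof -
    have "\<psi> (x(i := t)) = \<psi> (y(i := t))" for t
      using d(1) that unfolding depends_on_first_def by auto
    then show ?thesis using that i by (simp add: partial_deriv_def)
  qed
  have supp: "\<bar>x j\<bar> \<le> K" if nz: "partial_deriv i \<psi> x \<noteq> 0" and j: "j < n" for x j
  proof (rule ccontr)
    assume gt: "\<not> \<bar>x j\<bar> \<le> K"
    have "((\<lambda>t. 0) has_real_derivative partial_deriv i \<psi> x) (at (x i))"
    proof (cases "j = i")
      case True
      show ?thesis
      proof (rule has_field_derivative_transform_within_open[OF d(3)[OF i, of x], where S = "{t. K < \<bar>t\<bar>}"])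
        show "open {t. K < \<bar>t\<bar>}" by (intro open_Collect_less continuous_intros)
        show "x i \<in> {t. K < \<bar>t\<bar>}" using gt True by simp
        show "\<psi> (x(i := t)) = 0" if "t \<in> {t. K < \<bar>t\<bar>}" for t
          using K[of "x(i := t)" i] i that by force
      qed
    next
      case False
      have "\<psi> (x(i := t)) = 0" for t using K[of "x(i := t)" j] j gt False by force
      then show ?thesis using d(3)[OF i, of x] by simp
    qed
    then have "partial_deriv i \<psi> x = 0" using DERIV_const DERIV_unique by blast
    with nz show False by simp
  qed
  have "C_class n k (partial_deriv i \<psi>)" for k by (rule C_class_SucD(2)[OF d(2) i])
  then show ?thesis
    unfolding smooth_compact_support_def depends_on_first_def using dep supp by blast
qed

lemma smooth_compact_support_bounded:
  assumes \<psi>: "smooth_compact_support n \<psi>"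
  obtains B where "B \<ge> 0" "\<And>x. \<bar>\<psi> x\<bar> \<le> B"
proof -
  note d = smooth_compact_supportD[OF \<psi>]
  obtain K where K: "\<And>x j. \<psi> x \<noteq> 0 \<Longrightarrow> j < n \<Longrightarrow> \<bar>x j\<bar> \<le> K"
    using \<psi> unfolding smooth_compact_support_def by blast
  \<comment> \<open>The support condition bounds only the first \<open>n\<close> coordinates. The
    others are set to 0, which gives a compact product on which every nonzero value is
    attained.\<close>
  define S where "S = (\<Pi>\<^sub>E i\<in>(UNIV :: nat set). if i < n then {- K..K} else {0 :: real})"
  have "compactin (product_topology (\<lambda>i. euclidean) UNIV) S"
    unfolding S_def by (subst compactin_PiE) auto
  then have "compact S" by (simp add: euclidean_product_topology)
  moreover have "continuous_on S \<psi>"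
    using C_class_continuous[OF d(2)[of 0]] continuous_on_subset by blast
  ultimately have "bounded (\<psi> ` S)" by (intro compact_imp_bounded compact_continuous_image)
  then obtain B where B: "B > 0" "\<And>x. x \<in> S \<Longrightarrow> \<bar>\<psi> x\<bar> \<le> B"
    by (auto simp: bounded_pos)
  have "\<bar>\<psi> x\<bar> \<le> B" for x
  proof (cases "\<psi> x = 0")
    case False
    define y where "y i = (if i < n then x i else 0)" for i
    have "\<psi> x = \<psi> y" using d(1) by (simp add: depends_on_first_def y_def)
    moreover have "y \<in> S" using K[OF False] by (auto simp: S_def y_def abs_le_iff minus_le_iff)
    ultimately show ?thesis using B by simp
  qed (use B in simp)
  then show thesis using that[of B] B by simp
qed

lemma smooth_compact_support_tame:
  assumes \<psi>: "smooth_compact_support n \<psi>"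
  shows "tame n \<psi> (\<lambda>i. partial_deriv i \<psi>)"
proof -
  note d = smooth_compact_supportD[OF \<psi>]
  obtain B where B: "B \<ge> 0" "\<And>x. \<bar>\<psi> x\<bar> \<le> B" using smooth_compact_support_bounded[OF \<psi>] by blast
  have "\<forall>i. \<exists>b. i < n \<longrightarrow> (\<forall>x. \<bar>partial_deriv i \<psi> x\<bar> \<le> b)"
    using smooth_compact_support_bounded[OF smooth_compact_support_partial_deriv[OF \<psi>]] by metis
  then obtain b where b: "\<And>i x. i < n \<Longrightarrow> \<bar>partial_deriv i \<psi> x\<bar> \<le> b i" by metis
  define C where "C = B + (\<Sum>i<n. \<bar>b i\<bar>)"
  have C: "0 \<le> C" "B \<le> C" using B by (auto simp: C_def intro!: add_nonneg_nonneg sum_nonneg)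
  have C2: "b i \<le> C" if "i < n" for i
  proof -
    have "\<bar>b i\<bar> \<le> (\<Sum>i<n. \<bar>b i\<bar>)" using that by (intro member_le_sum) auto
    then show ?thesis using B by (simp add: C_def)
  qed
  have e: "C \<le> C * exp (C * (\<Sum>j<n. \<bar>x j\<bar>))" for x :: "nat \<Rightarrow> real"
    using C mult_left_mono[of 1 "exp (C * (\<Sum>j<n. \<bar>x j\<bar>))" C] by (simp add: sum_nonneg)
  have "\<forall>x. \<bar>\<psi> x\<bar> \<le> C * exp (C * (\<Sum>j<n. \<bar>x j\<bar>)) \<and> (\<forall>i<n. \<bar>partial_deriv i \<psi> x\<bar> \<le> C * exp (C * (\<Sum>j<n. \<bar>x j\<bar>)))"
    using B b C C2 e by (meson order_trans)
  moreover have "continuous_on UNIV (partial_deriv i \<psi>)" if "i < n" for i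
    by (rule C_class_continuous[OF C_class_SucD(2)[OF d(2) that, of 0]])
  ultimately show ?thesis
    unfolding tame_def using d(1,3) C_class_continuous[OF d(2)[of 0]] by (intro conjI exI[of _ C]) simp_all
qed

text \<open>The condition \<open>f 0 = 0\<close> keeps the composition zero outside the support of
  \<psi>.\<close>

lemma smooth_compact_support_compose:
  assumes \<psi>: "smooth_compact_support n \<psi>" and f: "smooth_real f" "f 0 = 0"
  shows "smooth_compact_support n (\<lambda>x. f (\<psi> x))"
proof -
  obtain K where K: "\<forall>x. \<psi> x \<noteq> 0 \<longrightarrow> (\<forall>i<n. \<bar>x i\<bar> \<le> K)"
    using \<psi> unfolding smooth_compact_support_def by blast
  have "\<forall>x. f (\<psi> x) \<noteq> 0 \<longrightarrow> (\<forall>i<n. \<bar>x i\<bar> \<le> K)" using K f(2) by metis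
  moreover have "depends_on_first n (\<lambda>x. f (\<psi> x))"
    using smooth_compact_supportD(1)[OF \<psi>] unfolding depends_on_first_def by metis
  ultimately show ?thesis
    unfolding smooth_compact_support_def
    using C_class_compose[OF f(1) smooth_compact_supportD(2)[OF \<psi>]] by blast
qed

text \<open>The factor exp 2 cancels the value of \<open>exp_inverse 1 * exp_inverse 1\<close>, so
  the bump function equals 1 at the origin.\<close>

definition cutoff :: "nat \<Rightarrow> (nat \<Rightarrow> real) \<Rightarrow> real" where
  "cutoff n x = (\<Prod>j<n. exp 2 * exp_inverse (1 + x j) * exp_inverse (1 - x j))"

lemma C_class_cutoff_scaled: "C_class n k (\<lambda>x. cutoff n (\<lambda>j. x j * c))"
  unfolding cutoff_def diff_conv_add_uminus mult_minus_right[symmetric]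
  by (intro C_class_prod C_class_mult C_class_const C_class_compose[OF smooth_real_exp_inverse] C_class_add C_class_coordinate)

lemma cutoff_depends: "(\<And>i. i < n \<Longrightarrow> x i = y i) \<Longrightarrow> cutoff n x = cutoff n y"
  by (simp add: cutoff_def)

lemma cutoff_support: "cutoff n x \<noteq> 0 \<Longrightarrow> i < n \<Longrightarrow> \<bar>x i\<bar> \<le> 1"
proof -
  assume "cutoff n x \<noteq> 0" "i < n"
  then have "exp_inverse (1 + x i) \<noteq> 0" "exp_inverse (1 - x i) \<noteq> 0" by (auto simp: cutoff_def)
  then show ?thesis by (auto simp: exp_inverse_def split: if_splits)
qed

lemma cutoff_zero: "cutoff n (\<lambda>_. 0) = 1"
  by (simp add: cutoff_def exp_inverse_def flip: exp_add)

lemma smooth_compact_support_cutoff: "smooth_compact_support n (cutoff n)"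
  unfolding smooth_compact_support_def depends_on_first_def
proof (intro conjI allI impI exI)
  show "C_class n k (cutoff n)" for k using C_class_cutoff_scaled[of n k 1] by simp
qed (auto intro: cutoff_depends cutoff_support)

section \<open>Pairs of square-integrable functions and the graph of the derivative\<close>

lemma square_integrable_Pair_iff:
  fixes f :: "'a \<Rightarrow> 'b::{real_normed_vector, second_countable_topology}"
    and g :: "'a \<Rightarrow> 'c::{real_normed_vector, second_countable_topology}"
  shows "square_integrable M (\<lambda>\<omega>. (f \<omega>, g \<omega>)) \<longleftrightarrow> square_integrable M f \<and> square_integrable M g"
proof safe
  assume p: "square_integrable M (\<lambda>\<omega>. (f \<omega>, g \<omega>))"
  then have m: "(\<lambda>\<omega>. (f \<omega>, g \<omega>)) \<in> borel_measurable M" by auto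
  have "(\<lambda>\<omega>. fst (f \<omega>, g \<omega>)) \<in> borel_measurable M" "(\<lambda>\<omega>. snd (f \<omega>, g \<omega>)) \<in> borel_measurable M"
    by (rule measurable_compose[OF m], intro borel_measurable_continuous_onI continuous_intros)+
  then have [measurable]: "f \<in> borel_measurable M" "g \<in> borel_measurable M" by simp_all
  show "square_integrable M f"
    by (rule square_integrable_bound[OF _ square_integrable_norm_sq[OF p]]) (auto simp: norm_Pair)
  show "square_integrable M g"
    by (rule square_integrable_bound[OF _ square_integrable_norm_sq[OF p]]) (auto simp: norm_Pair)
next
  assume fg [measurable]: "square_integrable M f" "square_integrable M g"
  show "square_integrable M (\<lambda>\<omega>. (f \<omega>, g \<omega>))"
    by (rule square_integrable_bound[where g = "\<lambda>\<omega>. (norm (f \<omega>))\<^sup>2 + (norm (g \<omega>))\<^sup>2"])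
      (use fg in \<open>auto simp: norm_Pair square_integrable_norm_sq\<close>)
qed

lemma msq_Pair:
  fixes f :: "'a \<Rightarrow> 'b::{real_normed_vector, second_countable_topology}"
    and g :: "'a \<Rightarrow> 'c::{real_normed_vector, second_countable_topology}"
  assumes "square_integrable M f" "square_integrable M g"
  shows "msq M (\<lambda>\<omega>. (f \<omega>, g \<omega>)) = msq M f + msq M g"
  using assms by (simp add: msq_def norm_Pair square_integrable_norm_sq)

lemma L2_converges_Pair_iff:
  fixes f :: "'a \<Rightarrow> 'b::{real_normed_vector, second_countable_topology}"
    and g :: "'a \<Rightarrow> 'c::{real_normed_vector, second_countable_topology}"
  assumes "\<And>n. square_integrable M (S n)" "\<And>n. square_integrable M (T n)" "square_integrable M f" "square_integrable M g"
  shows "L2_converges M (\<lambda>n \<omega>. (S n \<omega>, T n \<omega>)) (\<lambda>\<omega>. (f \<omega>, g \<omega>)) \<longleftrightarrow> L2_converges M S f \<and> L2_converges M T g"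
proof -
  have eq: "msq M (\<lambda>\<omega>. (S n \<omega>, T n \<omega>) - (f \<omega>, g \<omega>)) = msq M (\<lambda>\<omega>. S n \<omega> - f \<omega>) + msq M (\<lambda>\<omega>. T n \<omega> - g \<omega>)" for n
    using assms by (simp add: msq_Pair square_integrable_diff)
  show ?thesis
    unfolding L2_converges_msq eq
  proof safe
    assume lim: "(\<lambda>n. msq M (\<lambda>\<omega>. S n \<omega> - f \<omega>) + msq M (\<lambda>\<omega>. T n \<omega> - g \<omega>)) \<longlonglongrightarrow> 0"
    show "(\<lambda>n. msq M (\<lambda>\<omega>. S n \<omega> - f \<omega>)) \<longlonglongrightarrow> 0"
      by (rule Lim_null_comparison[OF _ lim]) simp
    show "(\<lambda>n. msq M (\<lambda>\<omega>. T n \<omega> - g \<omega>)) \<longlonglongrightarrow> 0"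
      by (rule Lim_null_comparison[OF _ lim]) simp
  qed (auto intro: tendsto_add_zero)
qed

lemma L2_converges_sum:
  fixes S :: "'i \<Rightarrow> nat \<Rightarrow> 'a \<Rightarrow> 'b::{real_normed_vector, second_countable_topology}"
  assumes "\<And>i n. i \<in> I \<Longrightarrow> square_integrable M (S i n)" "\<And>i. i \<in> I \<Longrightarrow> square_integrable M (f i)"
    "\<And>i. i \<in> I \<Longrightarrow> L2_converges M (S i) (f i)"
  shows "L2_converges M (\<lambda>n \<omega>. \<Sum>i\<in>I. S i n \<omega>) (\<lambda>\<omega>. \<Sum>i\<in>I. f i \<omega>)"
  using assms
proof (induction I rule: infinite_finite_induct)
  case (insert i I)
  then have "L2_converges M (\<lambda>n \<omega>. S i n \<omega> + (\<Sum>i\<in>I. S i n \<omega>)) (\<lambda>\<omega>. f i \<omega> + (\<Sum>i\<in>I. f i \<omega>))"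
    by (intro L2_converges_add square_integrable_sum insert.IH) auto
  then show ?case using insert.hyps by simp
qed (simp_all add: L2_converges_const)

lemma L2_converges_dominated:
  fixes S :: "nat \<Rightarrow> 'a \<Rightarrow> real"
  assumes [measurable]: "\<And>n. S n \<in> borel_measurable M" "f \<in> borel_measurable M"
    and w: "square_integrable M w" and b: "\<And>n \<omega>. \<bar>S n \<omega> - f \<omega>\<bar> \<le> w \<omega>"
    and lim: "\<And>\<omega>. (\<lambda>n. S n \<omega>) \<longlonglongrightarrow> f \<omega>"
  shows "L2_converges M S f"
proof -
  have "(\<lambda>n. \<integral>\<omega>. (norm (S n \<omega> - f \<omega>))\<^sup>2 \<partial>M) \<longlonglongrightarrow> (\<integral>\<omega>. 0 \<partial>M)"
  proof (rule integral_dominated_convergence[where w = "\<lambda>\<omega>. (norm (w \<omega>))\<^sup>2"])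
    show "integrable M (\<lambda>\<omega>. (norm (w \<omega>))\<^sup>2)" by (rule square_integrable_norm_sq[OF w])
    show "AE \<omega> in M. (\<lambda>n. (norm (S n \<omega> - f \<omega>))\<^sup>2) \<longlonglongrightarrow> 0"
    proof (rule AE_I2)
      fix \<omega>
      have "(\<lambda>n. (norm (S n \<omega> - f \<omega>))\<^sup>2) \<longlonglongrightarrow> (norm (f \<omega> - f \<omega>))\<^sup>2"
        by (intro tendsto_intros lim)
      then show "(\<lambda>n. (norm (S n \<omega> - f \<omega>))\<^sup>2) \<longlonglongrightarrow> 0" by simp
    qed
    show "AE \<omega> in M. norm ((norm (S n \<omega> - f \<omega>))\<^sup>2) \<le> (norm (w \<omega>))\<^sup>2" for n
    proof (rule AE_I2)
      fix \<omega>
      have "\<bar>S n \<omega> - f \<omega>\<bar> \<le> \<bar>w \<omega>\<bar>" using b[of n \<omega>] by linarith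
      then show "norm ((norm (S n \<omega> - f \<omega>))\<^sup>2) \<le> (norm (w \<omega>))\<^sup>2" by (simp add: abs_le_square_iff)
    qed
  qed measurable
  then show ?thesis by (simp add: L2_converges_def)
qed

text \<open>The derivative as a set of pairs. The norm on pairs is Euclidean, so the mean square of
  a pair is the squared norm of the domain, and closing the derivative becomes taking an
  \<open>L2_closure\<close>.\<close>

definition malliavin_graph :: "('h::real_inner \<Rightarrow> 'a \<Rightarrow> real) \<Rightarrow> ('a \<Rightarrow> real \<times> 'h) set" where
  "malliavin_graph X = {\<lambda>\<omega>. (S \<omega>, DS \<omega>) | S DS. smooth_cylindrical X S DS}"

text \<open>Only sums of polynomials in single variables \<open>X (h i)\<close>. These contain the
  Hermite sums and are closed under addition by concatenating the families.\<close>

definition poly_graph :: "('h::real_inner \<Rightarrow> 'a \<Rightarrow> real) \<Rightarrow> ('a \<Rightarrow> real \<times> 'h) set" where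
  "poly_graph X = {\<lambda>\<omega>. (\<Sum>i<n. poly (q i) (X (h i) \<omega>), \<Sum>i<n. poly (pderiv (q i)) (X (h i) \<omega>) *\<^sub>R h i) | (n::nat) q h. True}"

context isonormal_gaussian_process
begin

lemma smooth_cylindrical_tame:
  assumes "smooth_cylindrical X F DF"
  shows "tame_cylindrical X F DF"
  using assms smooth_compact_support_tame unfolding smooth_cylindrical_def tame_cylindrical_def by blast

lemma malliavin_graph_square_integrable:
  "P \<in> malliavin_graph X \<Longrightarrow> square_integrable M P"
  by (auto simp: malliavin_graph_def square_integrable_Pair_iff
    intro!: tame_cylindrical_square_integrable smooth_cylindrical_tame)

lemma has_malliavin_deriv_iff_closure:
  "has_malliavin_deriv M X F U \<longleftrightarrow> (\<lambda>\<omega>. (F \<omega>, U \<omega>)) \<in> L2_closure M (malliavin_graph X)"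
proof
  assume "has_malliavin_deriv M X F U"
  then obtain S DS where s: "square_integrable M F" "square_integrable M U"
    and S: "\<And>n. smooth_cylindrical X (S n) (DS n)" "L2_converges M S F" "L2_converges M DS U"
    unfolding has_malliavin_deriv_def by blast
  have "L2_converges M (\<lambda>n \<omega>. (S n \<omega>, DS n \<omega>)) (\<lambda>\<omega>. (F \<omega>, U \<omega>))"
    using S s by (subst L2_converges_Pair_iff)
      (auto intro: tame_cylindrical_square_integrable[OF smooth_cylindrical_tame])
  moreover have "(\<lambda>\<omega>. (S n \<omega>, DS n \<omega>)) \<in> malliavin_graph X" for n
    using S(1) by (auto simp: malliavin_graph_def)
  ultimately show "(\<lambda>\<omega>. (F \<omega>, U \<omega>)) \<in> L2_closure M (malliavin_graph X)"
    unfolding L2_closure_def using s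
    by (auto simp: square_integrable_Pair_iff intro!: exI[of _ "\<lambda>n \<omega>. (S n \<omega>, DS n \<omega>)"])
next
  assume a: "(\<lambda>\<omega>. (F \<omega>, U \<omega>)) \<in> L2_closure M (malliavin_graph X)"
  then have s: "square_integrable M F" "square_integrable M U"
    by (auto simp: L2_closure_def square_integrable_Pair_iff)
  obtain P where P: "\<And>n. P n \<in> malliavin_graph X" "L2_converges M P (\<lambda>\<omega>. (F \<omega>, U \<omega>))"
    using a by (auto simp: L2_closure_def)
  then obtain S DS where S: "\<And>n. smooth_cylindrical X (S n) (DS n)" "\<And>n. P n = (\<lambda>\<omega>. (S n \<omega>, DS n \<omega>))"
    unfolding malliavin_graph_def by (auto simp: set_eq_iff) metis
  have "P = (\<lambda>n \<omega>. (S n \<omega>, DS n \<omega>))" using S(2) by auto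
  then have "L2_converges M (\<lambda>n \<omega>. (S n \<omega>, DS n \<omega>)) (\<lambda>\<omega>. (F \<omega>, U \<omega>))" using P(2) by simp
  then have "L2_converges M S F \<and> L2_converges M DS U"
    using S(1) s by (subst (asm) L2_converges_Pair_iff)
      (auto intro: tame_cylindrical_square_integrable[OF smooth_cylindrical_tame])
  then show "has_malliavin_deriv M X F U"
    unfolding has_malliavin_deriv_def using s S(1) by blast
qed

lemma poly_square_integrable: "square_integrable M (\<lambda>\<omega>. poly p (X h \<omega>))"
  by (rule tame_cylindrical_square_integrable[OF tame_cylindrical_poly])

lemma poly_graph_square_integrable:
  "P \<in> poly_graph X \<Longrightarrow> square_integrable M P"
  by (auto simp: poly_graph_def square_integrable_Pair_iff
    intro!: square_integrable_sum square_integrable_scaleR_right poly_square_integrable)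

text \<open>A polynomial \<open>P\<close> is approximated by \<open>P(x) \<zeta>(x/K)\<close> with \<open>\<zeta>\<close> a bump function
  with \<open>\<zeta>(0) = 1\<close>.\<close>

lemma poly_cylindrical_has_malliavin_deriv:
  fixes q :: "nat \<Rightarrow> real poly"
  assumes n: "n \<ge> 1"
  shows "has_malliavin_deriv M X (\<lambda>\<omega>. \<Sum>i<n. poly (q i) (X (h i) \<omega>))
    (\<lambda>\<omega>. \<Sum>i<n. poly (pderiv (q i)) (X (h i) \<omega>) *\<^sub>R h i)"
proof -
  define P where "P x = (\<Sum>i<n. poly (q i) (x i))" for x :: "nat \<Rightarrow> real"
  define \<zeta> where "\<zeta> = cutoff n"
  note z = smooth_compact_supportD[OF smooth_compact_support_cutoff[of n], folded \<zeta>_def]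
  \<comment> \<open>The inverse scale 1/K for K = 1, 2, and so on.\<close>
  define c where "c k = 1 / real (Suc k)" for k
  have c: "0 < c k" "c k \<le> 1" for k by (simp_all add: c_def)
  have clim: "c \<longlonglongrightarrow> 0" unfolding c_def using LIMSEQ_inverse_real_of_nat by (simp add: inverse_eq_divide)
  define \<psi> where "\<psi> k x = P x * \<zeta> (\<lambda>j. x j * c k)" for k x
  \<comment> \<open>The product rule. Its second term carries the factor \<open>c k\<close> from the
    rescaling and therefore disappears in the limit.\<close>
  define \<psi>' where "\<psi>' k i x = poly (pderiv (q i)) (x i) * \<zeta> (\<lambda>j. x j * c k) + c k * partial_deriv i \<zeta> (\<lambda>j. x j * c k) * P x" for k i x
  have PC: "C_class n m P" for m
    unfolding P_def by (intro C_class_sum C_class_compose[OF smooth_real_poly] C_class_coordinate)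
  have scs: "smooth_compact_support n (\<psi> k)" for k
    unfolding smooth_compact_support_def
  proof (intro conjI allI exI impI)
    show "depends_on_first n (\<psi> k)"
      unfolding depends_on_first_def \<psi>_def P_def \<zeta>_def
      by (auto intro!: arg_cong2[where f = "(*)"] cutoff_depends)
    show "C_class n m (\<psi> k)" for m
      unfolding \<psi>_def \<zeta>_def by (intro C_class_mult PC C_class_cutoff_scaled)
    fix x i assume "\<psi> k x \<noteq> 0" "i < n"
    then have "\<bar>x i * c k\<bar> \<le> 1" using cutoff_support[of n "\<lambda>j. x j * c k" i] by (auto simp: \<psi>_def \<zeta>_def)
    then show "\<bar>x i\<bar> \<le> 1 / c k" using c(1)[of k] by (simp add: abs_mult field_simps)
  qed
  have pd: "partial_deriv i (\<psi> k) x = \<psi>' k i x" if i: "i < n" for i k x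
  proof (rule partial_deriv_eq)
    have "((\<lambda>t. P (x(i := t))) has_real_derivative poly (pderiv (q i)) (x i)) (at (x i))"
    proof -
      have "P (x(i := t)) = poly (q i) t + (\<Sum>j\<in>{..<n} - {i}. poly (q j) (x j))" for t
        unfolding P_def using i by (subst sum.remove[of _ i]) auto
      then show ?thesis by (auto intro!: derivative_eq_intros poly_DERIV)
    qed
    moreover have "((\<lambda>t. \<zeta> (\<lambda>j. (x(i := t)) j * c k)) has_real_derivative c k * partial_deriv i \<zeta> (\<lambda>j. x j * c k)) (at (x i))"
    proof -
      have eq: "(\<lambda>j. (x(i := t)) j * c k) = (\<lambda>j. x j * c k)(i := t * c k)" for t by auto
      have "((\<lambda>t. t * c k) has_real_derivative c k) (at (x i))" by (auto intro!: derivative_eq_intros)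
      from DERIV_chain2[OF z(3)[OF i, where x = "\<lambda>j. x j * c k"] this]
      show ?thesis unfolding eq by (simp add: mult.commute)
    qed
    ultimately have "((\<lambda>t. P (x(i := t)) * \<zeta> (\<lambda>j. (x(i := t)) j * c k)) has_real_derivative
      poly (pderiv (q i)) (x i) * \<zeta> (\<lambda>j. (x(i := x i)) j * c k) + c k * partial_deriv i \<zeta> (\<lambda>j. x j * c k) * P (x(i := x i))) (at (x i))"
      by (rule DERIV_mult)
    then show "((\<lambda>t. \<psi> k (x(i := t))) has_real_derivative \<psi>' k i x) (at (x i))"
      by (simp only: fun_upd_triv \<psi>_def \<psi>'_def)
  qed
  obtain B where B: "B \<ge> 0" "\<And>x. \<bar>\<zeta> x\<bar> \<le> B"
    using smooth_compact_support_bounded[OF smooth_compact_support_cutoff[of n]] unfolding \<zeta>_def by blast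
  let ?x = "\<lambda>\<omega> j. X (h j) \<omega>"
  have zlim: "(\<lambda>k. f (\<lambda>j. x j * c k)) \<longlonglongrightarrow> f (\<lambda>_. 0)" if "continuous_on UNIV f" for f :: "(nat \<Rightarrow> real) \<Rightarrow> real" and x
  proof -
    have "(\<lambda>k. (\<lambda>j. x j * c k)) \<longlonglongrightarrow> (\<lambda>_. 0)"
      by (rule tendsto_coordinatewise) (use tendsto_mult_right_zero[OF clim] in auto)
    then show ?thesis using that by (intro continuous_on_tendsto_compose[OF that]) auto
  qed
  have zc: "continuous_on UNIV \<zeta>" by (rule C_class_continuous[OF z(2)[of 0]])
  have z0: "\<zeta> (\<lambda>_. 0) = 1" by (simp add: \<zeta>_def cutoff_zero)
  have Psq: "square_integrable M (\<lambda>\<omega>. P (?x \<omega>))"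
    unfolding P_def by (intro square_integrable_sum poly_square_integrable)
  have sq\<psi>: "square_integrable M (\<lambda>\<omega>. \<psi> k (?x \<omega>))" for k
    by (rule tame_square_integrable(1)[OF smooth_compact_support_tame[OF scs]])
  have sq\<psi>': "square_integrable M (\<lambda>\<omega>. \<psi>' k i (?x \<omega>))" if "i < n" for k i
    using tame_square_integrable(2)[OF smooth_compact_support_tame[OF scs] that] pd[OF that] by simp
  have abs_sq: "square_integrable M (\<lambda>\<omega>. \<bar>f \<omega>\<bar>)" if "square_integrable M f" for f :: "'a \<Rightarrow> real"
  proof -
    have [measurable]: "f \<in> borel_measurable M" using that by auto
    show ?thesis using square_integrable_norm_sq[OF that] by (simp add: square_integrable_def)
  qed
  have 1: "L2_converges M (\<lambda>k \<omega>. \<psi> k (?x \<omega>)) (\<lambda>\<omega>. P (?x \<omega>))"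
  proof (rule L2_converges_dominated)
    \<comment> \<open>The factor B + 1 bounds |\<zeta> - 1|.\<close>
    show "square_integrable M (\<lambda>\<omega>. (B + 1) * \<bar>P (?x \<omega>)\<bar>)" by (intro square_integrable_mult abs_sq Psq)
    show "\<bar>\<psi> k (?x \<omega>) - P (?x \<omega>)\<bar> \<le> (B + 1) * \<bar>P (?x \<omega>)\<bar>" for k \<omega>
    proof -
      have "\<psi> k (?x \<omega>) - P (?x \<omega>) = (\<zeta> (\<lambda>j. ?x \<omega> j * c k) - 1) * P (?x \<omega>)" by (simp add: \<psi>_def algebra_simps)
      moreover have "\<bar>\<zeta> (\<lambda>j. ?x \<omega> j * c k) - 1\<bar> \<le> B + 1" using B(2)[of "\<lambda>j. ?x \<omega> j * c k"] by linarith
      ultimately show ?thesis by (simp add: abs_mult mult_right_mono)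
    qed
    show "(\<lambda>k. \<psi> k (?x \<omega>)) \<longlonglongrightarrow> P (?x \<omega>)" for \<omega>
      unfolding \<psi>_def using tendsto_mult[OF tendsto_const zlim[OF zc], of "P (?x \<omega>)" "?x \<omega>"] by (simp add: z0)
  qed (use Psq sq\<psi> in auto)
  have 2: "L2_converges M (\<lambda>k \<omega>. \<psi>' k i (?x \<omega>)) (\<lambda>\<omega>. poly (pderiv (q i)) (?x \<omega> i))" if i: "i < n" for i
  proof -
    have scs': "smooth_compact_support n (partial_deriv i \<zeta>)"
      unfolding \<zeta>_def by (rule smooth_compact_support_partial_deriv[OF smooth_compact_support_cutoff i])
    obtain b where b: "b \<ge> 0" "\<And>x. \<bar>partial_deriv i \<zeta> x\<bar> \<le> b"
      using smooth_compact_support_bounded[OF scs'] by blast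
    have pc: "continuous_on UNIV (partial_deriv i \<zeta>)"
      by (rule C_class_continuous[OF smooth_compact_supportD(2)[OF scs', of 0]])
    let ?Q = "\<lambda>\<omega>. poly (pderiv (q i)) (?x \<omega> i)"
    show ?thesis
    proof (rule L2_converges_dominated)
      show "square_integrable M (\<lambda>\<omega>. (B + 1) * \<bar>?Q \<omega>\<bar> + b * \<bar>P (?x \<omega>)\<bar>)"
        by (intro square_integrable_add square_integrable_mult abs_sq Psq poly_square_integrable)
      show "\<bar>\<psi>' k i (?x \<omega>) - ?Q \<omega>\<bar> \<le> (B + 1) * \<bar>?Q \<omega>\<bar> + b * \<bar>P (?x \<omega>)\<bar>" for k \<omega>
      proof -
        let ?y = "\<lambda>j. ?x \<omega> j * c k"
        have "\<psi>' k i (?x \<omega>) - ?Q \<omega> = (\<zeta> ?y - 1) * ?Q \<omega> + (c k * partial_deriv i \<zeta> ?y) * P (?x \<omega>)"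
          by (simp add: \<psi>'_def algebra_simps)
        moreover have "\<bar>\<zeta> ?y - 1\<bar> \<le> B + 1" using B(2)[of ?y] by linarith
        then have "\<bar>(\<zeta> ?y - 1) * ?Q \<omega>\<bar> \<le> (B + 1) * \<bar>?Q \<omega>\<bar>" by (simp add: abs_mult mult_right_mono)
        moreover have "\<bar>c k * partial_deriv i \<zeta> ?y\<bar> \<le> 1 * b"
          unfolding abs_mult using c[of k] b by (intro mult_mono) auto
        then have "\<bar>(c k * partial_deriv i \<zeta> ?y) * P (?x \<omega>)\<bar> \<le> b * \<bar>P (?x \<omega>)\<bar>"
          unfolding abs_mult[of _ "P (?x \<omega>)"] by (intro mult_right_mono) auto
        ultimately show ?thesis by linarith
      qed
      show "(\<lambda>k. \<psi>' k i (?x \<omega>)) \<longlonglongrightarrow> ?Q \<omega>" for \<omega>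
        unfolding \<psi>'_def
        using tendsto_add[OF tendsto_mult[OF tendsto_const zlim[OF zc], of "?Q \<omega>" "?x \<omega>"]
          tendsto_mult[OF tendsto_mult[OF clim zlim[OF pc, of "?x \<omega>"]] tendsto_const[of "P (?x \<omega>)"]]]
        by (simp add: z0)
    qed (use sq\<psi>'[OF i] poly_square_integrable in auto)
  qed
  show ?thesis
    unfolding has_malliavin_deriv_def
  proof (intro conjI exI allI)
    show "square_integrable M (\<lambda>\<omega>. \<Sum>i<n. poly (q i) (X (h i) \<omega>))" using Psq by (simp add: P_def)
    show "square_integrable M (\<lambda>\<omega>. \<Sum>i<n. poly (pderiv (q i)) (X (h i) \<omega>) *\<^sub>R h i)"
      by (intro square_integrable_sum square_integrable_scaleR_right poly_square_integrable)
    show "smooth_cylindrical X (\<lambda>\<omega>. \<psi> k (?x \<omega>)) (\<lambda>\<omega>. \<Sum>i<n. \<psi>' k i (?x \<omega>) *\<^sub>R h i)" for k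
      unfolding smooth_cylindrical_def using n scs[of k] pd by (intro exI[of _ n] exI[of _ "\<psi> k"] exI[of _ h]) auto
    show "L2_converges M (\<lambda>k \<omega>. \<psi> k (?x \<omega>)) (\<lambda>\<omega>. \<Sum>i<n. poly (q i) (X (h i) \<omega>))"
      using 1 by (simp add: P_def)
    show "L2_converges M (\<lambda>k \<omega>. \<Sum>i<n. \<psi>' k i (?x \<omega>) *\<^sub>R h i) (\<lambda>\<omega>. \<Sum>i<n. poly (pderiv (q i)) (X (h i) \<omega>) *\<^sub>R h i)"
    proof (rule L2_converges_sum)
      fix i assume "i \<in> {..<n}"
      then have i: "i < n" by simp
      have "(\<lambda>k. (norm (h i))\<^sup>2 * msq M (\<lambda>\<omega>. \<psi>' k i (?x \<omega>) - poly (pderiv (q i)) (X (h i) \<omega>))) \<longlonglongrightarrow> 0"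
        using tendsto_mult_right_zero[OF 2[OF i, unfolded L2_converges_msq]] by simp
      moreover have "msq M (\<lambda>\<omega>. \<psi>' k i (?x \<omega>) *\<^sub>R h i - poly (pderiv (q i)) (X (h i) \<omega>) *\<^sub>R h i)
          = (norm (h i))\<^sup>2 * msq M (\<lambda>\<omega>. \<psi>' k i (?x \<omega>) - poly (pderiv (q i)) (X (h i) \<omega>))" for k
        unfolding scaleR_diff_left[symmetric] by (simp add: msq_def power_mult_distrib mult.commute)
      ultimately show "L2_converges M (\<lambda>k \<omega>. \<psi>' k i (?x \<omega>) *\<^sub>R h i) (\<lambda>\<omega>. poly (pderiv (q i)) (X (h i) \<omega>) *\<^sub>R h i)"
        by (simp add: L2_converges_msq)
    qed (auto intro!: square_integrable_scaleR_right sq\<psi>' poly_square_integrable)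
  qed
qed

lemma poly_graph_closure: "L2_closure M (poly_graph X) \<subseteq> L2_closure M (malliavin_graph X)"
proof (rule L2_closure_mono_closure[OF malliavin_graph_square_integrable])
  show "poly_graph X \<subseteq> L2_closure M (malliavin_graph X)"
  proof
    fix P assume "P \<in> poly_graph X"
    then obtain n :: nat and q h where P: "P = (\<lambda>\<omega>. (\<Sum>i<n. poly (q i) (X (h i) \<omega>), \<Sum>i<n. poly (pderiv (q i)) (X (h i) \<omega>) *\<^sub>R h i))"
      by (auto simp: poly_graph_def)
    \<comment> \<open>Padding with a zero polynomial makes the number of summands positive, also for
      the empty sum.\<close>
    define q' where "q' = q(n := 0)"
    have "P = (\<lambda>\<omega>. (\<Sum>i<Suc n. poly (q' i) (X (h i) \<omega>), \<Sum>i<Suc n. poly (pderiv (q' i)) (X (h i) \<omega>) *\<^sub>R h i))"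
      by (simp add: P q'_def)
    then show "P \<in> L2_closure M (malliavin_graph X)"
      using poly_cylindrical_has_malliavin_deriv[of "Suc n" q' h]
      unfolding has_malliavin_deriv_iff_closure by simp
  qed
qed

lemma poly_graph_add:
  assumes "P \<in> poly_graph X" "Q \<in> poly_graph X"
  shows "(\<lambda>\<omega>. P \<omega> + Q \<omega>) \<in> poly_graph X"
proof -
  obtain n :: nat and p h where P: "P = (\<lambda>\<omega>. (\<Sum>i<n. poly (p i) (X (h i) \<omega>), \<Sum>i<n. poly (pderiv (p i)) (X (h i) \<omega>) *\<^sub>R h i))"
    using assms by (auto simp: poly_graph_def)
  obtain m :: nat and q k where Q: "Q = (\<lambda>\<omega>. (\<Sum>i<m. poly (q i) (X (k i) \<omega>), \<Sum>i<m. poly (pderiv (q i)) (X (k i) \<omega>) *\<^sub>R k i))"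
    using assms by (auto simp: poly_graph_def)
  let ?r = "\<lambda>i. if i < n then p i else q (i - n)" and ?l = "\<lambda>i. if i < n then h i else k (i - n)"
  have "(\<lambda>\<omega>. P \<omega> + Q \<omega>) = (\<lambda>\<omega>. (\<Sum>i<n + m. poly (?r i) (X (?l i) \<omega>), \<Sum>i<n + m. poly (pderiv (?r i)) (X (?l i) \<omega>) *\<^sub>R ?l i))"
  proof
    fix \<omega>
    have "(\<Sum>i<n. poly (?r i) (X (?l i) \<omega>)) = (\<Sum>i<n. poly (p i) (X (h i) \<omega>))"
      "(\<Sum>i<n. poly (pderiv (?r i)) (X (?l i) \<omega>) *\<^sub>R ?l i) = (\<Sum>i<n. poly (pderiv (p i)) (X (h i) \<omega>) *\<^sub>R h i)"
      by (rule sum.cong; simp)+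
    then show "P \<omega> + Q \<omega> = (\<Sum>i<n + m. poly (?r i) (X (?l i) \<omega>), \<Sum>i<n + m. poly (pderiv (?r i)) (X (?l i) \<omega>) *\<^sub>R ?l i)"
      unfolding sum_lessThan_plus P Q by simp
  qed
  then show ?thesis
    unfolding poly_graph_def by (intro CollectI exI[of _ "n + m"] exI[of _ ?r] exI[of _ ?l]) simp
qed

lemma poly_graph_scaleR:
  assumes "P \<in> poly_graph X"
  shows "(\<lambda>\<omega>. c *\<^sub>R P \<omega>) \<in> poly_graph X"
proof -
  obtain n :: nat and p h where P: "P = (\<lambda>\<omega>. (\<Sum>i<n. poly (p i) (X (h i) \<omega>), \<Sum>i<n. poly (pderiv (p i)) (X (h i) \<omega>) *\<^sub>R h i))"
    using assms by (auto simp: poly_graph_def)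
  have "(\<lambda>\<omega>. c *\<^sub>R P \<omega>) = (\<lambda>\<omega>. (\<Sum>i<n. poly (smult c (p i)) (X (h i) \<omega>), \<Sum>i<n. poly (pderiv (smult c (p i))) (X (h i) \<omega>) *\<^sub>R h i))"
    unfolding P by (simp add: pderiv_smult sum_distrib_left scaleR_sum_right)
  then show ?thesis unfolding poly_graph_def by (intro CollectI exI[of _ n] exI[of _ "\<lambda>i. smult c (p i)"] exI[of _ h]) simp
qed

end

section \<open>Wiener chaos\<close>

lemma msq_sum_orthogonal:
  fixes f :: "'i \<Rightarrow> 'a \<Rightarrow> 'b::{real_inner, second_countable_topology}"
  assumes "finite I" "\<And>i. i \<in> I \<Longrightarrow> square_integrable M (f i)"
    and "\<And>i j. i \<in> I \<Longrightarrow> j \<in> I \<Longrightarrow> i \<noteq> j \<Longrightarrow> (\<integral>\<omega>. inner (f i \<omega>) (f j \<omega>) \<partial>M) = 0"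
  shows "msq M (\<lambda>\<omega>. \<Sum>i\<in>I. f i \<omega>) = (\<Sum>i\<in>I. msq M (f i))"
  using assms
proof (induction I rule: finite_induct)
  case empty
  then show ?case by (simp add: msq_def)
next
  case (insert i I)
  have "(\<integral>\<omega>. inner (f i \<omega>) (\<Sum>j\<in>I. f j \<omega>) \<partial>M) = (\<Sum>j\<in>I. \<integral>\<omega>. inner (f i \<omega>) (f j \<omega>) \<partial>M)"
    unfolding inner_sum_right by (rule Bochner_Integration.integral_sum) (auto intro!: integrable_inner insert.prems)
  also have "\<dots> = 0" by (rule sum.neutral) (use insert in auto)
  finally have "msq M (\<lambda>\<omega>. f i \<omega> + (\<Sum>j\<in>I. f j \<omega>)) = msq M (f i) + msq M (\<lambda>\<omega>. \<Sum>j\<in>I. f j \<omega>)"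
    by (subst msq_add) (auto intro!: square_integrable_sum insert.prems)
  also have "msq M (\<lambda>\<omega>. \<Sum>j\<in>I. f j \<omega>) = (\<Sum>j\<in>I. msq M (f j))"
    by (rule insert.IH) (use insert.prems in auto)
  finally show ?case using insert.hyps by simp
qed

text \<open>By Pythagoras the mean square of a block of terms is the sum of their mean squares, so
  the partial sums are Cauchy. The series starts at 1, as does the one defining the inverse
  generator.\<close>

lemma (in prob_space) orthogonal_series_converges:
  fixes f :: "nat \<Rightarrow> 'a \<Rightarrow> 'b::{real_inner, complete_space, second_countable_topology}"
  assumes f: "\<And>m. m \<ge> 1 \<Longrightarrow> square_integrable M (f m)"
    and orth: "\<And>m l. m \<ge> 1 \<Longrightarrow> l \<ge> 1 \<Longrightarrow> m \<noteq> l \<Longrightarrow> (\<integral>\<omega>. inner (f m \<omega>) (f l \<omega>) \<partial>M) = 0"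
    and sum: "summable (\<lambda>m. msq M (f m))"
  obtains F where "square_integrable M F" "L2_converges M (\<lambda>N \<omega>. \<Sum>m=1..N. f m \<omega>) F"
proof (rule L2_complete[of "\<lambda>N \<omega>. \<Sum>m=1..N. f m \<omega>"])
  show "square_integrable M (\<lambda>\<omega>. \<Sum>m=1..N. f m \<omega>)" for N
    by (intro square_integrable_sum f) auto
  fix e :: real assume "e > 0"
  then obtain N where N: "\<And>m n. m \<ge> N \<Longrightarrow> norm (sum (\<lambda>m. msq M (f m)) {m..<n}) < e"
    using sum unfolding summable_Cauchy by blast
  have le: "msq M (\<lambda>\<omega>. (\<Sum>k=1..n. f k \<omega>) - (\<Sum>k=1..m. f k \<omega>)) < e" if "N \<le> m" "m \<le> n" for m n
  proof -
    have "(\<Sum>k=1..n. f k \<omega>) - (\<Sum>k=1..m. f k \<omega>) = (\<Sum>k\<in>{Suc m..<Suc n}. f k \<omega>)" for \<omega>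
    proof -
      have "{1..n} = {1..m} \<union> {Suc m..<Suc n}" using that by auto
      then have "(\<Sum>k=1..n. f k \<omega>) = (\<Sum>k=1..m. f k \<omega>) + (\<Sum>k\<in>{Suc m..<Suc n}. f k \<omega>)"
        by (simp only:) (rule sum.union_disjoint, auto)
      then show ?thesis by simp
    qed
    moreover have "msq M (\<lambda>\<omega>. \<Sum>k\<in>{Suc m..<Suc n}. f k \<omega>) = (\<Sum>k\<in>{Suc m..<Suc n}. msq M (f k))"
      by (rule msq_sum_orthogonal) (auto intro!: f orth)
    ultimately show ?thesis using N[of "Suc m" "Suc n"] that by simp
  qed
  have "msq M (\<lambda>\<omega>. (\<Sum>k=1..m. f k \<omega>) - (\<Sum>k=1..n. f k \<omega>)) < e" if "m \<ge> N" "n \<ge> N" for m n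
  proof (cases "m \<le> n")
    case True
    then show ?thesis using le[of m n] that by (subst msq_minus_commute) auto
  next
    case False
    then show ?thesis using le[of n m] that by simp
  qed
  then show "\<exists>N. \<forall>m\<ge>N. \<forall>n\<ge>N. msq M (\<lambda>\<omega>. (\<Sum>k=1..m. f k \<omega>) - (\<Sum>k=1..n. f k \<omega>)) < e" by blast
qed

text \<open>The derivative on the algebraic span of one chaos; the second component uses that the
  derivative of the Hermite polynomial of degree m is m times the one of degree m - 1.\<close>

definition hermite_graph :: "('h::real_inner \<Rightarrow> 'a \<Rightarrow> real) \<Rightarrow> nat \<Rightarrow> ('a \<Rightarrow> real \<times> 'h) set" where
  "hermite_graph X m = {\<lambda>\<omega>. (\<Sum>i<n. c i * hermite m (X (h i) \<omega>),
      \<Sum>i<n. (c i * (real m * hermite (m - 1) (X (h i) \<omega>))) *\<^sub>R h i) | (n::nat) c h. \<forall>i<n. norm (h i) = 1}"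

lemma hermite_graphE:
  assumes "P \<in> hermite_graph X m"
  obtains n :: nat and c h where "\<And>i. i < n \<Longrightarrow> norm (h i) = 1"
    "P = (\<lambda>\<omega>. (\<Sum>i<n. c i * hermite m (X (h i) \<omega>), \<Sum>i<n. (c i * (real m * hermite (m - 1) (X (h i) \<omega>))) *\<^sub>R h i))"
  using assms unfolding hermite_graph_def by blast

lemma wiener_chaos_eq: "wiener_chaos M X m = L2_closure M (chaos_span X m)"
  by (simp add: wiener_chaos_def L2_closure_def)

lemma chaos_spanE:
  assumes "S \<in> chaos_span X m" "m \<ge> 1"
  obtains n :: nat and c h where "\<And>i. i < n \<Longrightarrow> norm (h i) = 1" "S = (\<lambda>\<omega>. \<Sum>i<n. c i * hermite m (X (h i) \<omega>))"
  using assms unfolding chaos_span_def by auto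

lemma hermite_in_chaos_span: "norm h = 1 \<Longrightarrow> (\<lambda>\<omega>. hermite m (X h \<omega>)) \<in> chaos_span X m"
  unfolding chaos_span_def by (intro CollectI exI[of _ 1] exI[of _ "\<lambda>_. 1"] exI[of _ "\<lambda>_. h"]) auto

lemma chaos_span_scale:
  assumes "S \<in> chaos_span X m"
  shows "(\<lambda>\<omega>. a * S \<omega>) \<in> chaos_span X m"
proof -
  obtain n :: nat and c h where "m \<ge> 1 \<longrightarrow> (\<forall>i<n. norm (h i) = 1)" "S = (\<lambda>\<omega>. \<Sum>i<n. c i * hermite m (X (h i) \<omega>))"
    using assms unfolding chaos_span_def by blast
  then show ?thesis
    unfolding chaos_span_def
    by (intro CollectI exI[of _ n] exI[of _ "\<lambda>i. a * c i"] exI[of _ h]) (auto simp: sum_distrib_left mult.assoc)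
qed

lemma chaos_span_add:
  assumes "S \<in> chaos_span X m" "T \<in> chaos_span X m"
  shows "(\<lambda>\<omega>. S \<omega> + T \<omega>) \<in> chaos_span X m"
proof -
  obtain n :: nat and c h where S: "m \<ge> 1 \<longrightarrow> (\<forall>i<n. norm (h i) = 1)" "S = (\<lambda>\<omega>. \<Sum>i<n. c i * hermite m (X (h i) \<omega>))"
    using assms unfolding chaos_span_def by blast
  obtain l :: nat and d k where T: "m \<ge> 1 \<longrightarrow> (\<forall>i<l. norm (k i) = 1)" "T = (\<lambda>\<omega>. \<Sum>i<l. d i * hermite m (X (k i) \<omega>))"
    using assms unfolding chaos_span_def by blast
  let ?c = "\<lambda>i. if i < n then c i else d (i - n)" and ?h = "\<lambda>i. if i < n then h i else k (i - n)"
  have "(\<lambda>\<omega>. S \<omega> + T \<omega>) = (\<lambda>\<omega>. \<Sum>i<n + l. ?c i * hermite m (X (?h i) \<omega>))"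
    unfolding sum_lessThan_plus S T by simp
  moreover have "m \<ge> 1 \<longrightarrow> (\<forall>i<n + l. norm (?h i) = 1)" using S(1) T(1) by auto
  ultimately show ?thesis
    unfolding chaos_span_def by (intro CollectI exI[of _ "n + l"] exI[of _ ?c] exI[of _ ?h]) simp
qed

context isonormal_gaussian_process
begin

lemma chaos_span_square_integrable: "S \<in> chaos_span X m \<Longrightarrow> square_integrable M S"
  unfolding chaos_span_def
  by (auto intro!: square_integrable_sum square_integrable_mult hermite_square_integrable)

lemma wiener_chaos_square_integrable: "F \<in> wiener_chaos M X m \<Longrightarrow> square_integrable M F"
  by (simp add: wiener_chaos_def)

text \<open>The chaos is closed and linear, so an orthogonal projection exists and the element
  selected by \<open>chaos_proj\<close> is one.\<close>

lemma chaos_proj_in_chaos: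
  assumes Z: "square_integrable M Z"
  shows "chaos_proj M X m Z \<in> wiener_chaos M X m"
    and "W \<in> wiener_chaos M X m \<Longrightarrow> (\<integral>\<omega>. Z \<omega> * W \<omega> \<partial>M) = (\<integral>\<omega>. chaos_proj M X m Z \<omega> * W \<omega> \<partial>M)"
proof -
  let ?V = "wiener_chaos M X m"
  have "(\<lambda>\<omega>. 0) \<in> chaos_span X m" unfolding chaos_span_def by (intro CollectI exI[of _ 0]) auto
  then have zero: "(\<lambda>\<omega>. 0) \<in> ?V" unfolding wiener_chaos_eq by (rule L2_closure_incl) simp
  obtain Y where Y: "Y \<in> ?V" "\<And>W. W \<in> ?V \<Longrightarrow> (\<integral>\<omega>. inner (Z \<omega> - Y \<omega>) (W \<omega>) \<partial>M) = 0"
  proof (rule L2_projection[of ?V Z])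
    show "(\<lambda>\<omega>. f \<omega> + g \<omega>) \<in> ?V" if "f \<in> ?V" "g \<in> ?V" for f g
      using that unfolding wiener_chaos_eq by (intro L2_closure_add chaos_span_square_integrable chaos_span_add)
    show "(\<lambda>\<omega>. c *\<^sub>R f \<omega>) \<in> ?V" if "f \<in> ?V" for f c
      using that unfolding wiener_chaos_eq by (intro L2_closure_scaleR) (auto intro: chaos_span_scale)
    show "L2_closure M ?V \<subseteq> ?V"
      unfolding wiener_chaos_eq by (rule subsetI) (rule L2_closure_idem[OF chaos_span_square_integrable])
  qed (use zero Z wiener_chaos_square_integrable in auto)
  have "\<exists>Y. Y \<in> ?V \<and> (\<forall>W\<in>?V. (\<integral>\<omega>. (Z \<omega> - Y \<omega>) * W \<omega> \<partial>M) = 0)" using Y by auto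
  from someI_ex[OF this] have J: "chaos_proj M X m Z \<in> ?V" "\<And>W. W \<in> ?V \<Longrightarrow> (\<integral>\<omega>. (Z \<omega> - chaos_proj M X m Z \<omega>) * W \<omega> \<partial>M) = 0"
    unfolding chaos_proj_def by blast+
  show "chaos_proj M X m Z \<in> ?V" by (rule J(1))
  show "(\<integral>\<omega>. Z \<omega> * W \<omega> \<partial>M) = (\<integral>\<omega>. chaos_proj M X m Z \<omega> * W \<omega> \<partial>M)" if W: "W \<in> ?V"
    using J(2)[OF W] integrable_mult_sq[OF Z wiener_chaos_square_integrable[OF W]]
      integrable_mult_sq[OF wiener_chaos_square_integrable[OF J(1)] wiener_chaos_square_integrable[OF W]]
    by (simp add: left_diff_distrib)
qed

lemma integral_sum_sum:
  fixes f :: "nat \<Rightarrow> 'a \<Rightarrow> 'c::{real_inner, second_countable_topology}"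
  assumes "\<And>i. i < n \<Longrightarrow> square_integrable M (f i)" "\<And>j. j < l \<Longrightarrow> square_integrable M (g j)"
  shows "(\<integral>\<omega>. inner (\<Sum>i<n. f i \<omega>) (\<Sum>j<l. g j \<omega>) \<partial>M) = (\<Sum>i<n. \<Sum>j<l. \<integral>\<omega>. inner (f i \<omega>) (g j \<omega>) \<partial>M)"
  unfolding inner_sum_left
  unfolding inner_sum_right
proof -
  have i: "integrable M (\<lambda>\<omega>. inner (f i \<omega>) (g j \<omega>))" if "i < n" "j < l" for i j
    by (intro integrable_inner assms that)
  have "integrable M (\<lambda>\<omega>. \<Sum>j<l. inner (f i \<omega>) (g j \<omega>))" if "i \<in> {..<n}" for i
    using that i by (intro Bochner_Integration.integrable_sum) auto
  then have "(\<integral>\<omega>. (\<Sum>i<n. \<Sum>j<l. inner (f i \<omega>) (g j \<omega>)) \<partial>M) = (\<Sum>i<n. \<integral>\<omega>. (\<Sum>j<l. inner (f i \<omega>) (g j \<omega>)) \<partial>M)"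
    by (rule Bochner_Integration.integral_sum)
  also have "(\<Sum>i<n. \<integral>\<omega>. (\<Sum>j<l. inner (f i \<omega>) (g j \<omega>)) \<partial>M) = (\<Sum>i<n. \<Sum>j<l. \<integral>\<omega>. inner (f i \<omega>) (g j \<omega>) \<partial>M)"
    by (intro sum.cong refl Bochner_Integration.integral_sum i) auto
  finally show "(\<integral>\<omega>. (\<Sum>i<n. \<Sum>j<l. inner (f i \<omega>) (g j \<omega>)) \<partial>M) = (\<Sum>i<n. \<Sum>j<l. \<integral>\<omega>. inner (f i \<omega>) (g j \<omega>) \<partial>M)" .
qed

lemma chaos_span_orthogonal:
  assumes S: "S \<in> chaos_span X m" and T: "T \<in> chaos_span X l" and ml: "m \<ge> 1" "l \<ge> 1" "m \<noteq> l"
  shows "(\<integral>\<omega>. S \<omega> * T \<omega> \<partial>M) = 0"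
proof -
  obtain n :: nat and c h where h: "\<And>i. i < n \<Longrightarrow> norm (h i) = 1" "S = (\<lambda>\<omega>. \<Sum>i<n. c i * hermite m (X (h i) \<omega>))"
    by (rule chaos_spanE[OF S ml(1)]) (rule that)
  obtain n' :: nat and d k where k: "\<And>i. i < n' \<Longrightarrow> norm (k i) = 1" "T = (\<lambda>\<omega>. \<Sum>i<n'. d i * hermite l (X (k i) \<omega>))"
    by (rule chaos_spanE[OF T ml(2)]) (rule that)
  have "(\<integral>\<omega>. inner (S \<omega>) (T \<omega>) \<partial>M) = (\<Sum>i<n. \<Sum>j<n'. \<integral>\<omega>. inner (c i * hermite m (X (h i) \<omega>)) (d j * hermite l (X (k j) \<omega>)) \<partial>M)"
    unfolding h(2) k(2) by (intro integral_sum_sum square_integrable_mult hermite_square_integrable)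
  also have "\<dots> = (\<Sum>i<n. \<Sum>j<n'. c i * d j * (\<integral>\<omega>. hermite m (X (h i) \<omega>) * hermite l (X (k j) \<omega>) \<partial>M))"
    by (intro sum.cong refl) (simp add: ac_simps flip: integral_mult_right_zero)
  also have "\<dots> = 0"
    by (intro sum.neutral ballI) (use ml hermite_orthogonal[OF h(1) k(1)] in auto)
  finally show ?thesis by simp
qed

lemma wiener_chaos_orthogonal:
  assumes F: "F \<in> wiener_chaos M X m" and G: "G \<in> wiener_chaos M X l" and ml: "m \<ge> 1" "l \<ge> 1" "m \<noteq> l"
  shows "(\<integral>\<omega>. F \<omega> * G \<omega> \<partial>M) = 0"
proof -
  obtain S where S: "\<And>n. S n \<in> chaos_span X m" "L2_converges M S F"
    using F by (auto simp: wiener_chaos_def)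
  obtain T where T: "\<And>n. T n \<in> chaos_span X l" "L2_converges M T G"
    using G by (auto simp: wiener_chaos_def)
  have "(\<lambda>n. \<integral>\<omega>. inner (S n \<omega>) (T n \<omega>) \<partial>M) \<longlonglongrightarrow> (\<integral>\<omega>. inner (F \<omega>) (G \<omega>) \<partial>M)"
    by (intro L2_converges_inner S T chaos_span_square_integrable[OF S(1)] chaos_span_square_integrable[OF T(1)]
        wiener_chaos_square_integrable[OF F] wiener_chaos_square_integrable[OF G])
  then show ?thesis
    using chaos_span_orthogonal[OF S(1) T(1) ml] by (simp add: LIMSEQ_const_iff)
qed

text \<open>The mean is the inner product with 1, the Hermite polynomial of degree 0.\<close>

lemma wiener_chaos_mean_zero:
  assumes F: "F \<in> wiener_chaos M X m" and m: "m \<ge> 1"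
  shows "(\<integral>\<omega>. F \<omega> \<partial>M) = 0"
proof -
  obtain S where S: "\<And>n. S n \<in> chaos_span X m" "L2_converges M S F"
    using F by (auto simp: wiener_chaos_def)
  have one: "square_integrable M (\<lambda>\<omega>. 1 :: real)" by (simp add: square_integrable_def)
  have "(\<integral>\<omega>. S n \<omega> * 1 \<partial>M) = 0" for n
  proof -
    obtain k :: nat and c h where h: "\<And>i. i < k \<Longrightarrow> norm (h i) = 1" "S n = (\<lambda>\<omega>. \<Sum>i<k. c i * hermite m (X (h i) \<omega>))"
      by (rule chaos_spanE[OF S(1)[of n] m]) (rule that)
    have i: "integrable M (\<lambda>\<omega>. hermite m (X (h i) \<omega>))" for i
      using integrable_mult_sq[OF hermite_square_integrable one] by simp
    have "(\<integral>\<omega>. hermite m (X (h i) \<omega>) \<partial>M) = 0" if "i < k" for i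
      using hermite_orthogonal[OF h(1)[OF that] h(1)[OF that], of m 0] m by simp
    then show ?thesis unfolding h(2) using i by simp
  qed
  moreover have "(\<lambda>n. \<integral>\<omega>. S n \<omega> * 1 \<partial>M) \<longlonglongrightarrow> (\<integral>\<omega>. F \<omega> * 1 \<partial>M)"
    by (intro L2_converges_mult_left chaos_span_square_integrable[OF S(1)] wiener_chaos_square_integrable[OF F] S one)
  ultimately show ?thesis by (simp add: LIMSEQ_const_iff)
qed

lemma hermite_graph_subset: "hermite_graph X m \<subseteq> poly_graph X"
proof
  fix P assume "P \<in> hermite_graph X m"
  then obtain n :: nat and c h where P: "P = (\<lambda>\<omega>. (\<Sum>i<n. c i * hermite m (X (h i) \<omega>),
      \<Sum>i<n. (c i * (real m * hermite (m - 1) (X (h i) \<omega>))) *\<^sub>R h i))"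
    by (auto elim: hermite_graphE)
  show "P \<in> poly_graph X"
    unfolding poly_graph_def P
    by (intro CollectI exI[of _ n] exI[of _ "\<lambda>i. smult (c i) (hermite_poly m)"] exI[of _ h])
      (simp add: pderiv_smult poly_hermite_poly pderiv_hermite_poly)
qed

lemma hermite_graph_square_integrable: "P \<in> hermite_graph X m \<Longrightarrow> square_integrable M P"
  using hermite_graph_subset poly_graph_square_integrable by blast

text \<open>The number operator is multiplication by \<open>m\<close> on the \<open>m\<close>-th chaos.\<close>

lemma hermite_graph_deriv_inner:
  assumes P: "P \<in> hermite_graph X m" and Q: "Q \<in> hermite_graph X l" and m: "m \<ge> 1"
  shows "(\<integral>\<omega>. inner (snd (P \<omega>)) (snd (Q \<omega>)) \<partial>M) = real m * (\<integral>\<omega>. fst (P \<omega>) * fst (Q \<omega>) \<partial>M)"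
proof -
  obtain n :: nat and c h where h: "\<And>i. i < n \<Longrightarrow> norm (h i) = 1" "P = (\<lambda>\<omega>. (\<Sum>i<n. c i * hermite m (X (h i) \<omega>),
      \<Sum>i<n. (c i * (real m * hermite (m - 1) (X (h i) \<omega>))) *\<^sub>R h i))"
    by (rule hermite_graphE[OF P]) (rule that)
  obtain n' :: nat and d k where k: "\<And>i. i < n' \<Longrightarrow> norm (k i) = 1" "Q = (\<lambda>\<omega>. (\<Sum>i<n'. d i * hermite l (X (k i) \<omega>),
      \<Sum>i<n'. (d i * (real l * hermite (l - 1) (X (k i) \<omega>))) *\<^sub>R k i))"
    by (rule hermite_graphE[OF Q]) (rule that)
  have "(\<integral>\<omega>. inner (snd (P \<omega>)) (snd (Q \<omega>)) \<partial>M) = (\<Sum>i<n. \<Sum>j<n'. \<integral>\<omega>.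
      inner ((c i * (real m * hermite (m - 1) (X (h i) \<omega>))) *\<^sub>R h i) ((d j * (real l * hermite (l - 1) (X (k j) \<omega>))) *\<^sub>R k j) \<partial>M)"
    unfolding h(2) k(2) snd_conv
    by (intro integral_sum_sum square_integrable_scaleR_right square_integrable_mult hermite_square_integrable)
  also have "\<dots> = (\<Sum>i<n. \<Sum>j<n'. real m * (\<integral>\<omega>. inner (c i * hermite m (X (h i) \<omega>)) (d j * hermite l (X (k j) \<omega>)) \<partial>M))"
  proof (intro sum.cong refl)
    fix i j assume "i \<in> {..<n}" "j \<in> {..<n'}"
    then have ij: "norm (h i) = 1" "norm (k j) = 1" using h k by auto
    obtain m' where m': "m = Suc m'" using m by (cases m) auto
    have "(\<integral>\<omega>. inner (c i * hermite m (X (h i) \<omega>)) (d j * hermite l (X (k j) \<omega>)) \<partial>M)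
        = c i * d j * (\<integral>\<omega>. hermite (Suc m') (X (h i) \<omega>) * hermite l (X (k j) \<omega>) \<partial>M)"
      unfolding m' by (simp add: ac_simps flip: integral_mult_right_zero)
    \<comment> \<open>Duality trades one degree of the left factor for a derivative of the right
      factor, which is exactly the inner product of the two derivatives without the factor
      m.\<close>
    also have "\<dots> = c i * d j * (\<integral>\<omega>. hermite m' (X (h i) \<omega>) * inner (h i) ((real l * hermite (l - 1) (X (k j) \<omega>)) *\<^sub>R k j) \<partial>M)"
      by (simp only: hermite_duality[OF ij(1) tame_cylindrical_hermite])
    finally show "(\<integral>\<omega>. inner ((c i * (real m * hermite (m - 1) (X (h i) \<omega>))) *\<^sub>R h i) ((d j * (real l * hermite (l - 1) (X (k j) \<omega>))) *\<^sub>R k j) \<partial>M)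
        = real m * (\<integral>\<omega>. inner (c i * hermite m (X (h i) \<omega>)) (d j * hermite l (X (k j) \<omega>)) \<partial>M)"
      by (simp add: m' ac_simps flip: integral_mult_right_zero)
  qed
  also have "\<dots> = real m * (\<Sum>i<n. \<Sum>j<n'. \<integral>\<omega>. inner (c i * hermite m (X (h i) \<omega>)) (d j * hermite l (X (k j) \<omega>)) \<partial>M)"
    by (simp add: sum_distrib_left)
  also have "(\<Sum>i<n. \<Sum>j<n'. \<integral>\<omega>. inner (c i * hermite m (X (h i) \<omega>)) (d j * hermite l (X (k j) \<omega>)) \<partial>M)
      = (\<integral>\<omega>. inner (fst (P \<omega>)) (fst (Q \<omega>)) \<partial>M)"
    unfolding h(2) k(2) fst_conv
    by (intro integral_sum_sum[symmetric] square_integrable_mult hermite_square_integrable)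
  finally show ?thesis by simp
qed

text \<open>Both sides are continuous in mean square. For distinct degrees this makes derivatives of
  different chaoses orthogonal; for equal pairs it gives the mean square of the derivative as m
  times that of the variable.\<close>

lemma hermite_graph_closure_deriv_inner:
  assumes P: "(\<lambda>\<omega>. (F \<omega>, U \<omega>)) \<in> L2_closure M (hermite_graph X m)"
    and Q: "(\<lambda>\<omega>. (G \<omega>, V \<omega>)) \<in> L2_closure M (hermite_graph X l)" and m: "m \<ge> 1"
  shows "(\<integral>\<omega>. inner (U \<omega>) (V \<omega>) \<partial>M) = real m * (\<integral>\<omega>. F \<omega> * G \<omega> \<partial>M)"
proof -
  obtain p where p: "\<And>n. p n \<in> hermite_graph X m" "L2_converges M p (\<lambda>\<omega>. (F \<omega>, U \<omega>))"
    using P by (auto simp: L2_closure_def)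
  obtain q where q: "\<And>n. q n \<in> hermite_graph X l" "L2_converges M q (\<lambda>\<omega>. (G \<omega>, V \<omega>))"
    using Q by (auto simp: L2_closure_def)
  have s: "square_integrable M F" "square_integrable M U" "square_integrable M G" "square_integrable M V"
    using P Q by (auto simp: L2_closure_def square_integrable_Pair_iff)
  have sp: "square_integrable M (\<lambda>\<omega>. fst (p n \<omega>))" "square_integrable M (\<lambda>\<omega>. snd (p n \<omega>))"
    and sq: "square_integrable M (\<lambda>\<omega>. fst (q n \<omega>))" "square_integrable M (\<lambda>\<omega>. snd (q n \<omega>))" for n
    using square_integrable_Pair_iff[of M "\<lambda>\<omega>. fst (p n \<omega>)" "\<lambda>\<omega>. snd (p n \<omega>)"] hermite_graph_square_integrable[OF p(1)]
      square_integrable_Pair_iff[of M "\<lambda>\<omega>. fst (q n \<omega>)" "\<lambda>\<omega>. snd (q n \<omega>)"] hermite_graph_square_integrable[OF q(1)]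
    by auto
  have cp: "L2_converges M (\<lambda>n \<omega>. fst (p n \<omega>)) F" "L2_converges M (\<lambda>n \<omega>. snd (p n \<omega>)) U"
    using L2_converges_Pair_iff[where S = "\<lambda>n \<omega>. fst (p n \<omega>)" and T = "\<lambda>n \<omega>. snd (p n \<omega>)", OF sp s(1,2)] p(2) by auto
  have cq: "L2_converges M (\<lambda>n \<omega>. fst (q n \<omega>)) G" "L2_converges M (\<lambda>n \<omega>. snd (q n \<omega>)) V"
    using L2_converges_Pair_iff[where S = "\<lambda>n \<omega>. fst (q n \<omega>)" and T = "\<lambda>n \<omega>. snd (q n \<omega>)", OF sq s(3,4)] q(2) by auto
  have "(\<lambda>n. \<integral>\<omega>. inner (snd (p n \<omega>)) (snd (q n \<omega>)) \<partial>M) \<longlonglongrightarrow> (\<integral>\<omega>. inner (U \<omega>) (V \<omega>) \<partial>M)"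
    by (intro L2_converges_inner sp sq s cp cq)
  moreover have "(\<lambda>n. \<integral>\<omega>. inner (fst (p n \<omega>)) (fst (q n \<omega>)) \<partial>M) \<longlonglongrightarrow> (\<integral>\<omega>. inner (F \<omega>) (G \<omega>) \<partial>M)"
    by (intro L2_converges_inner sp sq s cp cq)
  then have "(\<lambda>n. \<integral>\<omega>. inner (snd (p n \<omega>)) (snd (q n \<omega>)) \<partial>M) \<longlonglongrightarrow> real m * (\<integral>\<omega>. F \<omega> * G \<omega> \<partial>M)"
    unfolding hermite_graph_deriv_inner[OF p(1) q(1) m] by (intro tendsto_mult tendsto_const) simp
  ultimately show ?thesis by (rule LIMSEQ_unique)
qed

lemma hermite_graph_diff:
  assumes "P \<in> hermite_graph X m" "Q \<in> hermite_graph X m"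
  shows "(\<lambda>\<omega>. P \<omega> - Q \<omega>) \<in> hermite_graph X m"
proof -
  obtain n :: nat and c h where h: "\<And>i. i < n \<Longrightarrow> norm (h i) = 1" "P = (\<lambda>\<omega>. (\<Sum>i<n. c i * hermite m (X (h i) \<omega>),
      \<Sum>i<n. (c i * (real m * hermite (m - 1) (X (h i) \<omega>))) *\<^sub>R h i))"
    by (rule hermite_graphE[OF assms(1)]) (rule that)
  obtain l :: nat and d k where k: "\<And>i. i < l \<Longrightarrow> norm (k i) = 1" "Q = (\<lambda>\<omega>. (\<Sum>i<l. d i * hermite m (X (k i) \<omega>),
      \<Sum>i<l. (d i * (real m * hermite (m - 1) (X (k i) \<omega>))) *\<^sub>R k i))"
    by (rule hermite_graphE[OF assms(2)]) (rule that)
  let ?c = "\<lambda>i. if i < n then c i else - d (i - n)" and ?h = "\<lambda>i. if i < n then h i else k (i - n)"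
  have "(\<lambda>\<omega>. P \<omega> - Q \<omega>) = (\<lambda>\<omega>. (\<Sum>i<n + l. ?c i * hermite m (X (?h i) \<omega>),
      \<Sum>i<n + l. (?c i * (real m * hermite (m - 1) (X (?h i) \<omega>))) *\<^sub>R ?h i))"
  proof
    fix \<omega>
    have "(\<Sum>i<n. (?c i * (real m * hermite (m - 1) (X (?h i) \<omega>))) *\<^sub>R ?h i) = (\<Sum>i<n. (c i * (real m * hermite (m - 1) (X (h i) \<omega>))) *\<^sub>R h i)"
      "(\<Sum>i<n. ?c i * hermite m (X (?h i) \<omega>)) = (\<Sum>i<n. c i * hermite m (X (h i) \<omega>))"
      by (rule sum.cong; simp)+
    then show "P \<omega> - Q \<omega> = (\<Sum>i<n + l. ?c i * hermite m (X (?h i) \<omega>),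
      \<Sum>i<n + l. (?c i * (real m * hermite (m - 1) (X (?h i) \<omega>))) *\<^sub>R ?h i)"
      unfolding sum_lessThan_plus h(2) k(2) by (simp add: sum_negf)
  qed
  moreover have "\<forall>i<n + l. norm (?h i) = 1" using h(1) k(1) by auto
  ultimately show ?thesis
    unfolding hermite_graph_def by (intro CollectI exI[of _ "n + l"] exI[of _ ?c] exI[of _ ?h]) simp
qed

text \<open>On the span of the chaos the mean square of the derivative is m times that of the
  variable. Derivatives of a convergent sequence are therefore Cauchy, and every element of the
  chaos is differentiable.\<close>

lemma wiener_chaos_graph:
  assumes F: "F \<in> wiener_chaos M X m" and m: "m \<ge> 1"
  obtains U where "(\<lambda>\<omega>. (F \<omega>, U \<omega>)) \<in> L2_closure M (hermite_graph X m)"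
proof -
  have F2: "square_integrable M F" by (rule wiener_chaos_square_integrable[OF F])
  obtain S where S: "\<And>n. S n \<in> chaos_span X m" "L2_converges M S F"
    using F by (auto simp: wiener_chaos_def)
  have "\<forall>n. \<exists>D. (\<lambda>\<omega>. (S n \<omega>, D \<omega>)) \<in> hermite_graph X m"
  proof
    fix n
    obtain k :: nat and c h where h: "\<And>i. i < k \<Longrightarrow> norm (h i) = 1" "S n = (\<lambda>\<omega>. \<Sum>i<k. c i * hermite m (X (h i) \<omega>))"
      by (rule chaos_spanE[OF S(1)[of n] m]) (rule that)
    then show "\<exists>D. (\<lambda>\<omega>. (S n \<omega>, D \<omega>)) \<in> hermite_graph X m"
      unfolding hermite_graph_def
      by (intro exI[of _ "\<lambda>\<omega>. \<Sum>i<k. (c i * (real m * hermite (m - 1) (X (h i) \<omega>))) *\<^sub>R h i"] CollectI exI[of _ k] exI[of _ c] exI[of _ h]) simp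
  qed
  then obtain D where D: "\<And>n. (\<lambda>\<omega>. (S n \<omega>, D n \<omega>)) \<in> hermite_graph X m" by metis
  have s: "square_integrable M (S n)" "square_integrable M (D n)" for n
    using hermite_graph_square_integrable[OF D[of n]] by (auto simp: square_integrable_Pair_iff)
  have eq: "msq M (\<lambda>\<omega>. D n \<omega> - D k \<omega>) = real m * msq M (\<lambda>\<omega>. S n \<omega> - S k \<omega>)" for n k
    using hermite_graph_deriv_inner[OF hermite_graph_diff[OF D[of n] D[of k]] hermite_graph_diff[OF D[of n] D[of k]] m]
    by (simp add: msq_eq_inner)
  obtain U where U: "square_integrable M U" "L2_converges M D U"
  proof (rule L2_complete[of D])
    fix e :: real assume e: "e > 0"
    have "(\<lambda>n. msq M (\<lambda>\<omega>. S n \<omega> - F \<omega>)) \<longlonglongrightarrow> 0" using S(2) by (simp add: L2_converges_msq)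
    \<comment> \<open>The 4 pays for the triangle inequality of mean squares, the \<open>m\<close>
      for passing from variables to derivatives.\<close>
    then have "\<forall>\<^sub>F n in sequentially. msq M (\<lambda>\<omega>. S n \<omega> - F \<omega>) < e / (4 * real m)"
      using e m by (intro order_tendstoD) auto
    then obtain N where N: "\<And>n. n \<ge> N \<Longrightarrow> msq M (\<lambda>\<omega>. S n \<omega> - F \<omega>) < e / (4 * real m)"
      by (auto simp: eventually_sequentially)
    have "msq M (\<lambda>\<omega>. D n \<omega> - D k \<omega>) < e" if "n \<ge> N" "k \<ge> N" for n k
    proof -
      have "msq M (\<lambda>\<omega>. S n \<omega> - S k \<omega>) < e / real m"
        using msq_diff_le[OF s(1)[of n] F2 s(1)[of k]] N[OF that(1)] N[OF that(2)]
        by (simp add: msq_minus_commute[of M F])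
      then show ?thesis using m unfolding eq by (simp add: field_simps)
    qed
    then show "\<exists>N. \<forall>n\<ge>N. \<forall>k\<ge>N. msq M (\<lambda>\<omega>. D n \<omega> - D k \<omega>) < e" by blast
  qed (rule s)
  have "L2_converges M (\<lambda>n \<omega>. (S n \<omega>, D n \<omega>)) (\<lambda>\<omega>. (F \<omega>, U \<omega>))"
    using L2_converges_Pair_iff[where S = S and T = D, OF s F2 U(1)] S(2) U(2) by blast
  then have "(\<lambda>\<omega>. (F \<omega>, U \<omega>)) \<in> L2_closure M (hermite_graph X m)"
    unfolding L2_closure_def using D F2 U(1)
    by (auto simp: square_integrable_Pair_iff intro!: exI[of _ "\<lambda>n \<omega>. (S n \<omega>, D n \<omega>)"])
  then show thesis by (rule that)
qed

section \<open>Chaos projections and the inverse generator in the domain of the derivative\<close>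

lemma chaos_proj_bessel:
  assumes Z: "square_integrable M Z"
  shows "(\<Sum>m=1..N. msq M (chaos_proj M X m Z)) \<le> msq M Z"
proof -
  let ?J = "\<lambda>m. chaos_proj M X m Z"
  note J = chaos_proj_in_chaos[OF Z]
  have s: "square_integrable M (?J m)" for m by (rule wiener_chaos_square_integrable[OF J(1)])
  have sT: "square_integrable M (\<lambda>\<omega>. \<Sum>m=1..N. ?J m \<omega>)" by (intro square_integrable_sum s)
  have T: "msq M (\<lambda>\<omega>. \<Sum>m=1..N. ?J m \<omega>) = (\<Sum>m=1..N. msq M (?J m))"
    by (rule msq_sum_orthogonal) (auto intro!: s wiener_chaos_orthogonal[OF J(1) J(1)])
  have "(\<integral>\<omega>. Z \<omega> * (\<Sum>m=1..N. ?J m \<omega>) \<partial>M) = (\<Sum>m=1..N. \<integral>\<omega>. Z \<omega> * ?J m \<omega> \<partial>M)"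
    unfolding sum_distrib_left by (intro Bochner_Integration.integral_sum integrable_mult_sq Z s)
  also have "\<dots> = (\<Sum>m=1..N. msq M (?J m))"
    by (intro sum.cong refl) (simp add: J(2)[OF J(1)] msq_eq_inner)
  finally have "msq M (\<lambda>\<omega>. Z \<omega> - (\<Sum>m=1..N. ?J m \<omega>)) = msq M Z - (\<Sum>m=1..N. msq M (?J m))"
    unfolding msq_diff[OF Z sT] T by simp
  then show ?thesis using msq_nonneg[of M "\<lambda>\<omega>. Z \<omega> - (\<Sum>m=1..N. ?J m \<omega>)"] by linarith
qed

lemma chaos_proj_summable:
  assumes Z: "square_integrable M Z"
  shows "summable (\<lambda>m. msq M (chaos_proj M X m Z))"
proof (rule summableI_nonneg_bounded)
  fix n
  \<comment> \<open>The term m = 0 is split off, since Bessel's inequality is stated from m = 1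
    on.\<close>
  have "(\<Sum>m<n. msq M (chaos_proj M X m Z)) \<le> (\<Sum>m\<in>insert 0 {1..n}. msq M (chaos_proj M X m Z))"
    by (rule sum_mono2) auto
  also have "\<dots> = msq M (chaos_proj M X 0 Z) + (\<Sum>m=1..n. msq M (chaos_proj M X m Z))" by simp
  also have "\<dots> \<le> msq M (chaos_proj M X 0 Z) + msq M Z" using chaos_proj_bessel[OF Z] by simp
  finally show "(\<Sum>m<n. msq M (chaos_proj M X m Z)) \<le> msq M (chaos_proj M X 0 Z) + msq M Z" .
qed simp

text \<open>The series is summed for pairs of a projection and its derivative. Term m has mean
  square (1 + m) / m^2 times that of the projection, so the weight 1/m more than compensates the
  growth of the derivative. Convergence of the first component also shows that the choice in
  \<open>L_inv\<close> is not empty.\<close>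

lemma L_inv_converges_in_D12:
  assumes Z: "square_integrable M Z"
  shows "square_integrable M (L_inv M X Z)"
    and "L2_converges M (\<lambda>N \<omega>. \<Sum>m=1..N. - (1 / real m) * chaos_proj M X m Z \<omega>) (L_inv M X Z)"
    and "L_inv M X Z \<in> D12 M X"
proof -
  let ?J = "\<lambda>m. chaos_proj M X m Z"
  note J = chaos_proj_in_chaos[OF Z]
  have "\<forall>m. \<exists>U. m \<ge> 1 \<longrightarrow> (\<lambda>\<omega>. (?J m \<omega>, U \<omega>)) \<in> L2_closure M (hermite_graph X m)"
    using wiener_chaos_graph[OF J(1)] by metis
  then obtain U where U: "\<And>m. m \<ge> 1 \<Longrightarrow> (\<lambda>\<omega>. (?J m \<omega>, U m \<omega>)) \<in> L2_closure M (hermite_graph X m)" by metis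
  have s: "square_integrable M (?J m)" "square_integrable M (U m)" if "m \<ge> 1" for m
    using U[OF that] by (auto simp: L2_closure_def square_integrable_Pair_iff)
  define P where "P m \<omega> = (- (1 / real m)) *\<^sub>R (?J m \<omega>, U m \<omega>)" for m \<omega>
  have sP: "square_integrable M (P m)" if "m \<ge> 1" for m
    unfolding P_def using s[OF that] by (intro square_integrable_scaleR) (simp add: square_integrable_Pair_iff)
  obtain F where F: "square_integrable M F" "L2_converges M (\<lambda>N \<omega>. \<Sum>m=1..N. P m \<omega>) F"
  proof (rule orthogonal_series_converges[of P, OF sP])
    fix m l :: nat assume ml: "m \<ge> 1" "l \<ge> 1" "m \<noteq> l"
    have "(\<integral>\<omega>. ?J m \<omega> * ?J l \<omega> \<partial>M) = 0" by (rule wiener_chaos_orthogonal[OF J(1) J(1) ml])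
    moreover have "(\<integral>\<omega>. inner (U m \<omega>) (U l \<omega>) \<partial>M) = 0"
      unfolding hermite_graph_closure_deriv_inner[OF U[OF ml(1)] U[OF ml(2)] ml(1)] using calculation by simp
    moreover have "(\<integral>\<omega>. inner (P m \<omega>) (P l \<omega>) \<partial>M) = 1 / real m * (1 / real l) * (\<integral>\<omega>. ?J m \<omega> * ?J l \<omega> + inner (U m \<omega>) (U l \<omega>) \<partial>M)"
      unfolding P_def inner_scaleR_left inner_scaleR_right inner_Pair integral_mult_right_zero by simp
    ultimately show "(\<integral>\<omega>. inner (P m \<omega>) (P l \<omega>) \<partial>M) = 0"
      using integrable_mult_sq[OF s(1)[OF ml(1)] s(1)[OF ml(2)]] integrable_inner[OF s(2)[OF ml(1)] s(2)[OF ml(2)]] by simp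
  next
    show "summable (\<lambda>m. msq M (P m))"
    proof (rule summable_comparison_test')
      show "summable (\<lambda>m. 2 * msq M (?J m))" by (intro summable_mult chaos_proj_summable[OF Z])
      fix m :: nat assume m: "m \<ge> 1"
      have "msq M (U m) = real m * msq M (?J m)"
        using hermite_graph_closure_deriv_inner[OF U[OF m] U[OF m] m] by (simp add: msq_eq_inner)
      then have "msq M (P m) = (1 / real m)\<^sup>2 * (1 + real m) * msq M (?J m)"
        unfolding P_def msq_scaleR msq_Pair[OF s[OF m]] by (simp add: algebra_simps)
      moreover have "(1 / real m)\<^sup>2 * (1 + real m) \<le> 2"
      proof -
        have "1 * real m \<le> real m * real m" using m by (intro mult_right_mono) auto
        then have "1 + real m \<le> 2 * (real m)\<^sup>2" using m unfolding power2_eq_square by linarith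
        then show ?thesis using m by (simp add: field_simps power2_eq_square)
      qed
      ultimately show "norm (msq M (P m)) \<le> 2 * msq M (?J m)" by (simp add: mult_right_mono)
    qed
  qed
  define sJ where "sJ N \<omega> = (\<Sum>m=1..N. - (1 / real m) * ?J m \<omega>)" for N \<omega>
  define sU where "sU N \<omega> = (\<Sum>m=1..N. (- (1 / real m)) *\<^sub>R U m \<omega>)" for N \<omega>
  have ssJ: "square_integrable M (sJ N)" for N
    unfolding sJ_def by (intro square_integrable_sum square_integrable_mult s) auto
  have ssU: "square_integrable M (sU N)" for N
    unfolding sU_def by (intro square_integrable_sum square_integrable_scaleR s) auto
  have sP_eq: "(\<Sum>m=1..N. P m \<omega>) = (sJ N \<omega>, sU N \<omega>)" for N \<omega>
    unfolding P_def sJ_def sU_def by (induction N) (auto simp: zero_prod_def)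
  have sF: "square_integrable M (\<lambda>\<omega>. fst (F \<omega>))" "square_integrable M (\<lambda>\<omega>. snd (F \<omega>))"
    using F(1) square_integrable_Pair_iff[of M "\<lambda>\<omega>. fst (F \<omega>)" "\<lambda>\<omega>. snd (F \<omega>)"] by auto
  have conv: "L2_converges M sJ (\<lambda>\<omega>. fst (F \<omega>))" "L2_converges M sU (\<lambda>\<omega>. snd (F \<omega>))"
    using L2_converges_Pair_iff[where S = sJ and T = sU, OF ssJ ssU sF] F(2) unfolding sP_eq by auto
  have "\<exists>Y. square_integrable M Y \<and> L2_converges M sJ Y" using sF conv by blast
  from someI_ex[OF this] have L: "square_integrable M (L_inv M X Z)" "L2_converges M sJ (L_inv M X Z)"
    unfolding L_inv_def sJ_def by auto
  show "square_integrable M (L_inv M X Z)" by (rule L(1))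
  show "L2_converges M (\<lambda>N \<omega>. \<Sum>m=1..N. - (1 / real m) * chaos_proj M X m Z \<omega>) (L_inv M X Z)"
    using L(2) by (simp add: sJ_def[abs_def])
  have mem: "(\<lambda>\<omega>. \<Sum>m=1..N. P m \<omega>) \<in> L2_closure M (poly_graph X)" for N
  proof (induction N)
    case 0
    have "(\<lambda>\<omega>. 0) \<in> poly_graph X" unfolding poly_graph_def by (intro CollectI exI[of _ 0]) (simp add: fun_eq_iff prod_eq_iff)
    then show ?case by (simp add: L2_closure_incl)
  next
    case (Suc N)
    have "(\<lambda>\<omega>. (?J (Suc N) \<omega>, U (Suc N) \<omega>)) \<in> L2_closure M (poly_graph X)"
      using U[of "Suc N"] hermite_graph_subset[of "Suc N"] by (auto simp: L2_closure_def)
    then have "P (Suc N) \<in> L2_closure M (poly_graph X)"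
      unfolding P_def[abs_def] by (intro L2_closure_scaleR poly_graph_scaleR)
    with Suc have "(\<lambda>\<omega>. (\<Sum>m=1..N. P m \<omega>) + P (Suc N) \<omega>) \<in> L2_closure M (poly_graph X)"
      by (intro L2_closure_add poly_graph_square_integrable poly_graph_add)
    moreover have "(\<lambda>\<omega>. \<Sum>m=1..Suc N. P m \<omega>) = (\<lambda>\<omega>. (\<Sum>m=1..N. P m \<omega>) + P (Suc N) \<omega>)" by simp
    ultimately show ?case by (simp only:)
  qed
  \<comment> \<open>\<open>L_inv\<close> is a chosen mean-square limit of the first components and
    need not be the function \<open>fst F\<close>, so it is paired anew with the limit of the
    derivatives.\<close>
  have "L2_converges M (\<lambda>N \<omega>. \<Sum>m=1..N. P m \<omega>) (\<lambda>\<omega>. (L_inv M X Z \<omega>, snd (F \<omega>)))"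
    unfolding sP_eq using L2_converges_Pair_iff[where S = sJ and T = sU, OF ssJ ssU L(1) sF(2)] L(2) conv(2) by blast
  then have "(\<lambda>\<omega>. (L_inv M X Z \<omega>, snd (F \<omega>))) \<in> L2_closure M (L2_closure M (poly_graph X))"
    unfolding L2_closure_def[of M "L2_closure M (poly_graph X)"] using mem L(1) sF(2)
    by (auto simp: square_integrable_Pair_iff intro!: exI[of _ "\<lambda>N \<omega>. \<Sum>m=1..N. P m \<omega>"])
  then have "(\<lambda>\<omega>. (L_inv M X Z \<omega>, snd (F \<omega>))) \<in> L2_closure M (malliavin_graph X)"
    using L2_closure_idem[OF poly_graph_square_integrable] poly_graph_closure by blast
  then show "L_inv M X Z \<in> D12 M X"
    unfolding D12_def has_malliavin_deriv_iff_closure by (intro CollectI exI[of _ "\<lambda>\<omega>. snd (F \<omega>)"])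
qed

end

section \<open>Chaos decomposition and integration by parts\<close>

lemma abs_power_sum_le_exp: "(\<Sum>n<N. \<bar>x\<bar> ^ n / fact n) \<le> exp \<bar>x\<bar>" for x :: real
proof -
  have "(\<Sum>n<N. inverse (fact n) *\<^sub>R \<bar>x\<bar> ^ n) \<le> (\<Sum>n. inverse (fact n) *\<^sub>R \<bar>x\<bar> ^ n)"
    by (rule sum_le_suminf[OF summable_exp_generic]) auto
  then show ?thesis by (simp add: exp_def divide_inverse mult.commute)
qed

context isonormal_gaussian_process
begin

text \<open>The recurrence, read as x times degree k equals degree k + 1 plus k times degree k - 1,
  removes one power of x at a time. The induction therefore covers products of powers with all
  Hermite polynomials.\<close>

lemma orthogonal_hermite_imp_powers:
  assumes R: "square_integrable M R"
    and orth: "\<And>m. (\<integral>\<omega>. R \<omega> * hermite m (X u \<omega>) \<partial>M) = 0"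
  shows "(\<integral>\<omega>. R \<omega> * X u \<omega> ^ m \<partial>M) = 0"
proof -
  have sq: "square_integrable M (\<lambda>\<omega>. X u \<omega> ^ m * hermite k (X u \<omega>))" for m k
    using poly_square_integrable[of "monom 1 m * hermite_poly k" u] by (simp add: poly_monom poly_hermite_poly)
  have "(\<integral>\<omega>. R \<omega> * (X u \<omega> ^ m * hermite k (X u \<omega>)) \<partial>M) = 0" for k
  proof (induction m arbitrary: k)
    case 0
    then show ?case using orth by simp
  next
    case (Suc m)
    have "(\<lambda>\<omega>. R \<omega> * (X u \<omega> ^ Suc m * hermite k (X u \<omega>)))
        = (\<lambda>\<omega>. R \<omega> * (X u \<omega> ^ m * hermite (Suc k) (X u \<omega>)) + real k * (R \<omega> * (X u \<omega> ^ m * hermite (k - 1) (X u \<omega>))))"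
      unfolding hermite_Suc by (simp add: fun_eq_iff algebra_simps)
    then show ?case
      using integrable_mult_sq[OF R sq[of m "Suc k"]] integrable_mult_sq[OF R sq[of m "k - 1"]] Suc[of "Suc k"] Suc[of "k - 1"]
      by simp
  qed
  from this[of 0] show ?thesis by simp
qed

text \<open>With coefficients at most 1 / n!, the partial sums are dominated by exp |s X u|, which
  is square integrable. The formulation covers sine and cosine at once.\<close>

lemma orthogonal_powers_imp_series:
  assumes R: "square_integrable M R" and orth: "\<And>m. (\<integral>\<omega>. R \<omega> * X u \<omega> ^ m \<partial>M) = 0"
    and a: "\<And>n. \<bar>a n\<bar> \<le> 1 / fact n" and f: "\<And>x. (\<lambda>n. a n * x ^ n) sums f x"
  shows "(\<integral>\<omega>. R \<omega> * f (s * X u \<omega>) \<partial>M) = 0"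
proof -
  let ?p = "\<lambda>N \<omega>. \<Sum>n<N. a n * (s * X u \<omega>) ^ n"
  have [measurable]: "R \<in> borel_measurable M" using R by auto
  have flim: "(\<lambda>N. \<Sum>n<N. a n * x ^ n) \<longlonglongrightarrow> f x" for x using f by (simp add: sums_def)
  have "f \<in> borel_measurable borel"
    by (rule borel_measurable_LIMSEQ_real[OF flim]) simp
  note [measurable] = this
  have iP: "integrable M (\<lambda>\<omega>. R \<omega> * X u \<omega> ^ n)" for n
    using integrable_mult_sq[OF R poly_square_integrable[of "monom 1 n" u]] by (simp add: poly_monom)
  have zero: "(\<integral>\<omega>. R \<omega> * ?p N \<omega> \<partial>M) = 0" for N
  proof -
    have "(\<lambda>\<omega>. R \<omega> * ?p N \<omega>) = (\<lambda>\<omega>. \<Sum>n<N. (a n * s ^ n) * (R \<omega> * X u \<omega> ^ n))"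
      by (simp add: fun_eq_iff sum_distrib_left power_mult_distrib ac_simps)
    then show ?thesis using iP orth by simp
  qed
  have "(\<lambda>N. \<integral>\<omega>. R \<omega> * ?p N \<omega> \<partial>M) \<longlonglongrightarrow> (\<integral>\<omega>. R \<omega> * f (s * X u \<omega>) \<partial>M)"
  proof (rule integral_dominated_convergence[where w = "\<lambda>\<omega>. \<bar>R \<omega>\<bar> * exp (\<bar>s\<bar> * \<bar>X u \<omega>\<bar>)"])
    have "square_integrable M (\<lambda>\<omega>. exp (\<bar>s\<bar> * \<bar>X u \<omega>\<bar>))"
      using X_exp_integrable[of "2 * \<bar>s\<bar>" u] by (simp add: square_integrable_def mult.assoc flip: exp_double)
    from integrable_mult_sq[OF R this] show "integrable M (\<lambda>\<omega>. \<bar>R \<omega>\<bar> * exp (\<bar>s\<bar> * \<bar>X u \<omega>\<bar>))"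
      using integrable_abs[of M "\<lambda>\<omega>. R \<omega> * exp (\<bar>s\<bar> * \<bar>X u \<omega>\<bar>)"] by (simp add: abs_mult)
    show "AE \<omega> in M. (\<lambda>N. R \<omega> * ?p N \<omega>) \<longlonglongrightarrow> R \<omega> * f (s * X u \<omega>)"
      by (intro AE_I2 tendsto_mult tendsto_const flim)
    show "AE \<omega> in M. norm (R \<omega> * ?p N \<omega>) \<le> \<bar>R \<omega>\<bar> * exp (\<bar>s\<bar> * \<bar>X u \<omega>\<bar>)" for N
    proof (rule AE_I2)
      fix \<omega>
      have "\<bar>?p N \<omega>\<bar> \<le> (\<Sum>n<N. \<bar>s * X u \<omega>\<bar> ^ n / fact n)"
      proof (rule order_trans[OF sum_abs], rule sum_mono)
        fix n
        show "\<bar>a n * (s * X u \<omega>) ^ n\<bar> \<le> \<bar>s * X u \<omega>\<bar> ^ n / fact n"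
          using mult_right_mono[OF a[of n], of "\<bar>s * X u \<omega>\<bar> ^ n"] by (simp add: abs_mult power_abs)
      qed
      also have "\<dots> \<le> exp \<bar>s * X u \<omega>\<bar>" by (rule abs_power_sum_le_exp)
      finally show "norm (R \<omega> * ?p N \<omega>) \<le> \<bar>R \<omega>\<bar> * exp (\<bar>s\<bar> * \<bar>X u \<omega>\<bar>)"
        by (simp add: abs_mult mult_left_mono)
    qed
  qed measurable
  then show ?thesis using zero by (simp add: LIMSEQ_const_iff)
qed

text \<open>Orthogonality passes from Hermite polynomials to powers, from there to cos and sin of
  multiples of X(u), and by linearity of the process to all finite linear combinations; the
  uniqueness theorem for characteristic functions concludes. The condition on the mean stands for
  degree 0, also in the trivial space, which has no unit vector.\<close>

theorem hermite_orthogonal_AE_zero: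
  assumes R: "square_integrable M R" and mean: "(\<integral>\<omega>. R \<omega> \<partial>M) = 0"
    and orth: "\<And>m u. m \<ge> 1 \<Longrightarrow> norm u = 1 \<Longrightarrow> (\<integral>\<omega>. R \<omega> * hermite m (X u \<omega>) \<partial>M) = 0"
  shows "AE \<omega> in M. R \<omega> = 0"
proof (rule trig_orthogonal_AE_zero[OF X_measurable _ generated])
  have [measurable]: "R \<in> borel_measurable M" using R by auto
  have one: "square_integrable M (\<lambda>\<omega>. 1 :: real)" by (simp add: square_integrable_def)
  have orth': "(\<integral>\<omega>. R \<omega> * hermite m (X u \<omega>) \<partial>M) = 0" if "norm u = 1" for m u
    using mean orth[OF _ that, of m] by (cases m) auto
  have trig: "(\<integral>\<omega>. R \<omega> * cos (s * X u \<omega>) \<partial>M) = 0 \<and> (\<integral>\<omega>. R \<omega> * sin (s * X u \<omega>) \<partial>M) = 0" if u: "norm u = 1" for u s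
  proof
    note p = orthogonal_hermite_imp_powers[OF R orth'[OF u]]
    show "(\<integral>\<omega>. R \<omega> * cos (s * X u \<omega>) \<partial>M) = 0"
    proof (rule orthogonal_powers_imp_series[OF R p])
      show "\<bar>cos_coeff n\<bar> \<le> 1 / fact n" for n by (auto simp: cos_coeff_def abs_mult power_abs)
      show "(\<lambda>n. cos_coeff n * x ^ n) sums cos x" for x using cos_converges[of x] by simp
    qed
    show "(\<integral>\<omega>. R \<omega> * sin (s * X u \<omega>) \<partial>M) = 0"
    proof (rule orthogonal_powers_imp_series[OF R p])
      show "\<bar>sin_coeff n\<bar> \<le> 1 / fact n" for n by (auto simp: sin_coeff_def abs_mult power_abs)
      show "(\<lambda>n. sin_coeff n * x ^ n) sums sin x" for x using sin_converges[of x] by simp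
    qed
  qed
  have trig': "(\<integral>\<omega>. R \<omega> * cos (X k \<omega>) \<partial>M) = 0 \<and> (\<integral>\<omega>. R \<omega> * sin (X k \<omega>) \<partial>M) = 0" for k
  proof (cases "k = 0")
    case True
    then have ae: "AE \<omega> in M. X k \<omega> = 0" using X_scale[of 0 0] by simp
    have "(\<integral>\<omega>. R \<omega> * cos (X k \<omega>) \<partial>M) = (\<integral>\<omega>. R \<omega> \<partial>M)" "(\<integral>\<omega>. R \<omega> * sin (X k \<omega>) \<partial>M) = (\<integral>\<omega>. 0 \<partial>M)"
      by (rule integral_cong_AE; use ae in auto)+
    then show ?thesis using mean by simp
  next
    case False
    define u where "u = (1 / norm k) *\<^sub>R k"
    have u: "norm u = 1" "k = norm k *\<^sub>R u" using False by (simp_all add: u_def)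
    have ae: "AE \<omega> in M. X k \<omega> = norm k * X u \<omega>" using X_scale[of "norm k" u] u(2) by simp
    have "(\<integral>\<omega>. R \<omega> * cos (X k \<omega>) \<partial>M) = (\<integral>\<omega>. R \<omega> * cos (norm k * X u \<omega>) \<partial>M)"
      "(\<integral>\<omega>. R \<omega> * sin (X k \<omega>) \<partial>M) = (\<integral>\<omega>. R \<omega> * sin (norm k * X u \<omega>) \<partial>M)"
      by (rule integral_cong_AE; use ae in auto)+
    then show ?thesis using trig[OF u(1), of "norm k"] by simp
  qed
  show "trig_orthogonal M X R"
  proof (rule trig_orthogonalI)
    show "integrable M R" using integrable_mult_sq[OF R one] by simp
    fix n :: nat and c and i :: "nat \<Rightarrow> 'h"
    let ?k = "\<Sum>j<n. c j *\<^sub>R i j"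
    have ae: "AE \<omega> in M. (\<Sum>j<n. c j * X (i j) \<omega>) = X ?k \<omega>" by (rule X_linear)
    have "(\<integral>\<omega>. R \<omega> * cos (\<Sum>j<n. c j * X (i j) \<omega>) \<partial>M) = (\<integral>\<omega>. R \<omega> * cos (X ?k \<omega>) \<partial>M)"
      "(\<integral>\<omega>. R \<omega> * sin (\<Sum>j<n. c j * X (i j) \<omega>) \<partial>M) = (\<integral>\<omega>. R \<omega> * sin (X ?k \<omega>) \<partial>M)"
      by (rule integral_cong_AE; use ae in auto)+
    then show "(\<integral>\<omega>. R \<omega> * cos (\<Sum>j<n. c j * X (i j) \<omega>) \<partial>M) = 0" "(\<integral>\<omega>. R \<omega> * sin (\<Sum>j<n. c j * X (i j) \<omega>) \<partial>M) = 0"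
      using trig'[of ?k] by simp_all
  qed
qed

text \<open>Let T be the sum of the projections. Then Z - T has mean 0 and is orthogonal to all
  Hermite variables, hence vanishes almost surely. The expansion is stated against a test function
  G, the form in which the duality below uses it.\<close>

theorem chaos_decomposition:
  assumes Z: "square_integrable M Z" and mean: "(\<integral>\<omega>. Z \<omega> \<partial>M) = 0" and G: "square_integrable M G"
  shows "(\<lambda>N. \<Sum>m=1..N. \<integral>\<omega>. chaos_proj M X m Z \<omega> * G \<omega> \<partial>M) \<longlonglongrightarrow> (\<integral>\<omega>. Z \<omega> * G \<omega> \<partial>M)"
proof -
  let ?J = "\<lambda>m. chaos_proj M X m Z"
  note J = chaos_proj_in_chaos[OF Z]
  have s: "square_integrable M (?J m)" for m by (rule wiener_chaos_square_integrable[OF J(1)])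
  have sT: "square_integrable M (\<lambda>\<omega>. \<Sum>m=1..N. ?J m \<omega>)" for N by (intro square_integrable_sum s)
  obtain T where T: "square_integrable M T" "L2_converges M (\<lambda>N \<omega>. \<Sum>m=1..N. ?J m \<omega>) T"
    using orthogonal_series_converges[of ?J, OF s _ chaos_proj_summable[OF Z]]
      wiener_chaos_orthogonal[OF J(1) J(1)] by auto
  have lim: "(\<lambda>N. \<Sum>m=1..N. \<integral>\<omega>. ?J m \<omega> * G \<omega> \<partial>M) \<longlonglongrightarrow> (\<integral>\<omega>. T \<omega> * G \<omega> \<partial>M)"
    if G: "square_integrable M G" for G
  proof -
    have "(\<integral>\<omega>. (\<Sum>m=1..N. ?J m \<omega>) * G \<omega> \<partial>M) = (\<Sum>m=1..N. \<integral>\<omega>. ?J m \<omega> * G \<omega> \<partial>M)" for N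
      unfolding sum_distrib_right by (intro Bochner_Integration.integral_sum integrable_mult_sq s G)
    then show ?thesis using L2_converges_mult_left[OF sT T G] by simp
  qed
  have one: "square_integrable M (\<lambda>\<omega>. 1 :: real)" by (simp add: square_integrable_def)
  have "AE \<omega> in M. Z \<omega> - T \<omega> = 0"
  proof (rule hermite_orthogonal_AE_zero)
    show "square_integrable M (\<lambda>\<omega>. Z \<omega> - T \<omega>)" by (intro square_integrable_diff Z T)
    have "(\<lambda>N. \<Sum>m=1..N. \<integral>\<omega>. ?J m \<omega> * 1 \<partial>M) = (\<lambda>N. 0)"
      using wiener_chaos_mean_zero[OF J(1)] by (auto simp: fun_eq_iff intro!: sum.neutral)
    then have "(\<integral>\<omega>. T \<omega> \<partial>M) = 0" using lim[OF one] by (simp add: LIMSEQ_const_iff)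
    then show "(\<integral>\<omega>. Z \<omega> - T \<omega> \<partial>M) = 0"
      using mean integrable_mult_sq[OF Z one] integrable_mult_sq[OF T(1) one] by simp
    fix l :: nat and u :: 'h assume l: "l \<ge> 1" and u: "norm u = 1"
    define W where "W \<omega> = hermite l (X u \<omega>)" for \<omega>
    have W: "W \<in> wiener_chaos M X l"
      unfolding wiener_chaos_eq W_def
      by (intro L2_closure_incl hermite_in_chaos_span u hermite_square_integrable)
    have Ws: "square_integrable M W" by (rule wiener_chaos_square_integrable[OF W])
    \<comment> \<open>Against an element of the chaos of degree \<open>l\<close> only the term m = l
      survives, so the partial sums are constant from \<open>l\<close> on.\<close>
    have "(\<Sum>m=1..N. \<integral>\<omega>. ?J m \<omega> * W \<omega> \<partial>M) = (\<integral>\<omega>. Z \<omega> * W \<omega> \<partial>M)" if "N \<ge> l" for N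
    proof -
      have "(\<Sum>m=1..N. \<integral>\<omega>. ?J m \<omega> * W \<omega> \<partial>M) = (\<Sum>m\<in>{l}. \<integral>\<omega>. ?J m \<omega> * W \<omega> \<partial>M)"
        using that l by (intro sum.mono_neutral_right) (auto intro: wiener_chaos_orthogonal[OF J(1) W])
      then show ?thesis by (simp add: J(2)[OF W])
    qed
    then have "\<forall>\<^sub>F N in sequentially. (\<integral>\<omega>. Z \<omega> * W \<omega> \<partial>M) = (\<Sum>m=1..N. \<integral>\<omega>. ?J m \<omega> * W \<omega> \<partial>M)"
      by (auto simp: eventually_sequentially intro!: exI[of _ l])
    then have "(\<lambda>N. \<Sum>m=1..N. \<integral>\<omega>. ?J m \<omega> * W \<omega> \<partial>M) \<longlonglongrightarrow> (\<integral>\<omega>. Z \<omega> * W \<omega> \<partial>M)"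
      by (rule Lim_transform_eventually[OF tendsto_const])
    then have "(\<integral>\<omega>. Z \<omega> * W \<omega> \<partial>M) = (\<integral>\<omega>. T \<omega> * W \<omega> \<partial>M)" using lim[OF Ws] LIMSEQ_unique by blast
    then show "(\<integral>\<omega>. (Z \<omega> - T \<omega>) * hermite l (X u \<omega>) \<partial>M) = 0"
      using integrable_mult_sq[OF Z Ws] integrable_mult_sq[OF T(1) Ws] by (simp add: left_diff_distrib W_def)
  qed
  then have "(\<integral>\<omega>. Z \<omega> * G \<omega> \<partial>M) = (\<integral>\<omega>. T \<omega> * G \<omega> \<partial>M)"
    using Z T(1) G by (intro integral_cong_AE) (auto simp: square_integrable_def)
  then show ?thesis using lim[OF G] by simp
qed

text \<open>This is \<open>\<delta>D = -L\<close> on smooth cylindrical variables, in weak form.\<close>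

lemma smooth_cylindrical_generator:
  assumes "smooth_cylindrical X F DF"
  obtains LF where "square_integrable M LF"
    "\<And>P DP. tame_cylindrical X P DP \<Longrightarrow> (\<integral>\<omega>. inner (DF \<omega>) (DP \<omega>) \<partial>M) = - (\<integral>\<omega>. LF \<omega> * P \<omega> \<partial>M)"
proof -
  obtain n \<psi> \<phi> where \<psi>: "smooth_compact_support n \<psi>"
    and DF: "DF = (\<lambda>\<omega>. \<Sum>i<n. partial_deriv i \<psi> (\<lambda>j. X (\<phi> j) \<omega>) *\<^sub>R \<phi> i)"
    using assms unfolding smooth_cylindrical_def by blast
  define G where "G i \<omega> = partial_deriv i \<psi> (\<lambda>j. X (\<phi> j) \<omega>)" for i \<omega>
  define DG where "DG i \<omega> = (\<Sum>l<n. partial_deriv l (partial_deriv i \<psi>) (\<lambda>j. X (\<phi> j) \<omega>) *\<^sub>R \<phi> l)" for i \<omega>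
  have T: "tame_cylindrical X (G i) (DG i)" if "i < n" for i
    unfolding tame_cylindrical_def G_def[abs_def] DG_def[abs_def]
    using smooth_compact_support_tame[OF smooth_compact_support_partial_deriv[OF \<psi> that]] by blast
  note sT = tame_cylindrical_square_integrable[OF T]
  \<comment> \<open>The Ornstein-Uhlenbeck operator on F: second derivatives contracted with the
    inner products of the \<phi>, minus the drift term with the first derivatives.\<close>
  define LF where "LF \<omega> = (\<Sum>i<n. inner (\<phi> i) (DG i \<omega>) - X (\<phi> i) \<omega> * G i \<omega>)" for \<omega>
  have XG: "square_integrable M (\<lambda>\<omega>. X (\<phi> i) \<omega> * G i \<omega>)" if "i < n" for i
    using tame_cylindrical_square_integrable(1)[OF tame_cylindrical_mult[OF tame_cylindrical_poly[of "[:0, 1:]" "\<phi> i"] T[OF that]]]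
    by simp
  have iD: "square_integrable M (\<lambda>\<omega>. inner h (f \<omega>))" if f: "square_integrable M f" for h and f :: "'a \<Rightarrow> 'h"
  proof (rule square_integrable_bound)
    have [measurable]: "f \<in> borel_measurable M" using f by auto
    show "(\<lambda>\<omega>. inner h (f \<omega>)) \<in> borel_measurable M" by measurable
    show "integrable M (\<lambda>\<omega>. (norm h)\<^sup>2 * (norm (f \<omega>))\<^sup>2)" using square_integrable_norm_sq[OF f] by simp
    show "AE \<omega> in M. (norm (inner h (f \<omega>)))\<^sup>2 \<le> (norm h)\<^sup>2 * (norm (f \<omega>))\<^sup>2"
    proof (rule AE_I2)
      fix \<omega>
      have "(norm (inner h (f \<omega>)))\<^sup>2 \<le> (norm h * norm (f \<omega>))\<^sup>2"
        using Cauchy_Schwarz_ineq2[of h "f \<omega>"] by (intro power_mono) auto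
      then show "(norm (inner h (f \<omega>)))\<^sup>2 \<le> (norm h)\<^sup>2 * (norm (f \<omega>))\<^sup>2" by (simp add: power_mult_distrib)
    qed
  qed
  have LF: "square_integrable M LF"
    unfolding LF_def by (intro square_integrable_sum square_integrable_diff iD sT XG) auto
  have "(\<integral>\<omega>. inner (DF \<omega>) (DP \<omega>) \<partial>M) = - (\<integral>\<omega>. LF \<omega> * P \<omega> \<partial>M)" if P: "tame_cylindrical X P DP" for P DP
  proof -
    note sP = tame_cylindrical_square_integrable[OF P]
    have "(\<integral>\<omega>. inner (DF \<omega>) (DP \<omega>) \<partial>M) = (\<integral>\<omega>. (\<Sum>i<n. G i \<omega> * inner (\<phi> i) (DP \<omega>)) \<partial>M)"
      by (simp add: DF G_def inner_sum_left)
    also have "\<dots> = (\<Sum>i<n. \<integral>\<omega>. G i \<omega> * inner (\<phi> i) (DP \<omega>) \<partial>M)"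
      by (intro Bochner_Integration.integral_sum integrable_mult_sq sT iD sP) auto
    also have "\<dots> = (\<Sum>i<n. - (\<integral>\<omega>. (inner (\<phi> i) (DG i \<omega>) - X (\<phi> i) \<omega> * G i \<omega>) * P \<omega> \<partial>M))"
    proof (intro sum.cong refl)
      fix i assume "i \<in> {..<n}"
      then have i: "i < n" by simp
      show "(\<integral>\<omega>. G i \<omega> * inner (\<phi> i) (DP \<omega>) \<partial>M) = - (\<integral>\<omega>. (inner (\<phi> i) (DG i \<omega>) - X (\<phi> i) \<omega> * G i \<omega>) * P \<omega> \<partial>M)"
        using divergence_duality[OF T[OF i] P, of "\<phi> i"] integrable_mult_sq[OF iD[OF sT(2)[OF i], of "\<phi> i"] sP(1)]
          integrable_mult_sq[OF XG[OF i] sP(1)]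
        by (simp add: left_diff_distrib)
    qed
    also have "\<dots> = - (\<integral>\<omega>. (\<Sum>i<n. (inner (\<phi> i) (DG i \<omega>) - X (\<phi> i) \<omega> * G i \<omega>) * P \<omega>) \<partial>M)"
      unfolding sum_negf
      by (subst Bochner_Integration.integral_sum)
        (auto intro!: integrable_mult_sq square_integrable_diff iD sT XG sP)
    finally show ?thesis by (simp add: LF_def sum_distrib_right)
  qed
  then show thesis using that LF by blast
qed

text \<open>The derivative is moved from the inverse of Z onto F, where it becomes -LF. Pairing LF
  with the projection of degree m gives -m times the pairing with F, which cancels the weight -1/m
  in the series for the inverse; the chaos decomposition then sums to E(ZF).\<close>

lemma malliavin_L_inv_duality_cylindrical:
  assumes Z: "square_integrable M Z" and mean: "(\<integral>\<omega>. Z \<omega> \<partial>M) = 0"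
    and F: "smooth_cylindrical X F DF" and V: "has_malliavin_deriv M X (L_inv M X Z) V"
  shows "(\<integral>\<omega>. inner (DF \<omega>) (V \<omega>) \<partial>M) = - (\<integral>\<omega>. Z \<omega> * F \<omega> \<partial>M)"
proof -
  let ?Y = "L_inv M X Z" and ?J = "\<lambda>m. chaos_proj M X m Z"
  note J = chaos_proj_in_chaos[OF Z] and L = L_inv_converges_in_D12[OF Z]
  have sJ: "square_integrable M (?J m)" for m by (rule wiener_chaos_square_integrable[OF J(1)])
  note tF = smooth_cylindrical_tame[OF F]
  note sF = tame_cylindrical_square_integrable[OF tF]
  obtain LF where LF: "square_integrable M LF"
    "\<And>P DP. tame_cylindrical X P DP \<Longrightarrow> (\<integral>\<omega>. inner (DF \<omega>) (DP \<omega>) \<partial>M) = - (\<integral>\<omega>. LF \<omega> * P \<omega> \<partial>M)"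
    using smooth_cylindrical_generator[OF F] by blast
  have sV: "square_integrable M V" using V by (simp add: has_malliavin_deriv_def)
  obtain S DS where S: "\<And>n. smooth_cylindrical X (S n) (DS n)" "L2_converges M S ?Y" "L2_converges M DS V"
    using V unfolding has_malliavin_deriv_def by blast
  note tS = smooth_cylindrical_tame[OF S(1)]
  note sS = tame_cylindrical_square_integrable[OF tS]
  have l1: "(\<lambda>n. \<integral>\<omega>. inner (DS n \<omega>) (DF \<omega>) \<partial>M) \<longlonglongrightarrow> (\<integral>\<omega>. inner (V \<omega>) (DF \<omega>) \<partial>M)"
    by (intro L2_converges_inner_left sS sV S sF)
  have l2: "(\<lambda>n. - (\<integral>\<omega>. S n \<omega> * LF \<omega> \<partial>M)) \<longlonglongrightarrow> - (\<integral>\<omega>. ?Y \<omega> * LF \<omega> \<partial>M)"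
    by (intro tendsto_minus L2_converges_mult_left sS L S LF)
  have 1: "(\<integral>\<omega>. inner (V \<omega>) (DF \<omega>) \<partial>M) = - (\<integral>\<omega>. ?Y \<omega> * LF \<omega> \<partial>M)"
  proof (rule LIMSEQ_unique[OF l1])
    show "(\<lambda>n. \<integral>\<omega>. inner (DS n \<omega>) (DF \<omega>) \<partial>M) \<longlonglongrightarrow> - (\<integral>\<omega>. ?Y \<omega> * LF \<omega> \<partial>M)"
      using l2 LF(2)[OF tS] by (simp add: inner_commute mult.commute)
  qed
  \<comment> \<open>Symmetry of L: the inner product of DF with the derivative of a Hermite variable
    is computed once through \<open>LF\<close> and once through the Hermite duality.\<close>
  have herm: "(\<integral>\<omega>. hermite m (X h \<omega>) * LF \<omega> \<partial>M) = - real m * (\<integral>\<omega>. hermite m (X h \<omega>) * F \<omega> \<partial>M)"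
    if m: "m \<ge> 1" and h: "norm h = 1" for m h
  proof -
    obtain m' where m': "m = Suc m'" using m by (cases m) auto
    have "- (\<integral>\<omega>. LF \<omega> * hermite m (X h \<omega>) \<partial>M) = (\<integral>\<omega>. inner (DF \<omega>) ((real m * hermite (m - 1) (X h \<omega>)) *\<^sub>R h) \<partial>M)"
      by (rule LF(2)[OF tame_cylindrical_hermite, symmetric])
    also have "\<dots> = (\<integral>\<omega>. real m * (hermite m' (X h \<omega>) * inner h (DF \<omega>)) \<partial>M)"
      by (simp add: m' inner_commute[of h] mult.assoc)
    also have "\<dots> = real m * (\<integral>\<omega>. hermite m (X h \<omega>) * F \<omega> \<partial>M)"
      using hermite_duality[OF h tF, of m'] by (simp add: m')
    finally show ?thesis by (simp add: mult.commute[of "LF _"])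
  qed
  have JL: "(\<integral>\<omega>. ?J m \<omega> * LF \<omega> \<partial>M) = - real m * (\<integral>\<omega>. ?J m \<omega> * F \<omega> \<partial>M)" if m: "m \<ge> 1" for m
  proof -
    obtain T where T: "\<And>n. T n \<in> chaos_span X m" "L2_converges M T (?J m)"
      using J(1)[of m] by (auto simp: wiener_chaos_def)
    have eq: "(\<integral>\<omega>. T n \<omega> * LF \<omega> \<partial>M) = - real m * (\<integral>\<omega>. T n \<omega> * F \<omega> \<partial>M)" for n
    proof -
      obtain k :: nat and c h where h: "\<And>i. i < k \<Longrightarrow> norm (h i) = 1" "T n = (\<lambda>\<omega>. \<Sum>i<k. c i * hermite m (X (h i) \<omega>))"
        by (rule chaos_spanE[OF T(1)[of n] m]) (rule that)
      have "(\<integral>\<omega>. T n \<omega> * g \<omega> \<partial>M) = (\<Sum>i<k. c i * (\<integral>\<omega>. hermite m (X (h i) \<omega>) * g \<omega> \<partial>M))" if g: "square_integrable M g" for g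
        unfolding h(2) sum_distrib_right
        by (subst Bochner_Integration.integral_sum)
          (auto simp: mult.assoc intro!: integrable_mult_right integrable_mult_sq hermite_square_integrable g)
      from this[OF LF(1)] this[OF sF(1)] show ?thesis
        using herm[OF m h(1)] by (simp add: sum_distrib_left ac_simps flip: sum_negf)
    qed
    have "(\<lambda>n. \<integral>\<omega>. T n \<omega> * LF \<omega> \<partial>M) \<longlonglongrightarrow> (\<integral>\<omega>. ?J m \<omega> * LF \<omega> \<partial>M)"
      by (intro L2_converges_mult_left chaos_span_square_integrable[OF T(1)] sJ T LF)
    moreover have "(\<lambda>n. \<integral>\<omega>. T n \<omega> * LF \<omega> \<partial>M) \<longlonglongrightarrow> - real m * (\<integral>\<omega>. ?J m \<omega> * F \<omega> \<partial>M)"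
      unfolding eq by (intro tendsto_mult tendsto_const L2_converges_mult_left chaos_span_square_integrable[OF T(1)] sJ T sF)
    ultimately show ?thesis by (rule LIMSEQ_unique)
  qed
  let ?s = "\<lambda>N \<omega>. \<Sum>m=1..N. - (1 / real m) * ?J m \<omega>"
  have ss: "square_integrable M (?s N)" for N
    by (intro square_integrable_sum square_integrable_mult sJ)
  have "(\<integral>\<omega>. ?s N \<omega> * LF \<omega> \<partial>M) = (\<Sum>m=1..N. \<integral>\<omega>. ?J m \<omega> * F \<omega> \<partial>M)" for N
  proof -
    have "(\<integral>\<omega>. ?s N \<omega> * LF \<omega> \<partial>M) = (\<Sum>m=1..N. \<integral>\<omega>. - (1 / real m) * ?J m \<omega> * LF \<omega> \<partial>M)"
      unfolding sum_distrib_right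
      by (intro Bochner_Integration.integral_sum integrable_mult_sq square_integrable_mult sJ LF)
    also have "\<dots> = (\<Sum>m=1..N. \<integral>\<omega>. ?J m \<omega> * F \<omega> \<partial>M)"
    proof (intro sum.cong refl)
      fix m assume "m \<in> {1..N}"
      then have m: "m \<ge> 1" by simp
      have "(\<integral>\<omega>. - (1 / real m) * ?J m \<omega> * LF \<omega> \<partial>M) = - (1 / real m) * (\<integral>\<omega>. ?J m \<omega> * LF \<omega> \<partial>M)"
        by (simp add: mult.assoc flip: integral_mult_right_zero)
      then show "(\<integral>\<omega>. - (1 / real m) * ?J m \<omega> * LF \<omega> \<partial>M) = (\<integral>\<omega>. ?J m \<omega> * F \<omega> \<partial>M)"
        using m by (simp add: JL[OF m])
    qed
    finally show ?thesis .
  qed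
  then have "(\<lambda>N. \<Sum>m=1..N. \<integral>\<omega>. ?J m \<omega> * F \<omega> \<partial>M) \<longlonglongrightarrow> (\<integral>\<omega>. ?Y \<omega> * LF \<omega> \<partial>M)"
    using L2_converges_mult_left[OF ss L(1,2) LF(1)] by simp
  then have "(\<integral>\<omega>. ?Y \<omega> * LF \<omega> \<partial>M) = (\<integral>\<omega>. Z \<omega> * F \<omega> \<partial>M)"
    using chaos_decomposition[OF Z mean sF(1)] by (rule LIMSEQ_unique)
  then show ?thesis using 1 by (simp add: inner_commute[of "V _"])
qed

lemma smooth_cylindrical_compose:
  assumes F: "smooth_cylindrical X F DF" and f: "smooth_real f" "f 0 = 0"
    and d: "\<And>x. (f has_real_derivative f' x) (at x)"
  shows "smooth_cylindrical X (\<lambda>\<omega>. f (F \<omega>)) (\<lambda>\<omega>. f' (F \<omega>) *\<^sub>R DF \<omega>)"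
proof -
  obtain n \<psi> \<phi> where n: "n \<ge> 1" and \<psi>: "smooth_compact_support n \<psi>" and FF: "F = (\<lambda>\<omega>. \<psi> (\<lambda>j. X (\<phi> j) \<omega>))"
    and DF: "DF = (\<lambda>\<omega>. \<Sum>i<n. partial_deriv i \<psi> (\<lambda>j. X (\<phi> j) \<omega>) *\<^sub>R \<phi> i)"
    using F unfolding smooth_cylindrical_def by blast
  have "partial_deriv i (\<lambda>x. f (\<psi> x)) x = f' (\<psi> x) * partial_deriv i \<psi> x" if i: "i < n" for i x
  proof (rule partial_deriv_eq)
    have "(f has_real_derivative f' (\<psi> (x(i := x i)))) (at (\<psi> (x(i := x i))))" by (rule d)
    from DERIV_chain2[OF this smooth_compact_supportD(3)[OF \<psi> i]]
    show "((\<lambda>t. f (\<psi> (x(i := t)))) has_real_derivative f' (\<psi> x) * partial_deriv i \<psi> x) (at (x i))"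
      by (simp only: fun_upd_triv)
  qed
  then show ?thesis
    unfolding smooth_cylindrical_def
    using n smooth_compact_support_compose[OF \<psi> f]
    by (intro exI[of _ n] exI[of _ "\<lambda>x. f (\<psi> x)"] exI[of _ \<phi>]) (auto simp: FF DF scaleR_sum_right)
qed

text \<open>The identity holds for f applied to cylindrical approximations of Z, and both sides
  converge: f(S n) because f is Lipschitz, the derivative side by first replacing DS n with U at the
  cost of a term that the bound on f' makes vanish, then S n with Z inside f'.\<close>

theorem malliavin_L_inv_duality:
  assumes mean: "(\<integral>\<omega>. Z \<omega> \<partial>M) = 0"
    and U: "has_malliavin_deriv M X Z U" and V: "has_malliavin_deriv M X (L_inv M X Z) V"
    and f: "smooth_real f" "f 0 = 0"
    and d: "\<And>x. (f has_real_derivative f' x) (at x)" and cont: "continuous_on UNIV f'" and B: "\<And>x. \<bar>f' x\<bar> \<le> B"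
  shows "square_integrable M (\<lambda>\<omega>. f (Z \<omega>))"
    and "(\<integral>\<omega>. Z \<omega> * f (Z \<omega>) \<partial>M) = (\<integral>\<omega>. f' (Z \<omega>) * inner (U \<omega>) (- V \<omega>) \<partial>M)"
proof -
  have Z: "square_integrable M Z" and sU: "square_integrable M U" and sV: "square_integrable M V"
    using U V by (auto simp: has_malliavin_deriv_def)
  obtain S DS where S: "\<And>n. smooth_cylindrical X (S n) (DS n)" "L2_converges M S Z" "L2_converges M DS U"
    using U unfolding has_malliavin_deriv_def by blast
  have sS: "square_integrable M (S n)" "square_integrable M (DS n)" for n
    using tame_cylindrical_square_integrable[OF smooth_cylindrical_tame[OF S(1)]] by auto
  have [measurable]: "f' \<in> borel_measurable borel" using cont by (rule borel_measurable_continuous_onI)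
  have "continuous_on UNIV f" using d by (meson DERIV_isCont continuous_at_imp_continuous_on)
  then have [measurable]: "f \<in> borel_measurable borel" by (rule borel_measurable_continuous_onI)
  have [measurable]: "Z \<in> borel_measurable M" "S n \<in> borel_measurable M" "DS n \<in> borel_measurable M"
    "U \<in> borel_measurable M" "V \<in> borel_measurable M" for n
    using Z sS sU sV by auto
  have lip: "\<bar>f a - f b\<bar> \<le> B * \<bar>a - b\<bar>" for a b
  proof -
    obtain z where "f a - f b = (a - b) * f' z" using MVT_abs[OF d, of b a] by metis
    then show ?thesis using B[of z] by (simp add: abs_mult mult.commute mult_right_mono)
  qed
  have lip2: "(norm (f a - f b))\<^sup>2 \<le> B\<^sup>2 * (norm (a - b))\<^sup>2" for a b
    using power_mono[OF lip[of a b], of 2] by (simp add: power_mult_distrib)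
  show sf: "square_integrable M (\<lambda>\<omega>. f (Z \<omega>))"
  proof (rule square_integrable_bound)
    show "integrable M (\<lambda>\<omega>. B\<^sup>2 * (norm (Z \<omega>))\<^sup>2)" using square_integrable_norm_sq[OF Z] by simp
    show "AE \<omega> in M. (norm (f (Z \<omega>)))\<^sup>2 \<le> B\<^sup>2 * (norm (Z \<omega>))\<^sup>2" using lip2[of _ 0] f(2) by simp
  qed measurable
  note fS = smooth_cylindrical_compose[OF S(1) f d]
  have sfS: "square_integrable M (\<lambda>\<omega>. f (S n \<omega>))" "square_integrable M (\<lambda>\<omega>. f' (S n \<omega>) *\<^sub>R DS n \<omega>)" for n
    using tame_cylindrical_square_integrable[OF smooth_cylindrical_tame[OF fS]] by auto
  have "L2_converges M (\<lambda>n \<omega>. f (S n \<omega>)) (\<lambda>\<omega>. f (Z \<omega>))"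
    unfolding L2_converges_msq
  proof (rule Lim_null_comparison)
    show "(\<lambda>n. B\<^sup>2 * msq M (\<lambda>\<omega>. S n \<omega> - Z \<omega>)) \<longlonglongrightarrow> 0"
      using S(2) unfolding L2_converges_msq by (rule tendsto_mult_right_zero)
    have "msq M (\<lambda>\<omega>. f (S n \<omega>) - f (Z \<omega>)) \<le> B\<^sup>2 * msq M (\<lambda>\<omega>. S n \<omega> - Z \<omega>)" for n
      unfolding msq_def integral_mult_right_zero[symmetric]
      by (intro integral_mono lip2 square_integrable_norm_sq square_integrable_diff sfS sf integrable_mult_right sS Z)
    then show "\<forall>\<^sub>F n in sequentially. norm (msq M (\<lambda>\<omega>. f (S n \<omega>) - f (Z \<omega>))) \<le> B\<^sup>2 * msq M (\<lambda>\<omega>. S n \<omega> - Z \<omega>)" by simp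
  qed
  then have lhs: "(\<lambda>n. \<integral>\<omega>. f (S n \<omega>) * Z \<omega> \<partial>M) \<longlonglongrightarrow> (\<integral>\<omega>. f (Z \<omega>) * Z \<omega> \<partial>M)"
    by (intro L2_converges_mult_left sfS sf Z)
  have dual: "(\<integral>\<omega>. f (S n \<omega>) * Z \<omega> \<partial>M) = - (\<integral>\<omega>. f' (S n \<omega>) * inner (DS n \<omega>) (V \<omega>) \<partial>M)" for n
    using malliavin_L_inv_duality_cylindrical[OF Z mean fS V, of n] by (simp add: mult.commute)
  have iUV: "integrable M (\<lambda>\<omega>. inner (U \<omega>) (V \<omega>))" by (rule integrable_inner[OF sU sV])
  have ifUV: "integrable M (\<lambda>\<omega>. f' (T \<omega>) * inner (U \<omega>) (V \<omega>))" if [measurable]: "T \<in> borel_measurable M" for T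
    using integrable_mult_bounded[OF iUV, of "\<lambda>\<omega>. f' (T \<omega>)" B] B by (simp add: mult.commute)
  have sfU: "square_integrable M (\<lambda>\<omega>. f' (S n \<omega>) *\<^sub>R (DS n \<omega> - U \<omega>))"
    and mfU: "msq M (\<lambda>\<omega>. f' (S n \<omega>) *\<^sub>R (DS n \<omega> - U \<omega>)) \<le> B\<^sup>2 * msq M (\<lambda>\<omega>. DS n \<omega> - U \<omega>)" for n
  proof -
    have b: "(norm (f' (S n \<omega>) *\<^sub>R (DS n \<omega> - U \<omega>)))\<^sup>2 \<le> B\<^sup>2 * (norm (DS n \<omega> - U \<omega>))\<^sup>2" for \<omega>
    proof -
      have "(f' (S n \<omega>))\<^sup>2 \<le> B\<^sup>2" using power_mono[OF B[of "S n \<omega>"], of 2] by simp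
      then show ?thesis by (simp add: power_mult_distrib mult_right_mono)
    qed
    have i: "integrable M (\<lambda>\<omega>. B\<^sup>2 * (norm (DS n \<omega> - U \<omega>))\<^sup>2)"
      by (intro integrable_mult_right square_integrable_norm_sq square_integrable_diff sS sU)
    show s: "square_integrable M (\<lambda>\<omega>. f' (S n \<omega>) *\<^sub>R (DS n \<omega> - U \<omega>))"
      by (rule square_integrable_bound[OF _ i]) (use b in auto)
    show "msq M (\<lambda>\<omega>. f' (S n \<omega>) *\<^sub>R (DS n \<omega> - U \<omega>)) \<le> B\<^sup>2 * msq M (\<lambda>\<omega>. DS n \<omega> - U \<omega>)"
      unfolding msq_def integral_mult_right_zero[symmetric]
      by (intro integral_mono b i square_integrable_norm_sq s)
  qed
  have rem: "(\<lambda>n. \<integral>\<omega>. inner (f' (S n \<omega>) *\<^sub>R (DS n \<omega> - U \<omega>)) (V \<omega>) \<partial>M) \<longlonglongrightarrow> 0"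
  proof (rule Lim_null_comparison)
    have "(\<lambda>n. sqrt (B\<^sup>2 * msq M (\<lambda>\<omega>. DS n \<omega> - U \<omega>) * msq M V)) \<longlonglongrightarrow> sqrt (B\<^sup>2 * 0 * msq M V)"
      using S(3) unfolding L2_converges_msq by (intro tendsto_intros)
    then show "(\<lambda>n. sqrt (B\<^sup>2 * msq M (\<lambda>\<omega>. DS n \<omega> - U \<omega>) * msq M V)) \<longlonglongrightarrow> 0" by simp
    show "\<forall>\<^sub>F n in sequentially. norm (\<integral>\<omega>. inner (f' (S n \<omega>) *\<^sub>R (DS n \<omega> - U \<omega>)) (V \<omega>) \<partial>M) \<le> sqrt (B\<^sup>2 * msq M (\<lambda>\<omega>. DS n \<omega> - U \<omega>) * msq M V)"
    proof (intro always_eventually allI)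
      fix n
      have "norm (\<integral>\<omega>. inner (f' (S n \<omega>) *\<^sub>R (DS n \<omega> - U \<omega>)) (V \<omega>) \<partial>M) \<le> sqrt (msq M (\<lambda>\<omega>. f' (S n \<omega>) *\<^sub>R (DS n \<omega> - U \<omega>)) * msq M V)"
        using integral_inner_Cauchy_Schwarz[OF sfU sV] by simp
      also have "\<dots> \<le> sqrt (B\<^sup>2 * msq M (\<lambda>\<omega>. DS n \<omega> - U \<omega>) * msq M V)"
        by (intro real_sqrt_le_mono mult_right_mono mfU) simp
      finally show "norm (\<integral>\<omega>. inner (f' (S n \<omega>) *\<^sub>R (DS n \<omega> - U \<omega>)) (V \<omega>) \<partial>M) \<le> sqrt (B\<^sup>2 * msq M (\<lambda>\<omega>. DS n \<omega> - U \<omega>) * msq M V)" .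
    qed
  qed
  have split: "(\<integral>\<omega>. f' (S n \<omega>) * inner (DS n \<omega>) (V \<omega>) \<partial>M)
      = (\<integral>\<omega>. inner (f' (S n \<omega>) *\<^sub>R (DS n \<omega> - U \<omega>)) (V \<omega>) \<partial>M) + (\<integral>\<omega>. f' (S n \<omega>) * inner (U \<omega>) (V \<omega>) \<partial>M)" for n
  proof -
    have "(\<lambda>\<omega>. f' (S n \<omega>) * inner (DS n \<omega>) (V \<omega>)) = (\<lambda>\<omega>. inner (f' (S n \<omega>) *\<^sub>R (DS n \<omega> - U \<omega>)) (V \<omega>) + f' (S n \<omega>) * inner (U \<omega>) (V \<omega>))"
      by (simp add: fun_eq_iff inner_diff_left algebra_simps)
    then show ?thesis
      using Bochner_Integration.integral_add[OF integrable_inner[OF sfU sV, of n] ifUV[of "S n"]] by simp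
  qed
  \<comment> \<open>The function f' is only continuous and bounded, so almost sure convergence is
    needed for dominated convergence; a subsequence provides it.\<close>
  obtain r where r: "strict_mono r" "AE \<omega> in M. (\<lambda>n. (norm (S (r n) \<omega> - Z \<omega>))\<^sup>2) \<longlonglongrightarrow> 0"
  proof -
    have "\<exists>r::nat \<Rightarrow> nat. strict_mono r \<and> (AE \<omega> in M. (\<lambda>n. (norm (S (r n) \<omega> - Z \<omega>))\<^sup>2) \<longlonglongrightarrow> 0)"
      by (rule tendsto_L1_AE_subseq)
        (use S(2) sS Z in \<open>auto simp: L2_converges_def intro!: square_integrable_norm_sq[of M "\<lambda>\<omega>. S _ \<omega> - Z \<omega>", simplified] square_integrable_diff\<close>)
    then show thesis using that by blast
  qed
  have "(\<lambda>n. \<integral>\<omega>. f' (S (r n) \<omega>) * inner (U \<omega>) (V \<omega>) \<partial>M) \<longlonglongrightarrow> (\<integral>\<omega>. f' (Z \<omega>) * inner (U \<omega>) (V \<omega>) \<partial>M)"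
  proof (rule integral_dominated_convergence[where w = "\<lambda>\<omega>. B * \<bar>inner (U \<omega>) (V \<omega>)\<bar>"])
    show "integrable M (\<lambda>\<omega>. B * \<bar>inner (U \<omega>) (V \<omega>)\<bar>)" using iUV by simp
    show "AE \<omega> in M. (\<lambda>n. f' (S (r n) \<omega>) * inner (U \<omega>) (V \<omega>)) \<longlonglongrightarrow> f' (Z \<omega>) * inner (U \<omega>) (V \<omega>)"
      using r(2)
    proof eventually_elim
      case (elim \<omega>)
      have "(\<lambda>n. sqrt ((norm (S (r n) \<omega> - Z \<omega>))\<^sup>2)) \<longlonglongrightarrow> sqrt 0" by (intro tendsto_real_sqrt elim)
      then have "(\<lambda>n. S (r n) \<omega> - Z \<omega>) \<longlonglongrightarrow> 0" by (simp add: tendsto_rabs_zero_iff)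
      then have "(\<lambda>n. S (r n) \<omega>) \<longlonglongrightarrow> Z \<omega>" by (rule LIM_zero_cancel)
      then have "(\<lambda>n. f' (S (r n) \<omega>)) \<longlonglongrightarrow> f' (Z \<omega>)"
        by (intro continuous_on_tendsto_compose[OF cont]) auto
      then show ?case by (intro tendsto_mult tendsto_const)
    qed
    show "AE \<omega> in M. norm (f' (S (r n) \<omega>) * inner (U \<omega>) (V \<omega>)) \<le> B * \<bar>inner (U \<omega>) (V \<omega>)\<bar>" for n
      using B by (auto simp: abs_mult intro!: mult_right_mono)
  qed measurable
  then have "(\<lambda>n. \<integral>\<omega>. f' (S (r n) \<omega>) * inner (DS (r n) \<omega>) (V \<omega>) \<partial>M) \<longlonglongrightarrow> 0 + (\<integral>\<omega>. f' (Z \<omega>) * inner (U \<omega>) (V \<omega>) \<partial>M)"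
    unfolding split using LIMSEQ_subseq_LIMSEQ[OF rem r(1)] by (intro tendsto_add) (auto simp: o_def)
  then have "(\<lambda>n. \<integral>\<omega>. f (S (r n) \<omega>) * Z \<omega> \<partial>M) \<longlonglongrightarrow> - (\<integral>\<omega>. f' (Z \<omega>) * inner (U \<omega>) (V \<omega>) \<partial>M)"
    unfolding dual by (intro tendsto_minus) simp
  moreover have "(\<lambda>n. \<integral>\<omega>. f (S (r n) \<omega>) * Z \<omega> \<partial>M) \<longlonglongrightarrow> (\<integral>\<omega>. f (Z \<omega>) * Z \<omega> \<partial>M)"
    using LIMSEQ_subseq_LIMSEQ[OF lhs r(1)] by (simp add: o_def)
  ultimately have "(\<integral>\<omega>. f (Z \<omega>) * Z \<omega> \<partial>M) = - (\<integral>\<omega>. f' (Z \<omega>) * inner (U \<omega>) (V \<omega>) \<partial>M)"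
    using LIMSEQ_unique by blast
  then show "(\<integral>\<omega>. Z \<omega> * f (Z \<omega>) \<partial>M) = (\<integral>\<omega>. f' (Z \<omega>) * inner (U \<omega>) (- V \<omega>) \<partial>M)"
    by (simp add: mult.commute)
qed

end

section \<open>The tail bound\<close>

text \<open>The negative log-sum-exp, a smooth concave function that lies below min x a by at most
  ln 2 / k.\<close>

definition softmin :: "real \<Rightarrow> real \<Rightarrow> real \<Rightarrow> real" where
  "softmin k a x = - ln (exp (- k * x) + exp (- k * a)) / k"

text \<open>The logistic function of k (a - x).\<close>

definition softmin_deriv :: "real \<Rightarrow> real \<Rightarrow> real \<Rightarrow> real" where
  "softmin_deriv k a x = exp (- k * x) / (exp (- k * x) + exp (- k * a))"

lemma exp_sum_pos: "0 < exp x + exp y" for x y :: real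
  by (simp add: add_pos_pos)

lemma softmin_deriv_bounds: "0 < softmin_deriv k a x" "softmin_deriv k a x < 1"
  using exp_sum_pos by (simp_all add: softmin_deriv_def divide_simps add_pos_pos)

lemma DERIV_softmin:
  assumes "k > 0"
  shows "(softmin k a has_real_derivative softmin_deriv k a x) (at x)"
proof -
  have pos: "0 < exp (- k * x) + exp (- k * a)" by (rule exp_sum_pos)
  have "((\<lambda>y. exp (- k * y) + exp (- k * a)) has_real_derivative - k * exp (- k * x)) (at x)"
    by (auto intro!: derivative_eq_intros)
  from DERIV_cdivide[OF DERIV_minus[OF DERIV_chain2[OF DERIV_ln[OF pos] this]], of k]
  moreover have "- (inverse S * (- k * e)) / k = e / S" for e S :: real
    using assms by (simp add: divide_inverse mult.commute)
  ultimately show ?thesis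
    unfolding softmin_def softmin_deriv_def by (simp only:)
qed

text \<open>The logistic differential equation. As the derivative is a polynomial in the function
  itself, all higher derivatives are polynomials in it too.\<close>

lemma DERIV_softmin_deriv:
  "(softmin_deriv k a has_real_derivative - k * softmin_deriv k a x * (1 - softmin_deriv k a x)) (at x)"
proof -
  define E where "E y = exp (- k * y)" for y
  define c where "c = exp (- k * a)"
  have pos: "E y + c > 0" for y by (simp add: E_def c_def add_pos_pos)
  have D: "(E has_real_derivative - k * E x) (at x)"
    unfolding E_def by (auto intro!: derivative_eq_intros)
  have "((\<lambda>y. E y / (E y + c)) has_real_derivative ((- k * E x) * (E x + c) - E x * (- k * E x)) / ((E x + c) * (E x + c))) (at x)"
  proof (intro DERIV_divide D)
    show "((\<lambda>y. E y + c) has_real_derivative - k * E x) (at x)" using DERIV_add[OF D DERIV_const, of c] by simp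
    show "E x + c \<noteq> 0" using pos[of x] by simp
  qed
  moreover have "((- k * E x) * (E x + c) - E x * (- k * E x)) / ((E x + c) * (E x + c)) = - k * (E x / (E x + c)) * (1 - E x / (E x + c))"
    using pos[of x] by (simp add: field_simps)
  ultimately show ?thesis by (simp add: softmin_deriv_def[abs_def] E_def c_def)
qed

lemma softmin_deriv_antimono:
  assumes "k > 0" "x \<le> y"
  shows "softmin_deriv k a y \<le> softmin_deriv k a x"
proof -
  have "exp (- k * y) \<le> exp (- k * x)" using assms by simp
  then have "exp (- k * y) * exp (- k * a) \<le> exp (- k * x) * exp (- k * a)" by (rule mult_right_mono) simp
  then show ?thesis
    using exp_sum_pos[of "- k * y" "- k * a"] exp_sum_pos[of "- k * x" "- k * a"]
    by (simp add: softmin_deriv_def divide_simps algebra_simps)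
qed

lemma softmin_le:
  assumes "k > 0"
  shows "softmin k a x \<le> x" "softmin k a x \<le> a"
proof -
  have "ln (exp (- k * x)) \<le> ln (exp (- k * x) + exp (- k * a))"
    "ln (exp (- k * a)) \<le> ln (exp (- k * x) + exp (- k * a))"
    by (subst ln_le_cancel_iff; simp add: add_pos_pos)+
  then show "softmin k a x \<le> x" "softmin k a x \<le> a"
    using assms by (simp_all add: softmin_def field_simps)
qed

lemma softmin_mono:
  assumes "k > 0" "x \<le> y"
  shows "softmin k a x \<le> softmin k a y"
proof -
  have "ln (exp (- k * y) + exp (- k * a)) \<le> ln (exp (- k * x) + exp (- k * a))"
    using assms by (subst ln_le_cancel_iff) (auto simp: add_pos_pos)
  then show ?thesis using assms by (simp add: softmin_def divide_right_mono)
qed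

text \<open>By concavity the tangent at x lies above the function at 0. The bound replaces the
  product of Z with the derivative by a function of \<open>softmin\<close> alone.\<close>

lemma softmin_tangent:
  assumes k: "k > 0"
  shows "x * softmin_deriv k a x \<le> softmin k a x - softmin k a 0"
proof (cases x "0 :: real" rule: linorder_cases)
  case less
  obtain z where z: "x < z" "z < 0" "softmin k a 0 - softmin k a x = (0 - x) * softmin_deriv k a z"
    using MVT2[OF less, of "softmin k a" "softmin_deriv k a"] DERIV_softmin[OF k] by blast
  then have "softmin_deriv k a z \<le> softmin_deriv k a x" using softmin_deriv_antimono[OF k] by simp
  then have "(- x) * softmin_deriv k a z \<le> (- x) * softmin_deriv k a x" using less by (intro mult_left_mono) auto
  then show ?thesis using z(3) by simp
next
  case greater
  obtain z where z: "0 < z" "z < x" "softmin k a x - softmin k a 0 = (x - 0) * softmin_deriv k a z"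
    using MVT2[OF greater, of "softmin k a" "softmin_deriv k a"] DERIV_softmin[OF k] by blast
  then have "softmin_deriv k a x \<le> softmin_deriv k a z" using softmin_deriv_antimono[OF k] by simp
  then have "x * softmin_deriv k a x \<le> x * softmin_deriv k a z" using greater by (intro mult_left_mono) auto
  then show ?thesis using z(3) by simp
qed simp

lemma softmin_abs_le:
  assumes k: "k > 0"
  shows "\<bar>softmin k a x\<bar> \<le> \<bar>x\<bar> + \<bar>softmin k a 0\<bar>"
proof -
  obtain z where "softmin k a x - softmin k a 0 = (x - 0) * softmin_deriv k a z"
    using MVT_abs[OF DERIV_softmin[OF k], of 0 x] by metis
  moreover have "\<bar>x * softmin_deriv k a z\<bar> \<le> \<bar>x\<bar> * 1"
    unfolding abs_mult using softmin_deriv_bounds[of k a z] by (intro mult_left_mono) auto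
  ultimately show ?thesis by simp
qed

text \<open>Each derivative is the exponential times a polynomial in the logistic function \<sigma>.
  One differentiation sends p to \<theta>xp + (k x^2 - kx) p', by the chain rule and the logistic
  equation.\<close>

lemma smooth_real_exp_softmin:
  assumes k: "k > 0"
  shows "smooth_real (\<lambda>x. exp (\<theta> * softmin k a x))"
proof -
  let ?\<sigma> = "softmin_deriv k a"
  let ?step = "\<lambda>p. smult \<theta> ([:0, 1:] * p) + [:0, - k, k:] * pderiv p"
  define d where "d m x = exp (\<theta> * softmin k a x) * poly ((?step ^^ m) 1) (?\<sigma> x)" for m x
  have "(d m has_real_derivative d (Suc m) x) (at x)" for m x
  proof -
    let ?p = "(?step ^^ m) 1"
    have D1: "((\<lambda>x. exp (\<theta> * softmin k a x)) has_real_derivative exp (\<theta> * softmin k a x) * (\<theta> * ?\<sigma> x)) (at x)"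
      by (intro DERIV_chain2[OF DERIV_exp] DERIV_cmult DERIV_softmin k)
    have D2: "((\<lambda>x. poly ?p (?\<sigma> x)) has_real_derivative poly (pderiv ?p) (?\<sigma> x) * (- k * ?\<sigma> x * (1 - ?\<sigma> x))) (at x)"
      by (rule DERIV_chain2[OF poly_DERIV DERIV_softmin_deriv])
    have "exp (\<theta> * softmin k a x) * (\<theta> * ?\<sigma> x) * poly ?p (?\<sigma> x)
        + poly (pderiv ?p) (?\<sigma> x) * (- k * ?\<sigma> x * (1 - ?\<sigma> x)) * exp (\<theta> * softmin k a x) = d (Suc m) x"
      by (simp add: d_def algebra_simps)
    then show ?thesis using DERIV_mult[OF D1 D2] unfolding d_def by simp
  qed
  moreover have "d 0 = (\<lambda>x. exp (\<theta> * softmin k a x))" by (simp add: d_def fun_eq_iff)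
  ultimately show ?thesis unfolding smooth_real_def by blast
qed

lemma smooth_real_diff_const:
  assumes "smooth_real f"
  shows "smooth_real (\<lambda>x. f x - c)"
proof -
  obtain d where d: "d 0 = f" "\<And>n x. (d n has_real_derivative d (Suc n) x) (at x)"
    using assms by (auto simp: smooth_real_def)
  let ?d = "\<lambda>n. if n = 0 then (\<lambda>x. f x - c) else d n"
  have "(?d n has_real_derivative ?d (Suc n) x) (at x)" for n x
  proof (cases n)
    case 0
    have "((\<lambda>x. f x - c) has_real_derivative d (Suc 0) x - 0) (at x)"
      using d(2)[of 0 x] unfolding d(1) by (intro DERIV_diff DERIV_const)
    then show ?thesis using 0 by simp
  qed (use d(2) in simp)
  then show ?thesis unfolding smooth_real_def by (intro exI[of _ ?d]) simp
qed

text \<open>The tangent inequality for the exponential, as a function of the parameter, at a.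
  Integrated over s, it controls difference quotients of a moment generating function from both
  sides.\<close>

lemma exp_diff_le: "(b - a) * s * exp (a * s) \<le> exp (b * s) - exp (a * s)" for a b s :: real
proof -
  have "1 + (b - a) * s \<le> exp ((b - a) * s)" by (rule exp_ge_add_one_self)
  then have "(1 + (b - a) * s) * exp (a * s) \<le> exp ((b - a) * s) * exp (a * s)" by (rule mult_right_mono) simp
  also have "\<dots> = exp (b * s)" by (simp add: exp_add[symmetric] algebra_simps)
  finally show ?thesis by (simp add: algebra_simps)
qed

text \<open>The assumption is the differential inequality \<open>m' \<le> \<theta> (\<alpha> m' + \<beta> m)\<close> for the
  moment generating function \<open>m\<close>.\<close>

lemma (in prob_space) moment_generating_bound:
  fixes s :: "'a \<Rightarrow> real"
  assumes s: "integrable M s" and A: "\<And>\<omega>. s \<omega> \<le> A"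
    and \<alpha>: "\<alpha> \<ge> 0" and \<beta>: "\<beta> \<ge> 0"
    and ineq: "\<And>\<theta>. \<theta> \<ge> 0 \<Longrightarrow> (\<integral>\<omega>. s \<omega> * exp (\<theta> * s \<omega>) \<partial>M)
      \<le> \<theta> * (\<alpha> * (\<integral>\<omega>. s \<omega> * exp (\<theta> * s \<omega>) \<partial>M) + \<beta> * (\<integral>\<omega>. exp (\<theta> * s \<omega>) \<partial>M))"
    and t: "t \<ge> 0" "\<alpha> * t < 1"
  shows "integrable M (\<lambda>\<omega>. exp (t * s \<omega>))"
    and "(\<integral>\<omega>. exp (t * s \<omega>) \<partial>M) \<le> exp (\<beta> * t\<^sup>2 / (2 * (1 - \<alpha> * t)))"
proof -
  have [measurable]: "s \<in> borel_measurable M" using s by auto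
  \<comment> \<open>Nonnegativity makes exp (\<theta> A') increasing in \<theta>, so that one
    constant dominates along a bounded sequence of parameters.\<close>
  define A' where "A' = max A 0"
  have eb: "exp (\<theta> * s \<omega>) \<le> exp (\<theta> * A')" if "\<theta> \<ge> 0" for \<theta> \<omega>
    using A[of \<omega>] that by (simp add: A'_def mult_left_mono max_def)
  have int: "integrable M (\<lambda>\<omega>. w \<omega> * exp (\<theta> * s \<omega>))" if "integrable M w" "\<theta> \<ge> 0" for w \<theta>
    by (rule integrable_mult_bounded[OF that(1), where C = "exp (\<theta> * A')"]) (use eb[OF that(2)] in auto)
  have cont: "continuous_on {0..} (\<lambda>\<theta>. \<integral>\<omega>. w \<omega> * exp (\<theta> * s \<omega>) \<partial>M)" if w: "integrable M w" for w
    unfolding continuous_on_sequentially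
  proof (intro allI ballI impI)
    fix x :: "nat \<Rightarrow> real" and y assume y: "y \<in> {0..}" and x: "(\<forall>n. x n \<in> {0..}) \<and> x \<longlonglongrightarrow> y"
    have [measurable]: "w \<in> borel_measurable M" using w by auto
    have "Bseq x" using x by (auto intro: convergent_imp_Bseq convergentI)
    then obtain K where K: "\<And>n. \<bar>x n\<bar> \<le> K" by (auto simp: Bseq_def)
    show "((\<lambda>\<theta>. \<integral>\<omega>. w \<omega> * exp (\<theta> * s \<omega>) \<partial>M) \<circ> x) \<longlonglongrightarrow> (\<integral>\<omega>. w \<omega> * exp (y * s \<omega>) \<partial>M)"
      unfolding o_def
    proof (rule integral_dominated_convergence[where w = "\<lambda>\<omega>. \<bar>w \<omega>\<bar> * exp (K * A')"])
      show "AE \<omega> in M. (\<lambda>n. w \<omega> * exp (x n * s \<omega>)) \<longlonglongrightarrow> w \<omega> * exp (y * s \<omega>)"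
        using x by (intro AE_I2 tendsto_intros) auto
      show "AE \<omega> in M. norm (w \<omega> * exp (x n * s \<omega>)) \<le> \<bar>w \<omega>\<bar> * exp (K * A')" for n
      proof (rule AE_I2)
        fix \<omega>
        have "exp (x n * s \<omega>) \<le> exp (x n * A')" using x by (intro eb) auto
        also have "\<dots> \<le> exp (K * A')" using K[of n] by (auto simp: A'_def intro!: mult_right_mono)
        finally show "norm (w \<omega> * exp (x n * s \<omega>)) \<le> \<bar>w \<omega>\<bar> * exp (K * A')"
          by (simp add: abs_mult mult_left_mono)
      qed
    qed (use w in auto)
  qed
  define m where "m \<theta> = (\<integral>\<omega>. exp (\<theta> * s \<omega>) \<partial>M)" for \<theta>
  define h where "h \<theta> = (\<integral>\<omega>. s \<omega> * exp (\<theta> * s \<omega>) \<partial>M)" for \<theta>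
  have im: "integrable M (\<lambda>\<omega>. exp (\<theta> * s \<omega>))" if "\<theta> \<ge> 0" for \<theta>
    using int[of "\<lambda>_. 1" \<theta>] that by simp
  show "integrable M (\<lambda>\<omega>. exp (t * s \<omega>))" by (rule im[OF t(1)])
  have ih: "integrable M (\<lambda>\<omega>. s \<omega> * exp (\<theta> * s \<omega>))" if "\<theta> \<ge> 0" for \<theta>
    using int[OF s that] .
  have cm: "continuous_on {0..} m" using cont[of "\<lambda>_. 1"] by (simp add: m_def[abs_def])
  have ch: "continuous_on {0..} h" using cont[OF s] by (simp add: h_def[abs_def])
  \<comment> \<open>\<open>m\<close> lies above its tangents, with slope \<open>h\<close>.
    Continuity of \<open>h\<close> then gives the derivative of \<open>m\<close> by squeezing,
    without differentiating under the integral.\<close>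
  have chord: "(b - a) * h a \<le> m b - m a" if "a \<ge> 0" "b \<ge> 0" for a b
  proof -
    have "(b - a) * h a = (\<integral>\<omega>. (b - a) * s \<omega> * exp (a * s \<omega>) \<partial>M)"
      by (simp add: h_def mult.assoc)
    also have "\<dots> \<le> (\<integral>\<omega>. exp (b * s \<omega>) - exp (a * s \<omega>) \<partial>M)"
    proof (rule integral_mono)
      show "integrable M (\<lambda>\<omega>. (b - a) * s \<omega> * exp (a * s \<omega>))"
        using integrable_mult_right[OF ih[OF that(1)], of "b - a"] by (simp add: mult.assoc)
    qed (use im that exp_diff_le in auto)
    also have "\<dots> = m b - m a" using im that by (simp add: m_def)
    finally show ?thesis .
  qed
  have dm: "(m has_real_derivative h x) (at x)" if x: "x > 0" for x
    unfolding has_field_derivative_iff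
  proof (rule LIM_zero_cancel, rule Lim_null_comparison)
    have "isCont h x" using ch x by (auto simp: continuous_on_interior)
    then have "(h \<longlongrightarrow> h x) (at x)" by (simp add: isCont_def)
    then have "((\<lambda>y. h y - h x) \<longlongrightarrow> 0) (at x)" by (rule LIM_zero)
    then show "((\<lambda>y. \<bar>h y - h x\<bar>) \<longlongrightarrow> 0) (at x)" by (rule tendsto_rabs_zero)
    have "\<forall>\<^sub>F y in at x. y > 0" by (rule order_tendstoD(1)[OF tendsto_ident_at x])
    moreover have "\<forall>\<^sub>F y in at x. y \<noteq> x" by (simp add: eventually_at_filter)
    ultimately show "\<forall>\<^sub>F y in at x. norm ((m y - m x) / (y - x) - h x) \<le> \<bar>h y - h x\<bar>"
    proof eventually_elim
      case (elim y)
      have 1: "(y - x) * h x \<le> m y - m x" using chord[of x y] elim x by simp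
      have 2: "m y - m x \<le> (y - x) * h y" using chord[of y x] elim x by (simp add: algebra_simps)
      show ?case
      proof (cases "y > x")
        case True
        then have "h x \<le> (m y - m x) / (y - x)" "(m y - m x) / (y - x) \<le> h y"
          using 1 2 by (simp_all add: field_simps)
        then show ?thesis by simp
      next
        case False
        then have "y - x < 0" using elim by simp
        then have "(m y - m x) / (y - x) \<le> h x" "h y \<le> (m y - m x) / (y - x)"
          using 1 2 by (simp_all add: field_simps)
        then show ?thesis by simp
      qed
    qed
  qed
  \<comment> \<open>Bounds the integral of \<beta>\<theta> / (1 - \<alpha>\<theta>) over [0, x] from
    above: 1 - \<alpha>\<theta> is replaced by its smallest value 1 - \<alpha>x. The goal is that m
    exp (-Q) does not increase.\<close>
  define Q where "Q x = \<beta> * x\<^sup>2 / (2 * (1 - \<alpha> * x))" for x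
  define Q' where "Q' x = \<beta> * (2 * x - \<alpha> * x\<^sup>2) / (2 * (1 - \<alpha> * x)\<^sup>2)" for x
  have less1: "\<alpha> * x < 1" if "x \<le> t" for x
    using mult_left_mono[OF that \<alpha>] t(2) by linarith
  have dQ: "(Q has_real_derivative Q' x) (at x)" if "x \<le> t" for x
  proof -
    have nz: "1 - \<alpha> * x \<noteq> 0" using less1[OF that] by simp
    have "(Q has_real_derivative (\<beta> * (2 * x) * (2 * (1 - \<alpha> * x)) - \<beta> * x\<^sup>2 * (2 * (- \<alpha>))) / (2 * (1 - \<alpha> * x) * (2 * (1 - \<alpha> * x)))) (at x)"
      unfolding Q_def using nz by (auto intro!: derivative_eq_intros)
    moreover have "(\<beta> * (2 * x) * (2 * (1 - \<alpha> * x)) - \<beta> * x\<^sup>2 * (2 * (- \<alpha>))) / (2 * (1 - \<alpha> * x) * (2 * (1 - \<alpha> * x))) = Q' x"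
    proof -
      have "\<beta> * (2 * x) * (2 * (1 - \<alpha> * x)) - \<beta> * x\<^sup>2 * (2 * (- \<alpha>)) = 2 * (\<beta> * (2 * x - \<alpha> * x\<^sup>2))"
        "2 * (1 - \<alpha> * x) * (2 * (1 - \<alpha> * x)) = 2 * (2 * (1 - \<alpha> * x)\<^sup>2)"
        by (simp_all add: algebra_simps power2_eq_square)
      then show ?thesis unfolding Q'_def by (simp only: mult_divide_mult_cancel_left_if) simp
    qed
    ultimately show ?thesis by simp
  qed
  have "m t * exp (- Q t) \<le> m 0 * exp (- Q 0)"
  proof (rule DERIV_nonpos_imp_decreasing_open[OF t(1)])
    fix x assume x: "0 < x" "x < t"
    have m0: "0 \<le> m x" unfolding m_def by (intro integral_nonneg_AE) simp
    have c: "0 < 1 - \<alpha> * x" using less1[of x] x by simp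
    have "h x * (1 - \<alpha> * x) \<le> \<beta> * x * m x" using ineq[of x] x by (simp add: h_def m_def algebra_simps)
    then have "h x \<le> \<beta> * x / (1 - \<alpha> * x) * m x" using c by (simp add: field_simps)
    \<comment> \<open>The difference of the two sides is \<alpha>\<beta>x^2 / (2 (1 -
      \<alpha>x)^2).\<close>
    also have "\<beta> * x / (1 - \<alpha> * x) \<le> Q' x"
    proof -
      have "\<beta> * x / (1 - \<alpha> * x) = \<beta> * (2 * x * (1 - \<alpha> * x)) / (2 * (1 - \<alpha> * x)\<^sup>2)"
      proof -
        have "\<beta> * x / b = \<beta> * (2 * x * b) / (2 * b\<^sup>2)" if "b \<noteq> 0" for b
          using that by (simp add: field_simps power2_eq_square)
        then show ?thesis using c by simp
      qed
      also have "\<dots> \<le> Q' x"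
      proof -
        have "0 \<le> \<alpha> * x\<^sup>2" using \<alpha> by simp
        then have "2 * x * (1 - \<alpha> * x) \<le> 2 * x - \<alpha> * x\<^sup>2" by (simp add: algebra_simps power2_eq_square)
        then show ?thesis
          unfolding Q'_def by (rule divide_right_mono[OF mult_left_mono[OF _ \<beta>]]) simp
      qed
      finally show ?thesis .
    qed
    then have "\<beta> * x / (1 - \<alpha> * x) * m x \<le> Q' x * m x" using m0 by (rule mult_right_mono)
    finally have le: "h x - Q' x * m x \<le> 0" by simp
    have "((\<lambda>x. m x * exp (- Q x)) has_real_derivative h x * exp (- Q x) + exp (- Q x) * (- Q' x) * m x) (at x)"
      using x by (intro DERIV_mult dm DERIV_chain2[OF DERIV_exp] DERIV_minus dQ) auto
    moreover have "h x * exp (- Q x) + exp (- Q x) * (- Q' x) * m x = (h x - Q' x * m x) * exp (- Q x)"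
      by (simp add: algebra_simps)
    moreover have "(h x - Q' x * m x) * exp (- Q x) \<le> 0" using le by (simp add: mult_nonpos_nonneg)
    ultimately show "\<exists>y. ((\<lambda>x. m x * exp (- Q x)) has_real_derivative y) (at x) \<and> y \<le> 0" by auto
  next
    have "continuous_on {0..t} Q"
      by (intro continuous_at_imp_continuous_on ballI DERIV_isCont[OF dQ]) simp
    then show "continuous_on {0..t} (\<lambda>x. m x * exp (- Q x))"
      by (intro continuous_intros continuous_on_subset[OF cm]) auto
  qed
  then have "m t * exp (- Q t) \<le> 1" by (simp add: m_def Q_def prob_space)
  then show "(\<integral>\<omega>. exp (t * s \<omega>) \<partial>M) \<le> exp (\<beta> * t\<^sup>2 / (2 * (1 - \<alpha> * t)))"
    by (simp add: m_def Q_def exp_minus field_simps)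
qed

section \<open>The Stein-type inequality and the exponential estimate\<close>

context isonormal_gaussian_process
begin

text \<open>f'(Z) is measurable with respect to the \<sigma>-algebra of Z, so the inner product in
  the duality may be replaced by its conditional expectation; f' \<ge> 0 then preserves the almost
  sure bound on it.\<close>

lemma stein_inequality:
  assumes Z: "Z \<in> D12 M X" and mean: "(\<integral>\<omega>. Z \<omega> \<partial>M) = 0"
    and g: "AE \<omega> in M. g_of M X Z \<omega> \<le> \<alpha> * Z \<omega> + \<beta>"
    and f: "smooth_real f" and d: "\<And>x. (f has_real_derivative f' x) (at x)" and cont: "continuous_on UNIV f'"
    and f': "\<And>x. 0 \<le> f' x" "\<And>x. f' x \<le> B"
  shows "square_integrable M (\<lambda>\<omega>. f (Z \<omega>))"
    and "(\<integral>\<omega>. Z \<omega> * f (Z \<omega>) \<partial>M) \<le> (\<integral>\<omega>. f' (Z \<omega>) * (\<alpha> * Z \<omega> + \<beta>) \<partial>M)"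
proof -
  define U where "U = malliavin_deriv M X Z"
  define V where "V = malliavin_deriv M X (L_inv M X Z)"
  have U: "has_malliavin_deriv M X Z U"
    using Z someI_ex[of "has_malliavin_deriv M X Z"] unfolding U_def malliavin_deriv_def D12_def by blast
  then have sZ: "square_integrable M Z" and sU: "square_integrable M U" by (auto simp: has_malliavin_deriv_def)
  have V: "has_malliavin_deriv M X (L_inv M X Z) V"
    using L_inv_converges_in_D12(3)[OF sZ] someI_ex[of "has_malliavin_deriv M X (L_inv M X Z)"]
    unfolding V_def malliavin_deriv_def D12_def by blast
  then have sV: "square_integrable M V" by (auto simp: has_malliavin_deriv_def)
  have one: "square_integrable M (\<lambda>\<omega>. 1 :: real)" by (simp add: square_integrable_def)
  have [measurable]: "f' \<in> borel_measurable borel" using cont by (rule borel_measurable_continuous_onI)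
  have [measurable]: "Z \<in> borel_measurable M" "U \<in> borel_measurable M" "V \<in> borel_measurable M" using sZ sU sV by auto
  have iZ: "integrable M Z" using integrable_mult_sq[OF sZ one] by simp
  \<comment> \<open>The duality asks for f(0) = 0, which keeps compositions compactly supported.
    Subtracting the constant leaves the left-hand side unchanged because Z has mean 0.\<close>
  let ?f0 = "\<lambda>x. f x - f 0"
  have f0: "smooth_real ?f0" "?f0 0 = 0" using smooth_real_diff_const[OF f] by auto
  have d0: "(?f0 has_real_derivative f' x) (at x)" for x
    using DERIV_diff[OF d[of x] DERIV_const, of "f 0"] by simp
  have ab: "\<bar>f' x\<bar> \<le> B" for x using f' by simp
  note dual = malliavin_L_inv_duality[OF mean U V f0 d0 cont ab]
  have "square_integrable M (\<lambda>\<omega>. ?f0 (Z \<omega>) + f 0 * 1)"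
    by (intro square_integrable_add square_integrable_mult dual(1) one)
  then show sf: "square_integrable M (\<lambda>\<omega>. f (Z \<omega>))" by simp
  let ?q = "\<lambda>\<omega>. inner (U \<omega>) (- V \<omega>)" and ?F = "vimage_algebra (space M) Z borel"
  have iq: "integrable M ?q" by (intro integrable_inner sU square_integrable_uminus sV)
  have sub: "subalgebra M ?F"
    unfolding subalgebra_def
  proof
    show "sets ?F \<subseteq> sets M" by (auto simp: sets_vimage_algebra2)
  qed simp
  interpret F: finite_measure_subalgebra M ?F by standard (rule sub)
  have Zm: "Z \<in> measurable ?F borel" by (rule measurable_vimage_algebra1) simp
  have fZm: "(\<lambda>\<omega>. f' (Z \<omega>)) \<in> borel_measurable ?F"
    by (rule measurable_compose[OF Zm borel_measurable_continuous_onI[OF cont]])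
  have ifq: "integrable M (\<lambda>\<omega>. f' (Z \<omega>) * ?q \<omega>)"
    using integrable_mult_bounded[OF iq, of "\<lambda>\<omega>. f' (Z \<omega>)" B] ab by (simp add: mult.commute)
  have cond: "integrable M (\<lambda>\<omega>. f' (Z \<omega>) * g_of M X Z \<omega>)"
    "(\<integral>\<omega>. f' (Z \<omega>) * g_of M X Z \<omega> \<partial>M) = (\<integral>\<omega>. f' (Z \<omega>) * ?q \<omega> \<partial>M)"
    unfolding g_of_def U_def[symmetric] V_def[symmetric]
    using F.real_cond_exp_intg[OF ifq fZm] iq by auto
  have ilin: "integrable M (\<lambda>\<omega>. f' (Z \<omega>) * (\<alpha> * Z \<omega> + \<beta>))"
    using integrable_mult_bounded[of M "\<lambda>\<omega>. \<alpha> * Z \<omega> + \<beta>" "\<lambda>\<omega>. f' (Z \<omega>)" B] iZ ab by (simp add: mult.commute)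
  have "(\<integral>\<omega>. Z \<omega> * f (Z \<omega>) \<partial>M) = (\<integral>\<omega>. Z \<omega> * ?f0 (Z \<omega>) \<partial>M)"
    using mean iZ integrable_mult_sq[OF sZ sf] by (simp add: right_diff_distrib)
  also have "\<dots> = (\<integral>\<omega>. f' (Z \<omega>) * g_of M X Z \<omega> \<partial>M)" using dual(2) cond(2) by simp
  also have "\<dots> \<le> (\<integral>\<omega>. f' (Z \<omega>) * (\<alpha> * Z \<omega> + \<beta>) \<partial>M)"
    by (rule integral_mono_AE[OF cond(1) ilin]) (use g in eventually_elim, auto intro: mult_left_mono f')
  finally show "(\<integral>\<omega>. Z \<omega> * f (Z \<omega>) \<partial>M) \<le> (\<integral>\<omega>. f' (Z \<omega>) * (\<alpha> * Z \<omega> + \<beta>) \<partial>M)" .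
qed

text \<open>The Stein inequality for exp (\<theta> s(Z)) becomes a closed inequality for s(Z),
  because s lies below the identity and below its tangents. The price of the tangent at 0 is that
  \<beta> grows to \<beta> - \<alpha>s(0), which returns to \<beta> as k grows.\<close>

lemma softmin_tail_bound:
  assumes Z: "Z \<in> D12 M X" and mean: "(\<integral>\<omega>. Z \<omega> \<partial>M) = 0"
    and \<alpha>: "\<alpha> \<ge> 0" and \<beta>: "\<beta> > 0"
    and g: "AE \<omega> in M. g_of M X Z \<omega> \<le> \<alpha> * Z \<omega> + \<beta>"
    and k: "k > 0" and z: "z > 0" and t: "t \<ge> 0" "\<alpha> * t < 1"
  shows "prob {\<omega>\<in>space M. z \<le> Z \<omega>}
    \<le> exp (- t * softmin k z z + (\<beta> - \<alpha> * softmin k z 0) * t\<^sup>2 / (2 * (1 - \<alpha> * t)))"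
proof -
  let ?s = "softmin k z" and ?\<sigma> = "softmin_deriv k z"
  have sZ: "square_integrable M Z" using Z by (auto simp: D12_def has_malliavin_deriv_def)
  have [measurable]: "Z \<in> borel_measurable M" using sZ by auto
  have one: "square_integrable M (\<lambda>\<omega>. 1 :: real)" by (simp add: square_integrable_def)
  have iZ: "integrable M Z" using integrable_mult_sq[OF sZ one] by simp
  have "continuous_on UNIV ?s" using DERIV_softmin[OF k] by (meson DERIV_isCont continuous_at_imp_continuous_on)
  then have [measurable]: "?s \<in> borel_measurable borel" by (rule borel_measurable_continuous_onI)
  have c\<sigma>: "continuous_on UNIV ?\<sigma>" using DERIV_softmin_deriv by (meson DERIV_isCont continuous_at_imp_continuous_on)
  then have [measurable]: "?\<sigma> \<in> borel_measurable borel" by (rule borel_measurable_continuous_onI)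
  have si: "integrable M (\<lambda>\<omega>. ?s (Z \<omega>))"
  proof (rule Bochner_Integration.integrable_bound)
    show "integrable M (\<lambda>\<omega>. \<bar>Z \<omega>\<bar> + \<bar>?s 0\<bar>)" using iZ by simp
    show "AE \<omega> in M. norm (?s (Z \<omega>)) \<le> norm (\<bar>Z \<omega>\<bar> + \<bar>?s 0\<bar>)" using softmin_abs_le[OF k] by simp
  qed measurable
  \<comment> \<open>At least \<beta>, since s(0) \<le> 0.\<close>
  define \<beta>' where "\<beta>' = \<beta> - \<alpha> * ?s 0"
  have s0: "?s 0 \<le> 0" by (rule softmin_le(1)[OF k])
  then have \<beta>': "\<beta>' \<ge> 0" using \<alpha> \<beta> mult_nonneg_nonpos[OF \<alpha> s0] by (simp add: \<beta>'_def)
  have eb: "exp (\<theta> * ?s x) \<le> exp (\<theta> * z)" if "\<theta> \<ge> 0" for \<theta> x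
    using softmin_le(2)[OF k, of z x] that by (simp add: mult_left_mono)
  have ie: "integrable M (\<lambda>\<omega>. w \<omega> * exp (\<theta> * ?s (Z \<omega>)))" if "integrable M w" "\<theta> \<ge> 0" for w \<theta>
    by (rule integrable_mult_bounded[OF that(1), where C = "exp (\<theta> * z)"]) (use eb[OF that(2)] in auto)
  have ineq: "(\<integral>\<omega>. ?s (Z \<omega>) * exp (\<theta> * ?s (Z \<omega>)) \<partial>M)
      \<le> \<theta> * (\<alpha> * (\<integral>\<omega>. ?s (Z \<omega>) * exp (\<theta> * ?s (Z \<omega>)) \<partial>M) + \<beta>' * (\<integral>\<omega>. exp (\<theta> * ?s (Z \<omega>)) \<partial>M))"
    if \<theta>: "\<theta> \<ge> 0" for \<theta>
  proof -
    let ?e = "\<lambda>x. exp (\<theta> * ?s x)" and ?f' = "\<lambda>x. exp (\<theta> * ?s x) * (\<theta> * ?\<sigma> x)"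
    have d: "(?e has_real_derivative ?f' x) (at x)" for x
      by (intro DERIV_chain2[OF DERIV_exp] DERIV_cmult DERIV_softmin k)
    have cf': "continuous_on UNIV ?f'" by (intro continuous_intros c\<sigma> \<open>continuous_on UNIV ?s\<close>)
    have b1: "0 \<le> ?f' x" for x using \<theta> softmin_deriv_bounds(1)[of k z x] by simp
    have b2: "?f' x \<le> exp (\<theta> * z) * (\<theta> * 1)" for x
      using \<theta> softmin_deriv_bounds[of k z x] eb[OF \<theta>, of x] by (intro mult_mono) auto
    have st: "(\<integral>\<omega>. Z \<omega> * ?e (Z \<omega>) \<partial>M) \<le> (\<integral>\<omega>. ?f' (Z \<omega>) * (\<alpha> * Z \<omega> + \<beta>) \<partial>M)"
      by (rule stein_inequality(2)[OF Z mean g smooth_real_exp_softmin[OF k] d cf' b1 b2])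
    have "(\<integral>\<omega>. ?s (Z \<omega>) * ?e (Z \<omega>) \<partial>M) \<le> (\<integral>\<omega>. Z \<omega> * ?e (Z \<omega>) \<partial>M)"
      using softmin_le(1)[OF k] by (intro integral_mono ie si iZ \<theta> mult_right_mono) auto
    also note st
    also have "(\<integral>\<omega>. ?f' (Z \<omega>) * (\<alpha> * Z \<omega> + \<beta>) \<partial>M) \<le> (\<integral>\<omega>. (\<theta> * (\<alpha> * ?s (Z \<omega>) + \<beta>')) * ?e (Z \<omega>) \<partial>M)"
    proof (rule integral_mono)
      have "integrable M (\<lambda>\<omega>. (\<alpha> * Z \<omega> + \<beta>) * ?f' (Z \<omega>))"
        by (rule integrable_mult_bounded[where C = "exp (\<theta> * z) * (\<theta> * 1)"]) (use iZ b1 b2 in auto)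
      then show "integrable M (\<lambda>\<omega>. ?f' (Z \<omega>) * (\<alpha> * Z \<omega> + \<beta>))" by (simp add: mult.commute)
      show "integrable M (\<lambda>\<omega>. (\<theta> * (\<alpha> * ?s (Z \<omega>) + \<beta>')) * ?e (Z \<omega>))"
        using si by (intro ie \<theta>) auto
      fix \<omega>
      let ?x = "Z \<omega>"
      have "(\<alpha> * ?x + \<beta>) * ?\<sigma> ?x = \<alpha> * (?x * ?\<sigma> ?x) + \<beta> * ?\<sigma> ?x" by (simp add: algebra_simps)
      also have "\<dots> \<le> \<alpha> * (?s ?x - ?s 0) + \<beta> * 1"
        using \<alpha> \<beta> softmin_tangent[OF k, of ?x z] softmin_deriv_bounds[of k z ?x] by (intro add_mono mult_left_mono) auto
      also have "\<dots> = \<alpha> * ?s ?x + \<beta>'" by (simp add: \<beta>'_def algebra_simps)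
      finally have "(\<theta> * ?e ?x) * ((\<alpha> * ?x + \<beta>) * ?\<sigma> ?x) \<le> (\<theta> * ?e ?x) * (\<alpha> * ?s ?x + \<beta>')"
        using \<theta> by (intro mult_left_mono) auto
      then show "?f' ?x * (\<alpha> * ?x + \<beta>) \<le> (\<theta> * (\<alpha> * ?s ?x + \<beta>')) * ?e ?x" by (simp add: ac_simps)
    qed
    also have "\<dots> = (\<integral>\<omega>. \<theta> * (\<alpha> * (?s (Z \<omega>) * ?e (Z \<omega>)) + \<beta>' * ?e (Z \<omega>)) \<partial>M)"
      by (intro Bochner_Integration.integral_cong refl) (simp add: algebra_simps)
    also have "\<dots> = \<theta> * (\<alpha> * (\<integral>\<omega>. ?s (Z \<omega>) * ?e (Z \<omega>) \<partial>M) + \<beta>' * (\<integral>\<omega>. ?e (Z \<omega>) \<partial>M))"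
      using ie[OF si \<theta>] ie[of "\<lambda>_. 1", OF _ \<theta>] by simp
    finally show ?thesis .
  qed
  note mg = moment_generating_bound[OF si softmin_le(2)[OF k] \<alpha> \<beta>' ineq t]
  \<comment> \<open>Monotonicity of \<open>softmin\<close> carries the event Z \<ge> z over to s(Z)
    \<ge> s(z), to which Markov's inequality applies.\<close>
  have "prob {\<omega>\<in>space M. z \<le> Z \<omega>} \<le> prob {\<omega>\<in>space M. exp (t * ?s z) \<le> exp (t * ?s (Z \<omega>))}"
    using t(1) softmin_mono[OF k] by (intro finite_measure_mono) (auto intro: mult_left_mono)
  also have "\<dots> \<le> (\<integral>\<omega>. exp (t * ?s (Z \<omega>)) \<partial>M) / exp (t * ?s z)"
    by (rule integral_Markov_inequality_measure[OF mg(1) sets.top]) auto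
  also have "\<dots> \<le> exp (\<beta>' * t\<^sup>2 / (2 * (1 - \<alpha> * t))) / exp (t * ?s z)"
    by (rule divide_right_mono[OF mg(2) exp_ge_zero])
  also have "\<dots> = exp (- t * ?s z + \<beta>' * t\<^sup>2 / (2 * (1 - \<alpha> * t)))"
    by (simp add: exp_diff[symmetric])
  finally show ?thesis by (simp add: \<beta>'_def)
qed

end

theorem theorem4p1:
  fixes M :: "'a measure"
    and X :: "'h::{real_inner, complete_space, second_countable_topology} \<Rightarrow> 'a \<Rightarrow> real"
    and Z :: "'a \<Rightarrow> real"
    and \<rho> :: "real \<Rightarrow> ennreal"
    and \<alpha> \<beta> :: real
  assumes "isonormal_gaussian_process M X"
    and "Z \<in> D12 M X"
    and "(\<integral>\<omega>. Z \<omega> \<partial>M) = 0"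
    and "\<alpha> \<ge> 0" and "\<beta> > 0"
    and "AE \<omega> in M. g_of M X Z \<omega> \<le> \<alpha> * Z \<omega> + \<beta>"
    and "distributed M lborel Z \<rho>"
  shows "\<forall>z>0. \<P>(\<omega> in M. Z \<omega> \<ge> z) \<le> exp (- (z\<^sup>2 / (2 * \<alpha> * z + 2 * \<beta>)))"
proof (intro allI impI)
  fix z :: real assume z: "z > 0"
  interpret isonormal_gaussian_process M X by (rule assms)
  define D where "D = \<alpha> * z + \<beta>"
  have D: "D > 0" using assms(4,5) z by (simp add: D_def add_nonneg_pos)
  \<comment> \<open>The solution of \<beta>t / (1 - \<alpha>t) = z, for which 1 - \<alpha>t =
    \<beta>/D. The limiting exponent is then - z^2/D + z^2/(2D).\<close>
  define t where "t = z / D"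
  have t: "t \<ge> 0" "\<alpha> * t < 1" "1 - \<alpha> * t = \<beta> / D"
    using z D assms(5) by (simp_all add: t_def D_def field_simps)
  let ?k = "\<lambda>n. real (Suc n)"
  let ?b = "\<lambda>n. exp (- t * softmin (?k n) z z + (\<beta> - \<alpha> * softmin (?k n) z 0) * t\<^sup>2 / (2 * (1 - \<alpha> * t)))"
  have l1: "(\<lambda>n. softmin (?k n) z z) \<longlonglongrightarrow> z"
  proof -
    \<comment> \<open>On the diagonal both exponentials agree, and the gap to the minimum is exactly
      ln 2 / k.\<close>
    have "softmin (?k n) z z = z - ln 2 / ?k n" for n
    proof -
      have "ln (exp (- ?k n * z) + exp (- ?k n * z)) = ln 2 + (- ?k n * z)"
        by (subst mult_2[symmetric]) (simp add: ln_mult)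
      then show ?thesis unfolding softmin_def by (simp only:) (simp add: field_simps)
    qed
    moreover have "(\<lambda>n. z - ln 2 / ?k n) \<longlonglongrightarrow> z" by real_asymp
    ultimately show ?thesis by simp
  qed
  have l2: "(\<lambda>n. softmin (?k n) z 0) \<longlonglongrightarrow> 0"
  proof -
    have "(\<lambda>n. - ln (1 + exp (- ?k n * z)) / ?k n) \<longlonglongrightarrow> 0" using z by real_asymp
    then show ?thesis by (simp add: softmin_def)
  qed
  have "?b \<longlonglongrightarrow> exp (- t * z + (\<beta> - \<alpha> * 0) * t\<^sup>2 / (2 * (1 - \<alpha> * t)))"
    using t D assms(5) by (intro tendsto_intros l1 l2) auto
  moreover have "- t * z + (\<beta> - \<alpha> * 0) * t\<^sup>2 / (2 * (1 - \<alpha> * t)) = - (z\<^sup>2 / (2 * \<alpha> * z + 2 * \<beta>))"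
  proof -
    have "- t * z + (\<beta> - \<alpha> * 0) * t\<^sup>2 / (2 * (1 - \<alpha> * t)) = - (z\<^sup>2 / (2 * D))"
      unfolding t(3) using D assms(5) by (simp add: t_def field_simps power2_eq_square)
    then show ?thesis by (simp add: D_def algebra_simps)
  qed
  ultimately have "?b \<longlonglongrightarrow> exp (- (z\<^sup>2 / (2 * \<alpha> * z + 2 * \<beta>)))" by (simp only:)
  moreover have "\<P>(\<omega> in M. Z \<omega> \<ge> z) \<le> ?b n" for n
    using softmin_tail_bound[OF assms(2-6) _ z t(1,2), of "?k n"] by simp
  ultimately show "\<P>(\<omega> in M. Z \<omega> \<ge> z) \<le> exp (- (z\<^sup>2 / (2 * \<alpha> * z + 2 * \<beta>)))"
    by (intro LIMSEQ_le_const) auto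
qed

end
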